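(* Let $\Phi,\Psi$ be two subsets of $L^2(\mathbb{R}^n)$ with $\Psi$ finite and $\Phi$ countable. Suppose the following relations are satisfied for a.e. $\xi\in\mathbb{R}^n$: $$\sum_{\varphi\in\Phi}|\widehat{\varphi}|^2(\xi)<\infty;$$ $$-\sum_{\varphi\in\Phi}\widehat{\varphi}(\xi)\overline{\widehat{\varphi}(\xi+2s\pi)}=\sum_{\psi\in\Psi}\widehat{\psi}(\xi)\overline{\widehat{\psi}(\xi+2s\pi)},\qquad (s\in\mathbb{Z}^n\setminus A^*\mathbb{Z}^n);$$ $$\sum_{\varphi\in\Phi}\widehat{\varphi}((A^* )^{-1}\xi)\overline{\widehat{\varphi}((A^* )^{-1}(\xi+2s\pi))}-\sum_{\varphi\in\Phi}\widehat{\varphi}(\xi)\overline{\widehat{\varphi}(\xi+2s\pi)}=\sum_{\psi\in\Psi}\widehat{\psi}(\xi)\overline{\widehat{\psi}(\xi+2s\pi)},\qquad (s\in A^*\mathbb{Z}^n);$$ $$\lim_{J\rightarrow\infty}\sum_{\varphi\in\Phi}|\widehat{\varphi}|^2((A^* )^J\xi)=0;$$ $$\lim_{J\rightarrow\infty}\sum_{\varphi\in\Phi}|\widehat{\varphi}|^2((A^* )^{-J}\xi)=1.$$ Then $$\{D_A^jT_k\psi\,|\,j\in\mathbb{Z},k\in\mathbb{Z}^n,\psi\in\Psi\}$$ is a normalized tight frame for $L^2(\mathbb{R}^n)$.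
   Context: $A$ is a fixed $n\times n$ matrix, all of whose eigenvalues $\lambda$ satisfy $|\lambda|>1$, with $A\mathbb{Z}^n\subset\mathbb{Z}^n$; $A^*$ is its adjoint (transpose). On $L^2(\mathbb{R}^n)$ put $T_kf(\xi)=f(\xi-k)$ for $k\in\mathbb{Z}^n$ and $D_Af(\xi)=|\det A|^{1/2}f(A\xi)$. The Fourier transform is $\widehat f(\xi)=\int_{\mathbb{R}^n}f(x)e^{-i\langle x\,|\,\xi\rangle}\,dx$ (extended to $L^2(\mathbb{R}^n)$). A family $\{e_i\}_{i\in I}$ in a Hilbert space $H$ is a normalized tight frame (NTF) for $H$ if $\sum_{i\in I}|\langle f\,|\,e_i\rangle|^2=\|f\|^2$ for all $f\in H$. The system $\{D_A^jT_k\psi\}$ is regarded as a family indexed by $(j,k,\psi)\in\mathbb{Z}\times\mathbb{Z}^n\times\Psi$. *)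

theory Defs
  imports "HOL-Analysis.Analysis"
begin

definition int_lattice :: "(real^'n) set" where
  "int_lattice = {x. \<forall>i. x $ i \<in> \<int>}"

text \<open>Eigenvalues of a real matrix are its complex ones.\<close>

definition eigenvalues :: "real^'n^'n \<Rightarrow> complex set" where
  "eigenvalues A = {\<mu>. \<exists>v::complex^'n. v \<noteq> 0 \<and>
      (\<chi> i j. complex_of_real (A $ i $ j)) *v v = \<mu> *s v}"

text \<open>Elements of \<open>L\<^sup>2\<close> are represented by square-integrable functions, not by their
  almost-everywhere classes. A set of such functions may thus contain several representatives
  of one class, which then count with multiplicity.\<close>

definition L2 :: "(real^'n \<Rightarrow> complex) set" where
  "L2 = {f. f \<in> borel_measurable lebesgue \<and> integrable lebesgue (\<lambda>x. (cmod (f x))\<^sup>2)}"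

definition l2_inner :: "(real^'n \<Rightarrow> complex) \<Rightarrow> (real^'n \<Rightarrow> complex) \<Rightarrow> complex" where
  "l2_inner f g = (LINT x|lebesgue. f x * cnj (g x))"

definition l2_norm :: "(real^'n \<Rightarrow> complex) \<Rightarrow> real" where
  "l2_norm f = sqrt (LINT x|lebesgue. (cmod (f x))\<^sup>2)"

definition translation :: "real^'n \<Rightarrow> (real^'n \<Rightarrow> complex) \<Rightarrow> real^'n \<Rightarrow> complex" where
  "translation k f = (\<lambda>x. f (x - k))"

definition dilation :: "real^'n^'n \<Rightarrow> (real^'n \<Rightarrow> complex) \<Rightarrow> real^'n \<Rightarrow> complex" where
  "dilation A f = (\<lambda>x. complex_of_real (sqrt \<bar>det A\<bar>) * f (A *v x))"

text \<open>Integer powers of a bijective operator.\<close>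

definition zpow :: "('a \<Rightarrow> 'a) \<Rightarrow> int \<Rightarrow> 'a \<Rightarrow> 'a" where
  "zpow F j = (if 0 \<le> j then F ^^ nat j else inv F ^^ nat (- j))"

text \<open>For invertible \<open>A\<close>, the operator \<open>dilation A\<close> is bijective on the space of all functions,
  so the inverse used by \<open>zpow\<close> is the genuine one.\<close>

lemma
  fixes A :: "real^'n^'n"
  assumes "invertible A"
  shows bij_dilation: "bij (dilation A)"
    and inv_dilation: "inv (dilation A) = dilation (matrix_inv A)"
proof -
  have i: "A ** matrix_inv A = mat 1" "matrix_inv A ** A = mat 1"
    using someI_ex[OF assms[unfolded invertible_def]] by (simp_all add: matrix_inv_def)
  have "det A * det (matrix_inv A) = 1"
    by (metis det_I det_mul i(1))
  then have "sqrt \<bar>det A\<bar> * sqrt \<bar>det (matrix_inv A)\<bar> = 1"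
    by (simp flip: real_sqrt_mult abs_mult)
  then have s: "complex_of_real (sqrt \<bar>det A\<bar>) * complex_of_real (sqrt \<bar>det (matrix_inv A)\<bar>) = 1"
    by (metis of_real_1 of_real_mult)
  have s': "complex_of_real (sqrt \<bar>det (matrix_inv A)\<bar>) * complex_of_real (sqrt \<bar>det A\<bar>) = 1"
    using s by (simp only: mult.commute)
  have l: "dilation (matrix_inv A) (dilation A f) = f" for f :: "real^'n \<Rightarrow> complex"
    unfolding dilation_def mult.assoc[symmetric] s' by (simp add: matrix_vector_mul_assoc i)
  have r: "dilation A (dilation (matrix_inv A) f) = f" for f :: "real^'n \<Rightarrow> complex"
    unfolding dilation_def mult.assoc[symmetric] s by (simp add: matrix_vector_mul_assoc i)
  show "bij (dilation A)" by (rule o_bij[of "dilation (matrix_inv A)"]) (auto simp: l r)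
  show "inv (dilation A) = dilation (matrix_inv A)"
    by (rule inv_unique_comp) (auto simp: l r)
qed

definition fourier_L1 :: "(real^'n \<Rightarrow> complex) \<Rightarrow> real^'n \<Rightarrow> complex" where
  "fourier_L1 f \<xi> = (LINT x|lebesgue. f x * exp (- (\<i> * complex_of_real (x \<bullet> \<xi>))))"

text \<open>The extension to \<open>L\<^sup>2\<close>: the truncations of \<open>f\<close> to balls are integrable and converge to
  \<open>f\<close> in \<open>L\<^sup>2\<close>, and the transform of \<open>f\<close> is (a representative of) the \<open>L\<^sup>2\<close>-limit of their
  transforms, which determines it up to null sets.\<close>

definition fourier :: "(real^'n \<Rightarrow> complex) \<Rightarrow> real^'n \<Rightarrow> complex" where
  "fourier f = (SOME g. g \<in> L2 \<and>
     ((\<lambda>R::real. \<integral>\<^sup>+ \<xi>. ennreal ((cmod (fourier_L1 (\<lambda>x. indicator (ball 0 R) x * f x) \<xi> - g \<xi>))\<^sup>2)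
        \<partial>lebesgue) \<longlongrightarrow> 0) at_top)"

definition normalized_tight_frame ::
    "'i set \<Rightarrow> ('i \<Rightarrow> real^'n \<Rightarrow> complex) \<Rightarrow> bool" where
  "normalized_tight_frame I e \<longleftrightarrow> (\<forall>i\<in>I. e i \<in> L2) \<and>
     (\<forall>f\<in>L2. ((\<lambda>i. (cmod (l2_inner f (e i)))\<^sup>2) has_sum (l2_norm f)\<^sup>2) I)"

end

theory Submission
  imports Defs "HOL-Probability.Probability" "HOL-Computational_Algebra.Fundamental_Theorem_Algebra"
begin

text \<open>
  The operators are transported to the Fourier side. There it suffices to work with bounded Borel functions \<open>g\<close>
  of bounded support (\<open>test_function\<close>), because their inverse transforms \<open>u = ift g\<close> are dense in \<open>L\<^sup>2\<close>
  (\<open>ift_dense\<close>) and the frame identity passes from a dense set to its closure (\<open>tight_frame_extension\<close>).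

  For a countable system \<open>\<Theta>\<close> let \<open>E\<^sub>\<Theta>(u)\<close> be the sum of \<open>|\<langle>u, T\<^sub>k \<theta>\<rangle>|\<^sup>2\<close> over \<open>k\<close> in the integer lattice and \<open>\<theta> \<in> \<Theta>\<close>.
  The numbers \<open>\<langle>u, T\<^sub>k \<theta>\<rangle>\<close> are Fourier coefficients of a function of bounded support. Summing its translates
  by \<open>2 \<pi> s\<close> into a function on the cube and applying Parseval's identity there gives (\<open>ft_periodization\<close>,
  \<open>energy_ift\<close>), up to the factor \<open>(2 \<pi>)\<^sup>n\<close>, the sum over lattice points \<open>s\<close> of the integrals of
  \<open>cnj (g \<xi>) * g (\<xi> + 2 \<pi> s) * C\<^sub>\<Theta>(s, \<xi>)\<close>, where \<open>C\<^sub>\<Theta>(s, \<xi>)\<close> is the sum over \<open>\<theta> \<in> \<Theta>\<close> of the transform of \<open>\<theta>\<close> at \<open>\<xi>\<close>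
  times its conjugate at \<open>\<xi> + 2 \<pi> s\<close>. Only finitely many \<open>s\<close> contribute.

  Write \<open>T\<close> for the transpose of \<open>A\<close>, \<open>B\<close> for the inverse of \<open>T\<close>, and \<open>D\<close> for the dilation by \<open>A\<close>. In these terms
  the equations for \<open>\<Phi>\<close> and \<open>\<Psi>\<close> state that \<open>C\<^sub>\<Phi>(s, \<sqdot>) + C\<^sub>\<Psi>(s, \<sqdot>)\<close> vanishes if \<open>s\<close> is not of the form \<open>T r\<close>, and
  that it equals \<open>C\<^sub>\<Phi>(r, B \<sqdot>)\<close> if \<open>s = T r\<close>. The change of variables \<open>\<xi> = B \<eta>\<close> in the formula for \<open>E\<^sub>\<Phi>(D\<^sup>-\<^sup>1 u)\<close>
  therefore yields \<open>E\<^sub>\<Phi>(D\<^sup>-\<^sup>1 u) = E\<^sub>\<Phi>(u) + E\<^sub>\<Psi>(u)\<close> (\<open>energy_refinement\<close>). As \<open>D\<close> is unitary, the frame sum of \<open>u\<close>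
  is the sum of \<open>E\<^sub>\<Psi>(D\<^sup>-\<^sup>j u)\<close> over all integers \<open>j\<close>. It telescopes to the difference of the limits of
  \<open>E\<^sub>\<Phi>(D\<^sup>-\<^sup>m u)\<close> and of \<open>E\<^sub>\<Phi>(D\<^sup>m u)\<close> for \<open>m \<rightarrow> \<infinity>\<close>.

  The first limit is the squared norm of \<open>u\<close> (\<open>energy_limit\<close>): the powers of \<open>B\<close> tend to \<open>0\<close>, so for large \<open>m\<close> only
  \<open>s = 0\<close> contributes, and what remains is the integral of \<open>|g(\<xi>)|\<^sup>2 h(B\<^sup>m \<xi>)\<close> with \<open>h = C\<^sub>\<Phi>(0, \<sqdot>)\<close>. The case
  \<open>s = 0\<close> of the equations says that \<open>h(B \<xi>) - h(\<xi>) = C\<^sub>\<Psi>(0, \<xi>) \<ge> 0\<close>. Hence \<open>h(B\<^sup>m \<xi>)\<close> increases to its limit \<open>1\<close>,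
  and \<open>h \<le> 1\<close> gives dominated convergence.

  The second limit is \<open>0\<close> (\<open>energy_vanishes\<close>): \<open>D\<^sup>m u\<close> concentrates at the origin, where all translates of all
  \<open>\<phi> \<in> \<Phi>\<close> together have little mass. This rests on two facts. The numbers \<open>E\<^sub>\<Phi>(D\<^sup>-\<^sup>m u)\<close> increase, so that
  \<open>E\<^sub>\<Phi>(u)\<close> is at most the squared norm of \<open>u\<close> (\<open>Bessel_translates\<close>). And the sum of the squared norms of the
  \<open>\<phi> \<in> \<Phi>\<close> is finite (\<open>P_summable\<close>): since \<open>h(T\<^sup>m \<xi>)\<close> tends to \<open>0\<close>, telescoping represents \<open>h(\<xi>)\<close> as the sum of
  \<open>C\<^sub>\<Psi>(0, T\<^sup>m \<xi>)\<close> over \<open>m \<ge> 1\<close>, whose integrals form a convergent geometric series because \<open>\<Psi>\<close> is finite and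
  \<open>|det A| > 1\<close>.

  The analytic tools are Plancherel's theorem, obtained by inserting Gaussians (\<open>plancherel_continuous\<close>) and
  passing to limits; Parseval's identity on the cube, derived from Plancherel's theorem and Bessel's inequality
  (\<open>Parseval_cube\<close>); the linear change of variables (\<open>nn_integral_lborel_matrix\<close>); and the decay of the powers of a
  matrix with spectrum in the open unit disc (\<open>funpow_matrix_tendsto_0\<close>).
\<close>

section \<open>Square-integrable functions\<close>

definition sq_integrable :: "'a measure \<Rightarrow> ('a \<Rightarrow> complex) \<Rightarrow> bool" where
  "sq_integrable M f \<longleftrightarrow> f \<in> borel_measurable M \<and> integrable M (\<lambda>x. (cmod (f x))\<^sup>2)"

definition ip :: "'a measure \<Rightarrow> ('a \<Rightarrow> complex) \<Rightarrow> ('a \<Rightarrow> complex) \<Rightarrow> complex" where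
  "ip M f g = (LINT x|M. f x * cnj (g x))"

definition nrm2 :: "'a measure \<Rightarrow> ('a \<Rightarrow> complex) \<Rightarrow> real" where
  "nrm2 M f = (LINT x|M. (cmod (f x))\<^sup>2)"

lemma sq_integrable_measurable [measurable_dest]: "sq_integrable M f \<Longrightarrow> f \<in> borel_measurable M"
  by (simp add: sq_integrable_def)

lemma sq_integrableD: "sq_integrable M f \<Longrightarrow> integrable M (\<lambda>x. (cmod (f x))\<^sup>2)"
  by (simp add: sq_integrable_def)

lemma sq_integrable_bound:
  assumes "sq_integrable M g" "f \<in> borel_measurable M" "AE x in M. cmod (f x) \<le> C * cmod (g x)"
  shows "sq_integrable M f"
  unfolding sq_integrable_def
proof
  show "integrable M (\<lambda>x. (cmod (f x))\<^sup>2)"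
  proof (rule Bochner_Integration.integrable_bound)
    show "integrable M (\<lambda>x. C\<^sup>2 * (cmod (g x))\<^sup>2)" using assms(1) by (auto simp: sq_integrable_def)
    show "(\<lambda>x. (cmod (f x))\<^sup>2) \<in> borel_measurable M" using assms(2) by measurable
    show "AE x in M. norm ((cmod (f x))\<^sup>2) \<le> norm (C\<^sup>2 * (cmod (g x))\<^sup>2)"
      using assms(3)
    proof eventually_elim
      case (elim x)
      then have "(cmod (f x))\<^sup>2 \<le> (C * cmod (g x))\<^sup>2" by (intro power_mono) auto
      then show ?case by (simp add: power_mult_distrib)
    qed
  qed
qed fact

lemma sq_integrable_add:
  assumes "sq_integrable M f" "sq_integrable M g"
  shows "sq_integrable M (\<lambda>x. f x + g x)"
  unfolding sq_integrable_def
proof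
  have [measurable]: "f \<in> borel_measurable M" "g \<in> borel_measurable M"
    using assms by (auto simp: sq_integrable_def)
  show "(\<lambda>x. f x + g x) \<in> borel_measurable M" by measurable
  show "integrable M (\<lambda>x. (cmod (f x + g x))\<^sup>2)"
  proof (rule Bochner_Integration.integrable_bound)
    show "integrable M (\<lambda>x. 2 * (cmod (f x))\<^sup>2 + 2 * (cmod (g x))\<^sup>2)"
      using assms by (auto simp: sq_integrable_def)
    show "AE x in M. norm ((cmod (f x + g x))\<^sup>2) \<le> norm (2 * (cmod (f x))\<^sup>2 + 2 * (cmod (g x))\<^sup>2)"
    proof (rule AE_I2)
      fix x
      have "(cmod (f x + g x))\<^sup>2 \<le> (cmod (f x) + cmod (g x))\<^sup>2"
        by (intro power_mono norm_triangle_ineq) auto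
      also have "\<dots> \<le> 2 * (cmod (f x))\<^sup>2 + 2 * (cmod (g x))\<^sup>2"
        using sum_squares_bound[of "cmod (f x)" "cmod (g x)"] by (simp add: power2_sum)
      finally show "norm ((cmod (f x + g x))\<^sup>2) \<le> norm (2 * (cmod (f x))\<^sup>2 + 2 * (cmod (g x))\<^sup>2)"
        by simp
    qed
  qed measurable
qed

lemma sq_integrable_cmult:
  assumes "sq_integrable M f"
  shows "sq_integrable M (\<lambda>x. c * f x)"
  using assms by (auto simp: sq_integrable_def norm_mult power_mult_distrib)

lemma sq_integrable_diff:
  assumes "sq_integrable M f" "sq_integrable M g"
  shows "sq_integrable M (\<lambda>x. f x - g x)"
  using sq_integrable_add[OF assms(1) sq_integrable_cmult[OF assms(2), of "-1"]] by simp

lemma borel_measurable_cnj [measurable (raw)]: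
  "f \<in> borel_measurable M \<Longrightarrow> (\<lambda>x. cnj (f x)) \<in> borel_measurable M"
  by (rule borel_measurable_continuous_on[of cnj]) (auto intro!: continuous_intros)

lemma sq_integrable_cnj: "sq_integrable M f \<Longrightarrow> sq_integrable M (\<lambda>x. cnj (f x))"
  by (auto simp: sq_integrable_def)

lemma sq_integrable_indicator:
  assumes "sq_integrable M f" "S \<in> sets M"
  shows "sq_integrable M (\<lambda>x. indicator S x * f x)"
proof (rule sq_integrable_bound[OF assms(1), of _ 1])
  show "(\<lambda>x. indicator S x * f x) \<in> borel_measurable M" using assms by measurable
qed (auto simp: indicator_def)

lemma integrable_cmod_mult:
  assumes "sq_integrable M f" "sq_integrable M g"
  shows "integrable M (\<lambda>x. cmod (f x) * cmod (g x))"
proof (rule Bochner_Integration.integrable_bound)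
  have [measurable]: "f \<in> borel_measurable M" "g \<in> borel_measurable M"
    using assms by (auto simp: sq_integrable_def)
  show "integrable M (\<lambda>x. (cmod (f x))\<^sup>2 + (cmod (g x))\<^sup>2)"
    using assms by (auto simp: sq_integrable_def)
  show "(\<lambda>x. cmod (f x) * cmod (g x)) \<in> borel_measurable M" by measurable
  show "AE x in M. norm (cmod (f x) * cmod (g x)) \<le> norm ((cmod (f x))\<^sup>2 + (cmod (g x))\<^sup>2)"
  proof (rule AE_I2)
    fix x
    have "cmod (f x) * cmod (g x) \<le> (cmod (f x))\<^sup>2 + (cmod (g x))\<^sup>2"
      using sum_squares_bound[of "cmod (f x)" "cmod (g x)"]
        mult_nonneg_nonneg[OF norm_ge_zero[of "f x"] norm_ge_zero[of "g x"]] by linarith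
    then show "norm (cmod (f x) * cmod (g x)) \<le> norm ((cmod (f x))\<^sup>2 + (cmod (g x))\<^sup>2)"
      by (simp add: abs_mult)
  qed
qed

lemma integrable_mult_cnj:
  assumes "sq_integrable M f" "sq_integrable M g"
  shows "integrable M (\<lambda>x. f x * cnj (g x))"
proof (rule Bochner_Integration.integrable_bound[OF integrable_cmod_mult[OF assms]])
  have [measurable]: "f \<in> borel_measurable M" "g \<in> borel_measurable M"
    using assms by (auto simp: sq_integrable_def)
  show "(\<lambda>x. f x * cnj (g x)) \<in> borel_measurable M" by measurable
qed (auto simp: norm_mult)

lemma nrm2_nonneg [simp]: "0 \<le> nrm2 M f"
  by (simp add: nrm2_def)

lemma nrm2_cmult: "nrm2 M (\<lambda>x. c * f x) = (cmod c)\<^sup>2 * nrm2 M f"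
  by (simp add: nrm2_def norm_mult power_mult_distrib)

lemma nrm2_minus_commute: "nrm2 M (\<lambda>x. f x - g x) = nrm2 M (\<lambda>x. g x - f x)"
  by (simp add: nrm2_def norm_minus_commute)

lemma nn_integral_nrm2:
  assumes "sq_integrable M f"
  shows "(\<integral>\<^sup>+x. ennreal ((cmod (f x))\<^sup>2) \<partial>M) = ennreal (nrm2 M f)"
  unfolding nrm2_def using assms by (intro nn_integral_eq_integral) (auto simp: sq_integrable_def)

lemma Cauchy_Schwarz_cmod:
  assumes "sq_integrable M f" "sq_integrable M g"
  shows "(LINT x|M. cmod (f x) * cmod (g x))\<^sup>2 \<le> nrm2 M f * nrm2 M g"
proof -
  let ?P = "LINT x|M. cmod (f x) * cmod (g x)"
  have i: "integrable M (\<lambda>x. (cmod (f x))\<^sup>2)" "integrable M (\<lambda>x. (cmod (g x))\<^sup>2)"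
    "integrable M (\<lambda>x. cmod (f x) * cmod (g x))"
    using assms integrable_cmod_mult[OF assms] by (auto simp: sq_integrable_def)
  have q: "0 \<le> t\<^sup>2 * nrm2 M f - 2 * t * ?P + nrm2 M g" for t
  proof -
    have "0 \<le> (LINT x|M. (t * cmod (f x) - cmod (g x))\<^sup>2)" by simp
    also have "\<dots> = (LINT x|M. t\<^sup>2 * (cmod (f x))\<^sup>2 - 2 * t * (cmod (f x) * cmod (g x)) + (cmod (g x))\<^sup>2)"
      by (intro Bochner_Integration.integral_cong) (auto simp: power2_diff power_mult_distrib algebra_simps)
    also have "\<dots> = t\<^sup>2 * nrm2 M f - 2 * t * ?P + nrm2 M g"
      using i unfolding nrm2_def by simp
    finally show ?thesis .
  qed
  show ?thesis
  proof (cases "nrm2 M f = 0")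
    case True
    have "?P = 0"
    proof (rule ccontr)
      \<comment> \<open>A null \<open>f\<close> makes the parabola a line, which stays nonnegative only if it is horizontal.\<close>
      assume "?P \<noteq> 0"
      then show False using q[of "(nrm2 M g + 1) / (2 * ?P)"] True by simp
    qed
    then show ?thesis using True by simp
  next
    case False
    then have pos: "nrm2 M f > 0" using nrm2_nonneg[of M f] by linarith
    have "0 \<le> nrm2 M f * ((?P / nrm2 M f)\<^sup>2 * nrm2 M f - 2 * (?P / nrm2 M f) * ?P + nrm2 M g)"
      using q[of "?P / nrm2 M f"] pos by simp
    also have "\<dots> = nrm2 M f * nrm2 M g - ?P\<^sup>2"
      using pos by (simp add: field_simps power2_eq_square)
    finally show ?thesis by simp
  qed
qed

lemma Cauchy_Schwarz_ip:
  assumes "sq_integrable M f" "sq_integrable M g"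
  shows "(cmod (ip M f g))\<^sup>2 \<le> nrm2 M f * nrm2 M g"
proof -
  have "cmod (ip M f g) \<le> (LINT x|M. cmod (f x * cnj (g x)))"
    unfolding ip_def by (rule integral_norm_bound)
  then have "(cmod (ip M f g))\<^sup>2 \<le> (LINT x|M. cmod (f x) * cmod (g x))\<^sup>2"
    by (intro power_mono) (auto simp: norm_mult)
  also note Cauchy_Schwarz_cmod[OF assms]
  finally show ?thesis .
qed

lemma ip_commute: "ip M g f = cnj (ip M f g)"
  unfolding ip_def using Bochner_Integration.integral_cnj[of M "\<lambda>x. f x * cnj (g x)"] by (simp add: mult.commute)

lemma ip_self:
  shows "ip M f f = complex_of_real (nrm2 M f)"
  unfolding ip_def nrm2_def
  by (subst integral_complex_of_real[symmetric]) (simp only: complex_norm_square)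

lemma ip_diff_left:
  assumes "sq_integrable M f" "sq_integrable M f'" "sq_integrable M g"
  shows "ip M (\<lambda>x. f x - f' x) g = ip M f g - ip M f' g"
  unfolding ip_def using integrable_mult_cnj[OF assms(1,3)] integrable_mult_cnj[OF assms(2,3)]
  by (simp add: left_diff_distrib)

lemma nrm2_add:
  assumes "sq_integrable M f" "sq_integrable M g"
  shows "nrm2 M (\<lambda>x. f x + g x) = nrm2 M f + nrm2 M g + 2 * Re (ip M f g)"
proof -
  have "nrm2 M (\<lambda>x. f x + g x) = (LINT x|M. (cmod (f x))\<^sup>2 + (cmod (g x))\<^sup>2 + 2 * Re (f x * cnj (g x)))"
    unfolding nrm2_def
  proof (rule Bochner_Integration.integral_cong)
    fix x
    show "(cmod (f x + g x))\<^sup>2 = (cmod (f x))\<^sup>2 + (cmod (g x))\<^sup>2 + 2 * Re (f x * cnj (g x))"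
      unfolding cmod_power2 by (simp add: power2_eq_square algebra_simps)
  qed simp
  also have "\<dots> = nrm2 M f + nrm2 M g + 2 * Re (ip M f g)"
    unfolding nrm2_def ip_def
    using integrable_mult_cnj[OF assms] sq_integrableD[OF assms(1)] sq_integrableD[OF assms(2)]
    by (simp del: complex_cnj_cnj times_complex.simps flip: integral_Re)
  finally show ?thesis .
qed

lemma nrm2_diff:
  assumes "sq_integrable M f" "sq_integrable M g"
  shows "nrm2 M (\<lambda>x. f x - g x) = nrm2 M f + nrm2 M g - 2 * Re (ip M f g)"
proof -
  have "ip M f (\<lambda>x. -1 * g x) = - ip M f g" unfolding ip_def by simp
  then show ?thesis
    using nrm2_add[OF assms(1) sq_integrable_cmult[OF assms(2), of "-1"]] nrm2_cmult[of M "-1" g] by simp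
qed

lemma Minkowski_nrm2:
  assumes "sq_integrable M f" "sq_integrable M g"
  shows "sqrt (nrm2 M (\<lambda>x. f x + g x)) \<le> sqrt (nrm2 M f) + sqrt (nrm2 M g)"
proof (rule real_le_lsqrt)
  have "Re (ip M f g) \<le> cmod (ip M f g)" by (rule complex_Re_le_cmod)
  also have "\<dots> \<le> sqrt (nrm2 M f * nrm2 M g)"
    using Cauchy_Schwarz_ip[OF assms] by (intro real_le_rsqrt)
  finally show "nrm2 M (\<lambda>x. f x + g x) \<le> (sqrt (nrm2 M f) + sqrt (nrm2 M g))\<^sup>2"
    by (simp add: nrm2_add[OF assms] power2_sum real_sqrt_mult)
qed auto

lemma Minkowski_nrm2_diff:
  assumes "sq_integrable M f" "sq_integrable M g"
  shows "\<bar>sqrt (nrm2 M f) - sqrt (nrm2 M g)\<bar> \<le> sqrt (nrm2 M (\<lambda>x. f x - g x))"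
proof -
  have "sqrt (nrm2 M f) \<le> sqrt (nrm2 M (\<lambda>x. f x - g x)) + sqrt (nrm2 M g)"
    using Minkowski_nrm2[OF sq_integrable_diff[OF assms] assms(2)] by simp
  moreover have "sqrt (nrm2 M g) \<le> sqrt (nrm2 M (\<lambda>x. f x - g x)) + sqrt (nrm2 M f)"
    using Minkowski_nrm2[OF sq_integrable_diff[OF assms(2,1)] assms(1)] nrm2_minus_commute[of M f g] by simp
  ultimately show ?thesis by linarith
qed

lemma nrm2_add_le:
  assumes "sq_integrable M f" "sq_integrable M g"
  shows "nrm2 M (\<lambda>x. f x + g x) \<le> 2 * nrm2 M f + 2 * nrm2 M g"
proof -
  have "0 \<le> nrm2 M (\<lambda>x. f x - g x)" by simp
  then show ?thesis unfolding nrm2_add[OF assms] nrm2_diff[OF assms] by simp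
qed

lemma tendsto_nrm2:
  assumes "\<And>n. sq_integrable M (f n)" "sq_integrable M g"
    and "((\<lambda>n. nrm2 M (\<lambda>x. f n x - g x)) \<longlongrightarrow> 0) F"
  shows "((\<lambda>n. nrm2 M (f n)) \<longlongrightarrow> nrm2 M g) F"
proof -
  have "((\<lambda>n. sqrt (nrm2 M (\<lambda>x. f n x - g x))) \<longlongrightarrow> 0) F"
    using tendsto_real_sqrt[OF assms(3)] by simp
  then have "((\<lambda>n. sqrt (nrm2 M (f n)) - sqrt (nrm2 M g)) \<longlongrightarrow> 0) F"
    by (rule Lim_null_comparison[rotated]) (auto intro!: always_eventually Minkowski_nrm2_diff assms)
  then have "((\<lambda>n. sqrt (nrm2 M (f n))) \<longlongrightarrow> sqrt (nrm2 M g)) F"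
    by (simp add: LIM_zero_iff)
  then have "((\<lambda>n. (sqrt (nrm2 M (f n)))\<^sup>2) \<longlongrightarrow> (sqrt (nrm2 M g))\<^sup>2) F"
    by (rule tendsto_power)
  then show ?thesis by simp
qed

lemma tendsto_ip_left:
  assumes "\<And>n. sq_integrable M (f n)" "sq_integrable M f'" "sq_integrable M g"
    and "((\<lambda>n. nrm2 M (\<lambda>x. f n x - f' x)) \<longlongrightarrow> 0) F"
  shows "((\<lambda>n. ip M (f n) g) \<longlongrightarrow> ip M f' g) F"
proof -
  have lim: "((\<lambda>n. sqrt (nrm2 M (\<lambda>x. f n x - f' x) * nrm2 M g)) \<longlongrightarrow> 0) F"
    using tendsto_real_sqrt[OF tendsto_mult_right[OF assms(4), of "nrm2 M g"]] by simp
  have "((\<lambda>n. ip M (f n) g - ip M f' g) \<longlongrightarrow> 0) F"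
  proof (rule Lim_null_comparison[OF always_eventually lim], rule allI)
    fix n
    show "norm (ip M (f n) g - ip M f' g) \<le> sqrt (nrm2 M (\<lambda>x. f n x - f' x) * nrm2 M g)"
      using Cauchy_Schwarz_ip[OF sq_integrable_diff[OF assms(1)[of n] assms(2)] assms(3)]
      unfolding ip_diff_left[OF assms(1,2,3)] by (intro real_le_rsqrt)
  qed
  then show ?thesis by (simp add: LIM_zero_iff)
qed

lemma tendsto_ip_right:
  assumes "\<And>n. sq_integrable M (f n)" "sq_integrable M f'" "sq_integrable M g"
    and "((\<lambda>n. nrm2 M (\<lambda>x. f n x - f' x)) \<longlongrightarrow> 0) F"
  shows "((\<lambda>n. ip M g (f n)) \<longlongrightarrow> ip M g f') F"
proof -
  have "((\<lambda>n. cnj (ip M (f n) g)) \<longlongrightarrow> cnj (ip M f' g)) F"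
    by (intro tendsto_intros tendsto_ip_left assms)
  then show ?thesis by (simp flip: ip_commute)
qed

lemma nrm2_dominated_convergence:
  fixes f :: "nat \<Rightarrow> 'a \<Rightarrow> complex"
  assumes w: "integrable M (\<lambda>x. (w x)\<^sup>2)" and m: "\<And>n. f n \<in> borel_measurable M" "g \<in> borel_measurable M"
    and lim: "AE x in M. (\<lambda>n. f n x) \<longlonglongrightarrow> g x"
    and bound: "\<And>n. AE x in M. cmod (f n x) \<le> w x" "AE x in M. cmod (g x) \<le> w x"
  shows "(\<lambda>n. nrm2 M (\<lambda>x. f n x - g x)) \<longlonglongrightarrow> 0"
proof -
  note m[measurable]
  have "(\<lambda>n. LINT x|M. (cmod (f n x - g x))\<^sup>2) \<longlonglongrightarrow> (LINT x|M. 0)"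
  proof (rule integral_dominated_convergence)
    show "integrable M (\<lambda>x. 4 * (w x)\<^sup>2)" using w by simp
    show "AE x in M. (\<lambda>n. (cmod (f n x - g x))\<^sup>2) \<longlonglongrightarrow> 0"
      using lim
    proof eventually_elim
      case (elim x)
      then have "(\<lambda>n. (cmod (f n x - g x))\<^sup>2) \<longlonglongrightarrow> (cmod (g x - g x))\<^sup>2"
        by (intro tendsto_intros)
      then show ?case by simp
    qed
    show "AE x in M. norm ((cmod (f n x - g x))\<^sup>2) \<le> 4 * (w x)\<^sup>2" for n
      using bound(1)[of n] bound(2)
    proof eventually_elim
      case (elim x)
      have "cmod (f n x - g x) \<le> 2 * w x"
        using elim norm_triangle_ineq4[of "f n x" "g x"] by linarith
      then have "(cmod (f n x - g x))\<^sup>2 \<le> (2 * w x)\<^sup>2" by (intro power_mono) auto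
      then show ?case by (simp add: power_mult_distrib)
    qed
  qed measurable
  then show ?thesis by (simp add: nrm2_def)
qed

text \<open>The triangle inequality for finite square sums. In this form it can be combined with bounds \<open>s\<close> and \<open>d\<close>
  that do not depend on \<open>K\<close>, and so passes to infinite sums.\<close>

lemma sum_cmod2_perturbation:
  assumes "(\<Sum>k\<in>K. (cmod (a k))\<^sup>2) \<le> s" "(\<Sum>k\<in>K. (cmod (b k - a k))\<^sup>2) \<le> d"
  shows "(\<Sum>k\<in>K. (cmod (b k))\<^sup>2) \<le> (sqrt s + sqrt d)\<^sup>2"
proof -
  have "L2_set (\<lambda>k. cmod (b k)) K \<le> L2_set (\<lambda>k. cmod (a k) + cmod (b k - a k)) K"
    by (rule L2_set_mono) (metis add.commute diff_add_cancel norm_triangle_ineq, simp)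
  also have "\<dots> \<le> L2_set (\<lambda>k. cmod (a k)) K + L2_set (\<lambda>k. cmod (b k - a k)) K"
    by (rule L2_set_triangle_ineq)
  also have "\<dots> \<le> sqrt s + sqrt d"
    unfolding L2_set_def by (intro add_mono real_sqrt_le_mono assms)
  finally have "(L2_set (\<lambda>k. cmod (b k)) K)\<^sup>2 \<le> (sqrt s + sqrt d)\<^sup>2" by (intro power_mono) auto
  then show ?thesis by (simp add: L2_set_def sum_nonneg)
qed

section \<open>Linear changes of variables\<close>

lemma matrix_vector_mult_borel [measurable]:
  "(\<lambda>x. (B :: real^'n^'m) *v x) \<in> borel_measurable borel"
  by (intro borel_measurable_continuous_onI) (simp add: linear_continuous_on matrix_vector_mul_bounded_linear)

interpretation lborel_product: product_sigma_finite "\<lambda>_. lborel :: real measure" ..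

text \<open>The coordinate \<open>m\<close> is split off by Tonelli's theorem. For fixed values of the others the shear translates it.\<close>

lemma nn_integral_lborel_shear:
  fixes f :: "real^'n \<Rightarrow> ennreal"
  assumes [measurable]: "f \<in> borel_measurable borel" and mn: "m \<noteq> n"
  shows "(\<integral>\<^sup>+x. f (x + (x $ n) *\<^sub>R axis m 1) \<partial>lborel) = (\<integral>\<^sup>+x. f x \<partial>lborel)"
proof -
  define S where "S = (\<lambda>y :: real^'n \<Rightarrow> real. \<Sum>b\<in>Basis. y b *\<^sub>R b)"
  define I where "I = (Basis :: (real^'n) set) - {axis m 1}"
  have am: "axis m 1 \<in> (Basis :: (real^'n) set)" and an: "axis n 1 \<in> I"
    using mn by (auto simp: I_def Basis_vec_def axis_eq_axis)
  have I: "finite I" "axis m 1 \<notin> I" and BI: "Basis = insert (axis m 1) I"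
    using am by (auto simp: I_def)
  have S_meas [measurable]: "S \<in> (\<Pi>\<^sub>M b\<in>Basis. lborel) \<rightarrow>\<^sub>M borel"
    unfolding S_def by measurable
  then have S_meas' [measurable]: "S \<in> (\<Pi>\<^sub>M b\<in>insert (axis m 1) I. lborel) \<rightarrow>\<^sub>M borel"
    by (simp add: BI)
  have nn: "(\<integral>\<^sup>+x. g x \<partial>lborel) = (\<integral>\<^sup>+y. \<integral>\<^sup>+t. g (S (y(axis m 1 := t))) \<partial>lborel \<partial>(\<Pi>\<^sub>M b\<in>I. lborel))"
    if [measurable]: "g \<in> borel_measurable borel" for g
  proof -
    have "(\<integral>\<^sup>+x. g x \<partial>lborel) = (\<integral>\<^sup>+y. g (S y) \<partial>(\<Pi>\<^sub>M b\<in>Basis. lborel))"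
      by (subst lborel_eq) (simp add: nn_integral_distr flip: S_def)
    also have "\<dots> = (\<integral>\<^sup>+y. g (S y) \<partial>(\<Pi>\<^sub>M b\<in>insert (axis m 1) I. lborel))" by (simp add: BI)
    also have "\<dots> = (\<integral>\<^sup>+y. \<integral>\<^sup>+t. g (S (y(axis m 1 := t))) \<partial>lborel \<partial>(\<Pi>\<^sub>M b\<in>I. lborel))"
      by (rule lborel_product.product_nn_integral_insert[OF I]) measurable
    finally show ?thesis .
  qed
  have S_upd: "S (y(axis m 1 := t)) = t *\<^sub>R axis m 1 + (\<Sum>b\<in>I. y b *\<^sub>R b)" for y t
  proof -
    have "S (y(axis m 1 := t)) = t *\<^sub>R axis m 1 + (\<Sum>b\<in>I. (y(axis m 1 := t)) b *\<^sub>R b)"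
      unfolding S_def BI using I by simp
    also have "(\<Sum>b\<in>I. (y(axis m 1 := t)) b *\<^sub>R b) = (\<Sum>b\<in>I. y b *\<^sub>R b)"
      using I by (intro sum.cong) auto
    finally show ?thesis .
  qed
  have S_n: "S (y(axis m 1 := t)) $ n = y (axis n 1)" for y t
  proof -
    have "S (y(axis m 1 := t)) $ n = S (y(axis m 1 := t)) \<bullet> axis n 1" by (simp add: inner_axis)
    also have "\<dots> = (y(axis m 1 := t)) (axis n 1)"
      using an unfolding S_def I_def by simp
    finally show ?thesis using mn by (simp add: axis_eq_axis)
  qed
  have "(\<integral>\<^sup>+x. f (x + (x $ n) *\<^sub>R axis m 1) \<partial>lborel) =
      (\<integral>\<^sup>+y. \<integral>\<^sup>+t. f (S (y(axis m 1 := t)) + y (axis n 1) *\<^sub>R axis m 1) \<partial>lborel \<partial>(\<Pi>\<^sub>M b\<in>I. lborel))"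
    by (subst nn) (simp_all add: S_n)
  also have "\<dots> = (\<integral>\<^sup>+y. \<integral>\<^sup>+t. f (S (y(axis m 1 := t))) \<partial>lborel \<partial>(\<Pi>\<^sub>M b\<in>I. lborel))"
  proof (rule nn_integral_cong)
    fix y :: "real^'n \<Rightarrow> real"
    have [measurable]: "(\<lambda>t. f (S (y(axis m 1 := t)))) \<in> borel_measurable borel"
      unfolding S_upd by measurable
    have "(\<integral>\<^sup>+t. f (S (y(axis m 1 := t))) \<partial>lborel) = (\<integral>\<^sup>+t. f (S (y(axis m 1 := y (axis n 1) + t))) \<partial>lborel)"
      by (subst nn_integral_real_affine[where c=1 and t="y (axis n 1)"]) auto
    also have "\<dots> = (\<integral>\<^sup>+t. f (S (y(axis m 1 := t)) + y (axis n 1) *\<^sub>R axis m 1) \<partial>lborel)"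
      unfolding S_upd by (simp add: algebra_simps)
    finally show "(\<integral>\<^sup>+t. f (S (y(axis m 1 := t)) + y (axis n 1) *\<^sub>R axis m 1) \<partial>lborel) =
        (\<integral>\<^sup>+t. f (S (y(axis m 1 := t))) \<partial>lborel)" by simp
  qed
  also have "\<dots> = (\<integral>\<^sup>+x. f x \<partial>lborel)" by (rule nn[symmetric]) measurable
  finally show ?thesis .
qed

lemma nn_integral_lborel_permute:
  fixes f :: "real^'n \<Rightarrow> ennreal"
  assumes [measurable]: "f \<in> borel_measurable borel" and p: "p permutes UNIV"
  shows "(\<integral>\<^sup>+x. f (\<chi> i. x $ p i) \<partial>lborel) = (\<integral>\<^sup>+x. f x \<partial>lborel)"
proof -
  have bij: "bij p" using p by (simp add: permutes_bij)
  have [measurable]: "(\<lambda>x :: real^'n. \<chi> i. x $ p i) \<in> borel_measurable borel"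
    by (intro borel_measurable_continuous_onI continuous_intros)
  \<comment> \<open>Lebesgue measure is determined by its values on boxes, and these are permuted.\<close>
  have "lborel = distr lborel borel (\<lambda>x :: real^'n. \<chi> i. x $ p i)"
  proof (rule lborel_eqI)
    fix l u :: "real^'n" assume le: "\<And>b. b \<in> Basis \<Longrightarrow> l \<bullet> b \<le> u \<bullet> b"
    have le': "l $ i \<le> u $ i" for i using le[of "axis i 1"] by (simp add: axis_in_Basis_iff inner_axis)
    let ?q = "inv p"
    have vim: "(\<lambda>x :: real^'n. \<chi> i. x $ p i) -` box l u = box (\<chi> i. l $ ?q i) (\<chi> i. u $ ?q i)"
    proof (intro set_eqI iffI)
      fix x :: "real^'n"
      assume "x \<in> (\<lambda>x. \<chi> i. x $ p i) -` box l u"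
      then have *: "l $ i < x $ p i \<and> x $ p i < u $ i" for i by (simp add: mem_box_cart)
      show "x \<in> box (\<chi> i. l $ ?q i) (\<chi> i. u $ ?q i)"
        using *[of "?q i" for i] bij by (simp add: mem_box_cart surj_f_inv_f bij_is_surj)
    next
      fix x :: "real^'n"
      assume "x \<in> box (\<chi> i. l $ ?q i) (\<chi> i. u $ ?q i)"
      then have *: "l $ ?q i < x $ i \<and> x $ i < u $ ?q i" for i by (simp add: mem_box_cart)
      show "x \<in> (\<lambda>x. \<chi> i. x $ p i) -` box l u"
        using *[of "p i" for i] bij by (simp add: mem_box_cart inv_f_f bij_is_inj)
    qed
    have cartprod: "(\<Prod>b\<in>Basis. (v :: real^'n) \<bullet> b) = (\<Prod>i\<in>UNIV. v $ i)" for v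
      unfolding Basis_vec_def
      by (subst prod.UNION_disjoint[of UNIV "\<lambda>i. {axis i 1}" , simplified] |
          simp add: UNION_singleton_eq_range prod.reindex inj_on_def axis_eq_axis inner_axis)+
    have "emeasure (distr lborel borel (\<lambda>x :: real^'n. \<chi> i. x $ p i)) (box l u) =
        emeasure lborel (box (\<chi> i. l $ ?q i) (\<chi> i. u $ ?q i) :: (real^'n) set)"
      by (subst emeasure_distr) (auto simp: vim)
    also have "\<dots> = ennreal (\<Prod>b\<in>Basis. ((\<chi> i. u $ ?q i) - (\<chi> i. l $ ?q i) :: real^'n) \<bullet> b)"
      using le' by (subst emeasure_lborel_box) (auto simp: Basis_vec_def inner_axis)
    also have "(\<Prod>b\<in>Basis. ((\<chi> i. u $ ?q i) - (\<chi> i. l $ ?q i) :: real^'n) \<bullet> b) = (\<Prod>i\<in>UNIV. u $ ?q i - l $ ?q i)"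
      unfolding cartprod by simp
    also have "\<dots> = (\<Prod>i\<in>UNIV. u $ i - l $ i)"
      by (rule prod.reindex_bij_betw[of ?q UNIV UNIV "\<lambda>i. u $ i - l $ i"]) (simp add: bij bij_imp_bij_inv)
    also have "\<dots> = (\<Prod>b\<in>Basis. (u - l) \<bullet> b)" unfolding cartprod by simp
    finally show "emeasure (distr lborel borel (\<lambda>x :: real^'n. \<chi> i. x $ p i)) (box l u) = (\<Prod>b\<in>Basis. (u - l) \<bullet> b)" .
  qed simp
  then have "(\<integral>\<^sup>+x. f x \<partial>lborel) = (\<integral>\<^sup>+x. f x \<partial>distr lborel borel (\<lambda>x :: real^'n. \<chi> i. x $ p i))" by simp
  also have "\<dots> = (\<integral>\<^sup>+x. f (\<chi> i. x $ p i) \<partial>lborel)" by (rule nn_integral_distr) auto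
  finally show ?thesis by simp
qed

lemma nn_integral_lborel_diagonal:
  fixes f :: "real^'n \<Rightarrow> ennreal"
  assumes [measurable]: "f \<in> borel_measurable borel" and c: "\<And>i. c i \<noteq> 0"
  shows "ennreal \<bar>\<Prod>i\<in>UNIV. c i\<bar> * (\<integral>\<^sup>+x. f (\<chi> i. c i * x $ i) \<partial>lborel) = (\<integral>\<^sup>+x. f x \<partial>lborel)"
proof -
  define d where "d b = c (axis_index b)" for b :: "real^'n"
  have d: "d (axis i 1) = c i" for i by (simp add: d_def)
  have "b \<in> Basis \<Longrightarrow> d b \<noteq> 0" for b using c by (simp add: d_def)
  note lb = lborel_affine_euclidean[of d 0, OF this]
  have Basis: "Basis = (\<lambda>i. axis i 1 :: real^'n) ` UNIV" by (auto simp: Basis_vec_def)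
  have inj: "inj (\<lambda>i. axis i 1 :: real^'n)" by (auto simp: inj_on_def axis_eq_axis)
  have T: "0 + (\<Sum>j\<in>Basis. (d j * (x \<bullet> j)) *\<^sub>R j) = (\<chi> i. c i * x $ i)" for x :: "real^'n"
  proof -
    have "(\<Sum>j\<in>Basis. (d j * (x \<bullet> j)) *\<^sub>R j) = (\<Sum>i\<in>UNIV. (c i * x $ i) *\<^sub>R axis i 1)"
      unfolding Basis sum.reindex[OF inj] by (simp add: d inner_axis)
    also have "\<dots> = (\<chi> i. c i * x $ i)"
      by (simp add: vec_eq_iff axis_def if_distrib[of "\<lambda>y. z * y" for z] cong: if_cong)
    finally show ?thesis by simp
  qed
  have P: "(\<Prod>j\<in>Basis. \<bar>d j\<bar>) = \<bar>\<Prod>i\<in>UNIV. c i\<bar>"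
    unfolding Basis prod.reindex[OF inj] by (simp add: d abs_prod)
  have [measurable]: "(\<lambda>x :: real^'n. \<chi> i. c i * x $ i) \<in> borel_measurable borel"
    by (intro borel_measurable_continuous_onI continuous_intros)
  have "(\<integral>\<^sup>+x. f x \<partial>lborel) = (\<integral>\<^sup>+x. f x \<partial>density (distr lborel borel (\<lambda>x. \<chi> i. c i * x $ i)) (\<lambda>_. \<bar>\<Prod>i\<in>UNIV. c i\<bar>))"
    using lb unfolding T P by simp
  also have "\<dots> = ennreal \<bar>\<Prod>i\<in>UNIV. c i\<bar> * (\<integral>\<^sup>+x. f (\<chi> i. c i * x $ i) \<partial>lborel)"
    by (simp add: nn_integral_density nn_integral_distr nn_integral_cmult)
  finally show ?thesis by simp
qed

text \<open>The induction on elementary matrices leaves diagonal matrices, transpositions and shears; a zero row is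
  excluded by the determinant.\<close>

lemma nn_integral_lborel_matrix:
  fixes A :: "real^'n^'n" and f :: "real^'n \<Rightarrow> ennreal"
  assumes "f \<in> borel_measurable borel" and "det A \<noteq> 0"
  shows "ennreal \<bar>det A\<bar> * (\<integral>\<^sup>+x. f (A *v x) \<partial>lborel) = (\<integral>\<^sup>+x. f x \<partial>lborel)"
proof -
  let ?P = "\<lambda>A :: real^'n^'n. det A \<noteq> 0 \<longrightarrow> (\<forall>f\<in>borel_measurable borel.
      ennreal \<bar>det A\<bar> * (\<integral>\<^sup>+x. f (A *v x) \<partial>lborel) = (\<integral>\<^sup>+x. f x \<partial>lborel))"
  have "?P A"
  proof (rule induct_matrix_elementary_alt)
    fix A B :: "real^'n^'n" assume A: "?P A" and B: "?P B"
    show "?P (A ** B)"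
    proof (intro impI ballI)
      fix f :: "real^'n \<Rightarrow> ennreal"
      assume d: "det (A ** B) \<noteq> 0" and f [measurable]: "f \<in> borel_measurable borel"
      have dd: "det A \<noteq> 0" "det B \<noteq> 0" using d by (auto simp: det_mul)
      have fA: "(\<lambda>x. f (A *v x)) \<in> borel_measurable borel" by measurable
      have "ennreal \<bar>det (A ** B)\<bar> * (\<integral>\<^sup>+x. f ((A ** B) *v x) \<partial>lborel) =
         ennreal \<bar>det A\<bar> * (ennreal \<bar>det B\<bar> * (\<integral>\<^sup>+x. f (A *v (B *v x)) \<partial>lborel))"
        by (simp add: det_mul abs_mult ennreal_mult matrix_vector_mul_assoc mult.assoc)
      also have "\<dots> = ennreal \<bar>det A\<bar> * (\<integral>\<^sup>+x. f (A *v x) \<partial>lborel)"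
        by (simp only: B[rule_format, OF dd(2) fA])
      also have "\<dots> = (\<integral>\<^sup>+x. f x \<partial>lborel)" using A dd(1) f by auto
      finally show "ennreal \<bar>det (A ** B)\<bar> * (\<integral>\<^sup>+x. f ((A ** B) *v x) \<partial>lborel) = (\<integral>\<^sup>+x. f x \<partial>lborel)" .
    qed
  next
    fix A :: "real^'n^'n" and i assume "row i A = 0"
    then show "?P A" by (auto simp: det_zero_row)
  next
    fix A :: "real^'n^'n" assume 0: "\<And>i j. i \<noteq> j \<Longrightarrow> A $ i $ j = 0"
    have det: "det A = (\<Prod>i\<in>UNIV. A $ i $ i)" using 0 by (rule det_diagonal)
    have "(\<Sum>j\<in>UNIV. A $ i $ j * x $ j) = (\<Sum>j\<in>UNIV. if j = i then A $ i $ i * x $ i else 0)" for i and x :: "real^'n"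
      using 0 by (intro sum.cong) auto
    then have v: "A *v x = (\<chi> i. A $ i $ i * x $ i)" for x
      by (simp add: matrix_vector_mult_def vec_eq_iff)
    show "?P A"
    proof (intro impI ballI)
      fix f :: "real^'n \<Rightarrow> ennreal"
      assume "det A \<noteq> 0" and "f \<in> borel_measurable borel"
      then show "ennreal \<bar>det A\<bar> * (\<integral>\<^sup>+x. f (A *v x) \<partial>lborel) = (\<integral>\<^sup>+x. f x \<partial>lborel)"
        unfolding v det by (intro nn_integral_lborel_diagonal) (auto simp: prod_zero_iff)
    qed
  next
    fix m n :: 'n assume mn: "m \<noteq> n"
    let ?S = "(\<chi> i j. mat 1 $ i $ Transposition.transpose m n j) :: real^'n^'n"
    have p: "Transposition.transpose m n permutes UNIV" by (simp add: permutes_swap_id)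
    have v: "?S *v x = (\<chi> i. x $ Transposition.transpose m n i)" for x
    proof -
      have "(\<Sum>j\<in>UNIV. (mat 1 :: real^'n^'n) $ i $ Transposition.transpose m n j * x $ j) =
            (\<Sum>j\<in>UNIV. if j = Transposition.transpose m n i then x $ j else 0)" for i
        by (rule sum.cong) (auto simp: mat_def Transposition.transpose_def split: if_splits)
      then show ?thesis by (simp add: matrix_vector_mult_def vec_eq_iff)
    qed
    have "det ?S = of_int (sign (Transposition.transpose m n)) * det (mat 1 :: real^'n^'n)"
      by (rule det_permute_columns[OF p])
    then have det: "\<bar>det ?S\<bar> = 1" using mn by (simp add: sign_swap_id)
    show "?P ?S" unfolding v det by (auto intro!: nn_integral_lborel_permute p)
  next
    fix m n :: 'n assume mn: "m \<noteq> n"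
    let ?S = "(\<chi> i j. of_bool (i = m \<and> j = n \<or> i = j)) :: real^'n^'n"
    have v: "?S *v x = x + (x $ n) *\<^sub>R axis m 1" for x
      using mn by (auto simp: matrix_vector_mult_def vec_eq_iff axis_def of_bool_def
          if_distrib[of "\<lambda>z. z * y" for y] sum.remove[of UNIV n] cong: if_cong)
    have "det (\<chi> k. if k = m then row m (mat 1 :: real^'n^'n) + 1 *s row n (mat 1) else row k (mat 1)) = det (mat 1 :: real^'n^'n)"
      by (rule det_row_operation[OF mn])
    also have "(\<chi> k. if k = m then row m (mat 1 :: real^'n^'n) + 1 *s row n (mat 1) else row k (mat 1)) = ?S"
      using mn by (auto simp: vec_eq_iff row_def mat_def)
    finally have det: "det ?S = 1" by simp
    show "?P ?S" unfolding v det using nn_integral_lborel_shear[OF _ mn] by auto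
  qed
  then show ?thesis using assms by auto
qed

lemma lborel_eq_distr_matrix:
  fixes A :: "real^'n^'n"
  assumes "det A \<noteq> 0"
  shows "lborel = density (distr lborel borel ((*v) A)) (\<lambda>_. ennreal \<bar>det A\<bar>)"
proof (rule measure_eqI)
  fix X :: "(real^'n) set" assume "X \<in> sets lborel"
  then have [measurable]: "X \<in> sets borel" by simp
  have "emeasure (density (distr lborel borel ((*v) A)) (\<lambda>_. ennreal \<bar>det A\<bar>)) X =
      (\<integral>\<^sup>+x. ennreal \<bar>det A\<bar> * indicator X x \<partial>distr lborel borel ((*v) A))"
    by (subst emeasure_density) auto
  also have "\<dots> = ennreal \<bar>det A\<bar> * (\<integral>\<^sup>+x. indicator X x \<partial>distr lborel borel ((*v) A))"
    by (rule nn_integral_cmult) simp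
  also have "(\<integral>\<^sup>+x. indicator X x \<partial>distr lborel borel ((*v) A)) = (\<integral>\<^sup>+x. indicator X (A *v x) \<partial>lborel)"
    by (rule nn_integral_distr) auto
  also have "ennreal \<bar>det A\<bar> * (\<integral>\<^sup>+x. indicator X (A *v x) \<partial>lborel) = (\<integral>\<^sup>+x. indicator X x \<partial>lborel)"
    by (rule nn_integral_lborel_matrix[OF _ assms]) simp
  finally show "emeasure lborel X = emeasure (density (distr lborel borel ((*v) A)) (\<lambda>_. ennreal \<bar>det A\<bar>)) X"
    by simp
qed simp

lemma AE_lborel_matrix:
  fixes A :: "real^'n^'n"
  assumes "det A \<noteq> 0" "AE x in lborel. P x"
  shows "AE x in lborel. P (A *v x)"
proof -
  have "AE x in density (distr lborel borel ((*v) A)) (\<lambda>_. ennreal \<bar>det A\<bar>). P x"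
    using assms(2) unfolding lborel_eq_distr_matrix[OF assms(1), symmetric] .
  then have "AE x in distr lborel borel ((*v) A). P x"
    using assms(1) by (subst (asm) AE_density) auto
  then show ?thesis by (rule AE_distrD[rotated]) simp
qed

lemma integrable_lborel_matrix:
  fixes A :: "real^'n^'n" and f :: "real^'n \<Rightarrow> 'b::{banach, second_countable_topology}"
  assumes "det A \<noteq> 0" "integrable lborel f"
  shows "integrable lborel (\<lambda>x. f (A *v x))"
proof -
  have [measurable]: "f \<in> borel_measurable borel" using assms(2) by auto
  have "integrable (density (distr lborel borel ((*v) A)) (\<lambda>_. ennreal \<bar>det A\<bar>)) f"
    using assms(2) unfolding lborel_eq_distr_matrix[OF assms(1), symmetric] .
  then have "integrable lborel (\<lambda>x. \<bar>det A\<bar> *\<^sub>R f (A *v x))"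
    by (simp add: integrable_density integrable_distr_eq)
  then have "integrable lborel (\<lambda>x. inverse \<bar>det A\<bar> *\<^sub>R (\<bar>det A\<bar> *\<^sub>R f (A *v x)))"
    by (rule integrable_scaleR_right)
  then show ?thesis using assms(1) by simp
qed

lemma integral_lborel_matrix:
  fixes A :: "real^'n^'n" and f :: "real^'n \<Rightarrow> 'b::{banach, second_countable_topology}"
  assumes "det A \<noteq> 0" "f \<in> borel_measurable borel"
  shows "(LINT x|lborel. f x) = \<bar>det A\<bar> *\<^sub>R (LINT x|lborel. f (A *v x))"
proof -
  note assms(2)[measurable]
  have "(LINT x|lborel. f x) = (LINT x|density (distr lborel borel ((*v) A)) (\<lambda>_. ennreal \<bar>det A\<bar>). f x)"
    unfolding lborel_eq_distr_matrix[OF assms(1), symmetric] ..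
  then show ?thesis by (simp add: integral_density integral_distr)
qed

lemma lborel_translate:
  fixes t :: "'a::euclidean_space" and f :: "'a \<Rightarrow> 'b::{banach, second_countable_topology}"
  shows AE_lborel_translate: "AE x in lborel. P x \<Longrightarrow> AE x in lborel. P (x + t)"
    and integrable_lborel_translate: "integrable lborel f \<Longrightarrow> integrable lborel (\<lambda>x. f (x + t))"
    and integral_lborel_translate: "f \<in> borel_measurable borel \<Longrightarrow> (LINT x|lborel. f (x + t)) = (LINT x|lborel. f x)"
    and nn_integral_lborel_translate: "g \<in> borel_measurable borel \<Longrightarrow> (\<integral>\<^sup>+x. g (x + t) \<partial>lborel) = (\<integral>\<^sup>+x. g x \<partial>lborel)"
proof -
  have d: "distr lborel borel (\<lambda>x. x + t) = lborel"
  proof -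
    have "(\<lambda>x. x + t) = (+) t" by (simp add: fun_eq_iff add.commute)
    then show ?thesis by (simp only: lborel_distr_plus)
  qed
  show "AE x in lborel. P (x + t)" if "AE x in lborel. P x"
    by (rule AE_distrD[of "\<lambda>x. x + t" lborel borel]) (simp_all only: that d, simp)
  show "integrable lborel (\<lambda>x. f (x + t))" if "integrable lborel f"
    by (rule integrable_distr[of "\<lambda>x. x + t" lborel borel]) (simp_all only: that d, simp)
  show "(LINT x|lborel. f (x + t)) = (LINT x|lborel. f x)" if "f \<in> borel_measurable borel"
    using integral_distr[of "\<lambda>x. x + t" lborel borel f] that unfolding d by simp
  show "(\<integral>\<^sup>+x. g (x + t) \<partial>lborel) = (\<integral>\<^sup>+x. g x \<partial>lborel)" if "g \<in> borel_measurable borel"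
    using nn_integral_distr[of "\<lambda>x. x + t" lborel borel g] that unfolding d by simp
qed

section \<open>Powers of the inverse of an expansive matrix\<close>

definition poly_act :: "complex^'n^'n \<Rightarrow> complex poly \<Rightarrow> complex^'n \<Rightarrow> complex^'n" where
  "poly_act C p v = (\<Sum>i\<le>degree p. coeff p i *s (((*v) C) ^^ i) v)"

lemma poly_act_eq:
  assumes "degree p \<le> N"
  shows "poly_act C p v = (\<Sum>i\<le>N. coeff p i *s (((*v) C) ^^ i) v)"
  unfolding poly_act_def
  by (rule sum.mono_neutral_left) (use assms in \<open>auto simp: coeff_eq_0\<close>)

lemma mult_vec_sum: "(C :: complex^'n^'n) *v (\<Sum>i\<in>I. f i) = (\<Sum>i\<in>I. C *v f i)"
  by (induct I rule: infinite_finite_induct) (auto simp: matrix_vector_right_distrib)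

lemma funpow_mult_diff: "(((*v) (C :: complex^'n^'n)) ^^ i) (C *v v - c *s v) =
    (((*v) C) ^^ Suc i) v - c *s (((*v) C) ^^ i) v"
proof (induct i)
  case (Suc i)
  show ?case unfolding funpow.simps(2) o_def Suc
    by (simp add: matrix_vector_mult_diff_distrib vector_scalar_commute)
qed simp

text \<open>A root \<open>c\<close> of an annihilating polynomial can be moved to the vector or be read as an eigenvalue equation.\<close>

lemma poly_act_factor:
  "poly_act C ([:- c, 1:] * q) v = poly_act C q (C *v v - c *s v)"
  "poly_act C ([:- c, 1:] * q) v = C *v poly_act C q v - c *s poly_act C q v"
proof -
  let ?N = "Suc (degree q)"
  let ?f = "\<lambda>i. (((*v) C) ^^ i) v"
  have deg: "degree ([:- c, 1:] * q) \<le> ?N"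
    by (rule order.trans[OF degree_mult_le]) simp
  have co: "coeff ([:- c, 1:] * q) i = (case i of 0 \<Rightarrow> 0 | Suc j \<Rightarrow> coeff q j) - c * coeff q i" for i
    by (simp add: mult_pCons_left coeff_pCons split: nat.splits)
  have "poly_act C ([:- c, 1:] * q) v = (\<Sum>i\<le>?N. coeff ([:- c, 1:] * q) i *s ?f i)"
    by (rule poly_act_eq[OF deg])
  also have "\<dots> = (\<Sum>i\<le>?N. (case i of 0 \<Rightarrow> 0 | Suc j \<Rightarrow> coeff q j) *s ?f i) - (\<Sum>i\<le>?N. (c * coeff q i) *s ?f i)"
    unfolding co by (simp add: vector_sub_rdistrib sum_subtractf)
  also have "(\<Sum>i\<le>?N. (case i of 0 \<Rightarrow> 0 | Suc j \<Rightarrow> coeff q j) *s ?f i) = (\<Sum>i\<le>degree q. coeff q i *s ?f (Suc i))"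
    by (subst sum.atMost_Suc_shift) simp
  also have "(\<Sum>i\<le>?N. (c * coeff q i) *s ?f i) = (\<Sum>i\<le>degree q. (c * coeff q i) *s ?f i)"
    by (simp add: coeff_eq_0)
  finally have *: "poly_act C ([:- c, 1:] * q) v =
      (\<Sum>i\<le>degree q. coeff q i *s ?f (Suc i)) - (\<Sum>i\<le>degree q. (c * coeff q i) *s ?f i)" .
  show "poly_act C ([:- c, 1:] * q) v = poly_act C q (C *v v - c *s v)"
    unfolding * unfolding poly_act_def funpow_mult_diff
    by (simp add: vector_ssub_ldistrib sum_subtractf mult.commute vector_smult_assoc)
  show "poly_act C ([:- c, 1:] * q) v = C *v poly_act C q v - c *s poly_act C q v"
    unfolding * unfolding poly_act_def
    by (simp add: mult_vec_sum vector_scalar_commute vec.scale_sum_right vector_smult_assoc)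
qed

text \<open>More iterates of \<open>v\<close> than the real dimension are linearly dependent, even over the reals.\<close>

lemma annihilating_poly_exists:
  fixes C :: "complex^'n^'n"
  shows "\<exists>p. p \<noteq> 0 \<and> poly_act C p v = 0"
proof -
  let ?D = "DIM(complex^'n)"
  let ?f = "\<lambda>i. (((*v) C) ^^ i) v"
  have "\<exists>c :: nat \<Rightarrow> real. (\<exists>i\<le>?D. c i \<noteq> 0) \<and> (\<Sum>i\<le>?D. c i *\<^sub>R ?f i) = 0"
  \<comment> \<open>A repeated iterate shrinks the set of iterates, but is itself a linear relation.\<close>
  proof (cases "inj_on ?f {..?D}")
    case False
    then obtain i j where ij: "i \<le> ?D" "j \<le> ?D" "i \<noteq> j" "?f i = ?f j"
      by (auto simp: inj_on_def)
    let ?c = "\<lambda>k. if k = i then 1 else if k = j then -1 else 0 :: real"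
    have "(\<Sum>k\<le>?D. ?c k *\<^sub>R ?f k) = (\<Sum>k\<in>{i, j}. ?c k *\<^sub>R ?f k)"
      by (rule sum.mono_neutral_right) (use ij in auto)
    also have "\<dots> = 0" using ij by simp
    finally show ?thesis using ij by (intro exI[of _ ?c]) auto
  next
    case True
    have "dependent (?f ` {..?D})"
      by (rule dependent_biggerset) (use card_image[OF True] in simp)
    then obtain u where u: "\<exists>x\<in>?f ` {..?D}. u x \<noteq> 0" "(\<Sum>x\<in>?f ` {..?D}. u x *\<^sub>R x) = 0"
      unfolding dependent_finite[OF finite_imageI[OF finite_atMost]] by blast
    have "(\<Sum>i\<le>?D. u (?f i) *\<^sub>R ?f i) = 0"
      using u(2) sum.reindex[OF True, of "\<lambda>x. u x *\<^sub>R x"] by (simp add: o_def)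
    then show ?thesis using u(1) by (intro exI[of _ "\<lambda>i. u (?f i)"]) auto
  qed
  then obtain c :: "nat \<Rightarrow> real" where c: "\<exists>i\<le>?D. c i \<noteq> 0" "(\<Sum>i\<le>?D. c i *\<^sub>R ?f i) = 0" by auto
  define p where "p = (\<Sum>i\<le>?D. monom (complex_of_real (c i)) i)"
  have co: "coeff p k = (if k \<le> ?D then complex_of_real (c k) else 0)" for k
    by (simp add: p_def coeff_sum if_distrib[of complex_of_real])
  have "p \<noteq> 0" using c(1) co by (metis coeff_0 of_real_eq_0_iff)
  have "degree p \<le> ?D" by (rule degree_le) (auto simp: co)
  have "complex_of_real a *s w = a *\<^sub>R w" for a and w :: "complex^'n"
    unfolding vec_eq_iff vector_smult_component vector_scaleR_component by (simp add: scaleR_conv_of_real)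
  then have "poly_act C p v = 0"
    using c(2) by (simp add: poly_act_eq[OF \<open>degree p \<le> ?D\<close>] co)
  with \<open>p \<noteq> 0\<close> show ?thesis by blast
qed

lemma tendsto_0_affine_recursion:
  fixes a w :: "nat \<Rightarrow> 'a::real_normed_vector"
  assumes rec: "\<And>k. norm (a (Suc k)) \<le> r * norm (a k) + norm (w k)"
    and r: "0 \<le> r" "r < 1" and w: "w \<longlonglongrightarrow> 0"
  shows "a \<longlonglongrightarrow> 0"
proof (rule LIMSEQ_I)
  fix e :: real assume e: "e > 0"
  \<comment> \<open>Once the perturbation stays below \<open>d\<close>, its total effect is at most \<open>d / (1 - r) = e / 2\<close>.\<close>
  define d where "d = (1 - r) * e / 2"
  have d: "d > 0" using e r by (simp add: d_def)
  obtain K where K: "\<And>k. k \<ge> K \<Longrightarrow> norm (w k) < d"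
    using LIMSEQ_D[OF w d] by auto
  have bd: "norm (a (K + m)) \<le> r ^ m * norm (a K) + e / 2" for m
  proof (induct m)
    case 0 then show ?case using e by simp
  next
    case (Suc m)
    have "norm (a (K + Suc m)) \<le> r * norm (a (K + m)) + norm (w (K + m))" using rec by simp
    also have "\<dots> \<le> r * (r ^ m * norm (a K) + e / 2) + d"
      using Suc r K[of "K + m"] by (intro add_mono mult_left_mono) auto
    also have "\<dots> = r ^ Suc m * norm (a K) + e / 2" by (simp add: d_def field_simps)
    finally show ?case .
  qed
  have "(\<lambda>m. r ^ m * norm (a K)) \<longlonglongrightarrow> 0"
    using tendsto_mult_right[OF LIMSEQ_power_zero[of r], of "norm (a K)"] r by simp
  then obtain M where M: "\<And>m. m \<ge> M \<Longrightarrow> norm (r ^ m * norm (a K)) < e / 2"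
    using LIMSEQ_D[of _ 0 "e / 2"] e by (metis diff_zero half_gt_zero)
  show "\<exists>no. \<forall>n\<ge>no. norm (a n - 0) < e"
  proof (intro exI allI impI)
    fix n assume "n \<ge> K + M"
    then have "norm (a (K + (n - K))) \<le> r ^ (n - K) * norm (a K) + e / 2" "r ^ (n - K) * norm (a K) < e / 2"
      using bd[of "n - K"] M[of "n - K"] r by (auto simp: abs_mult)
    then show "norm (a n - 0) < e" using \<open>n \<ge> K + M\<close> by simp
  qed
qed

text \<open>Induction on the degree of a polynomial that annihilates the orbit of \<open>v\<close>: a root outside the
  spectrum can be cancelled, and a root \<open>c\<close> inside the disc turns the decay for \<open>C v - c v\<close> into the
  decay for \<open>v\<close>.\<close>

lemma funpow_matrix_tendsto_0:
  fixes C :: "complex^'n^'n"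
  assumes ev: "\<And>c w. w \<noteq> 0 \<Longrightarrow> C *v w = c *s w \<Longrightarrow> cmod c < 1"
  shows "(\<lambda>k. (((*v) C) ^^ k) v) \<longlonglongrightarrow> 0"
proof -
  have "(\<lambda>k. (((*v) C) ^^ k) v) \<longlonglongrightarrow> 0" if "p \<noteq> 0" "poly_act C p v = 0" "degree p = n" for p n v
    using that
  proof (induct n arbitrary: p v)
    case 0
    then obtain a where "p = [:a:]" "a \<noteq> 0" by (metis degree_0_id of_nat_0 pCons_0_0 degree_eq_zeroE)
    then have "v = 0" using 0(2) by (simp add: poly_act_def)
    moreover have "(((*v) C) ^^ k) 0 = 0" for k by (induct k) auto
    ultimately show ?case by simp
  next
    case (Suc n)
    have "\<not> constant (poly p)" using Suc(4) by (simp add: constant_degree)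
    then obtain c where "poly p c = 0" using fundamental_theorem_of_algebra by blast
    then obtain q where p: "p = [:- c, 1:] * q" by (auto simp: poly_eq_0_iff_dvd)
    have q: "q \<noteq> 0" using Suc(2) p by auto
    have "degree p = Suc (degree q)"
      using q unfolding p by (subst degree_mult_eq) auto
    then have dq: "degree q = n" using Suc(4) by simp
    have IH: "(\<lambda>k. (((*v) C) ^^ k) (C *v v - c *s v)) \<longlonglongrightarrow> 0"
      by (rule Suc(1)[OF q _ dq]) (metis Suc(3) p poly_act_factor(1))
    show ?case
    proof (cases "cmod c < 1")
      case True
      have n: "norm (c *s w) \<le> cmod c * norm w" for w :: "complex^'n"
      proof -
        have "norm (c *s w) = norm (cmod c *\<^sub>R w)"
          unfolding norm_vec_def L2_set_def by (simp add: norm_mult)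
        then show ?thesis by simp
      qed
      show ?thesis
      proof (rule tendsto_0_affine_recursion[OF _ _ True IH])
        fix k
        have "(((*v) C) ^^ Suc k) v = c *s (((*v) C) ^^ k) v + (((*v) C) ^^ k) (C *v v - c *s v)"
          unfolding funpow_mult_diff by simp
        then show "norm ((((*v) C) ^^ Suc k) v) \<le> cmod c * norm ((((*v) C) ^^ k) v) + norm ((((*v) C) ^^ k) (C *v v - c *s v))"
          by (metis (no_types, lifting) norm_triangle_ineq add_right_mono n order.trans)
      qed simp
    next
      case False
      have "C *v poly_act C q v = c *s poly_act C q v"
        using Suc(3) unfolding p poly_act_factor(2) by simp
      then have "poly_act C q v = 0" using ev False by blast
      then show ?thesis by (rule Suc(1)[OF q _ dq])
    qed
  qed
  then show ?thesis using annihilating_poly_exists by blast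
qed

definition complexify_vec :: "real^'n \<Rightarrow> complex^'n" where
  "complexify_vec x = (\<chi> i. complex_of_real (x $ i))"

definition complexify_mat :: "real^'n^'n \<Rightarrow> complex^'n^'n" where
  "complexify_mat A = (\<chi> i j. complex_of_real (A $ i $ j))"

lemma complexify_mult: "complexify_mat A *v complexify_vec x = complexify_vec (A *v x)"
  by (simp add: complexify_mat_def complexify_vec_def matrix_vector_mult_def vec_eq_iff)

lemma complexify_mat_mult: "complexify_mat A ** complexify_mat B = complexify_mat (A ** B)"
  by (simp add: complexify_mat_def matrix_matrix_mult_def vec_eq_iff)

lemma complexify_mat_1: "complexify_mat (mat 1) = mat 1"
  by (simp add: complexify_mat_def mat_def vec_eq_iff)

lemma norm_complexify_vec: "norm (complexify_vec x) = norm x"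
  by (simp add: complexify_vec_def norm_vec_def)

lemma matrix_inv_mult:
  fixes A :: "real^'n^'n"
  assumes "det A \<noteq> 0"
  shows "A ** matrix_inv A = mat 1" "matrix_inv A ** A = mat 1"
  using someI_ex[of "\<lambda>A'. A ** A' = mat 1 \<and> A' ** A = mat 1"] assms
  by (auto simp: matrix_inv_def invertible_det_nz[symmetric] invertible_def)

lemma matrix_inv_vec [simp]:
  fixes A :: "real^'n^'n"
  assumes "det A \<noteq> 0"
  shows "A *v (matrix_inv A *v x) = x" "matrix_inv A *v (A *v x) = x"
  using matrix_inv_mult[OF assms] by (simp_all add: matrix_vector_mul_assoc)

lemma det_matrix_inv:
  fixes A :: "real^'n^'n"
  assumes "det A \<noteq> 0"
  shows "det (matrix_inv A) = inverse (det A)"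
proof -
  have "det A * det (matrix_inv A) = 1"
    using matrix_inv_mult(1)[OF assms] by (metis det_I det_mul)
  then show ?thesis by (rule inverse_unique[symmetric])
qed

lemma matrix_inv_matrix_inv:
  fixes A :: "real^'n^'n"
  assumes "det A \<noteq> 0"
  shows "matrix_inv (matrix_inv A) = A"
proof -
  have "det (matrix_inv A) \<noteq> 0" using assms by (simp add: det_matrix_inv)
  then have "A ** (matrix_inv A ** matrix_inv (matrix_inv A)) = A"
    by (simp add: matrix_inv_mult)
  then show ?thesis unfolding matrix_mul_assoc matrix_inv_mult(1)[OF assms] by simp
qed

lemma linear_funpow: "linear f \<Longrightarrow> linear (f ^^ k)" for f :: "'x::real_vector \<Rightarrow> 'x"
  by (induct k) (auto simp: linear_compose id_def[symmetric] linear_id)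

locale expansive_matrix =
  fixes A :: "real^'n^'n"
  assumes expansive: "\<And>\<mu>. \<mu> \<in> eigenvalues A \<Longrightarrow> cmod \<mu> > 1"
begin

lemma det_nz: "det A \<noteq> 0"
proof
  assume "det A = 0"
  then have "\<not> inj ((*v) A)" by (metis det_nz_iff_inj matrix_of_matrix_vector_mul matrix_vector_mul_linear)
  then obtain x where x: "x \<noteq> 0" "A *v x = 0"
    by (metis linear_injective_0 matrix_vector_mul_linear)
  have "complexify_mat A *v complexify_vec x = 0 *s complexify_vec x"
    unfolding complexify_mult x(2) by (simp add: complexify_vec_def vec_eq_iff)
  moreover have "complexify_vec x \<noteq> 0"
    using x(1) norm_complexify_vec[of x] by auto
  ultimately have "0 \<in> eigenvalues A"
    unfolding eigenvalues_def complexify_mat_def by blast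
  then show False using expansive by fastforce
qed

lemma inv_funpow_tendsto_0: "(\<lambda>k. (((*v) (matrix_inv A)) ^^ k) x) \<longlonglongrightarrow> 0"
proof -
  let ?B = "complexify_mat (matrix_inv A)"
  have "(\<lambda>k. (((*v) ?B) ^^ k) (complexify_vec x)) \<longlonglongrightarrow> 0"
  proof (rule funpow_matrix_tendsto_0)
    fix c w assume w: "w \<noteq> 0" and cw: "?B *v w = c *s w"
    have "complexify_mat A *v (?B *v w) = w"
      by (simp add: matrix_vector_mul_assoc complexify_mat_mult matrix_inv_mult[OF det_nz] complexify_mat_1)
    then have *: "c *s (complexify_mat A *v w) = w"
      unfolding cw by (simp add: vector_scalar_commute)
    have "c \<noteq> 0" using * w by auto
    then have "complexify_mat A *v w = inverse c *s w"
      using arg_cong[OF *, of "\<lambda>z. inverse c *s z"] by (simp add: vector_smult_assoc)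
    then have "inverse c \<in> eigenvalues A"
      using w unfolding eigenvalues_def complexify_mat_def by blast
    then have "cmod (inverse c) > 1" by (rule expansive)
    then show "cmod c < 1" using \<open>c \<noteq> 0\<close> by (simp add: norm_inverse one_less_inverse_iff)
  qed
  moreover have "(((*v) ?B) ^^ k) (complexify_vec x) = complexify_vec ((((*v) (matrix_inv A)) ^^ k) x)" for k
    by (induct k) (auto simp: complexify_mult)
  ultimately have "(\<lambda>k. norm (complexify_vec ((((*v) (matrix_inv A)) ^^ k) x))) \<longlonglongrightarrow> 0"
    using tendsto_norm_zero by fastforce
  then show ?thesis unfolding norm_complexify_vec by (rule tendsto_norm_zero_cancel)
qed

text \<open>A bound for the norm of the \<open>k\<close>-th power of the inverse. As a sum over the basis it inherits the convergence
  to \<open>0\<close> from single vectors, and by duality it bounds the powers of the inverse of the transpose as well.\<close>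

definition contraction :: "nat \<Rightarrow> real" where
  "contraction k = (\<Sum>b\<in>Basis. norm ((((*v) (matrix_inv A)) ^^ k) b))"

lemma contraction_tendsto: "contraction \<longlonglongrightarrow> 0"
  unfolding contraction_def[abs_def]
  by (intro tendsto_null_sum tendsto_norm_zero inv_funpow_tendsto_0)

lemma inv_funpow_le: "norm ((((*v) (matrix_inv A)) ^^ k) x) \<le> contraction k * norm x"
proof -
  let ?f = "((*v) (matrix_inv A)) ^^ k"
  have lin: "linear ?f" by (rule linear_funpow) (rule matrix_vector_mul_linear)
  have "?f x = ?f (\<Sum>b\<in>Basis. (x \<bullet> b) *\<^sub>R b)" by (simp add: euclidean_representation)
  also have "\<dots> = (\<Sum>b\<in>Basis. (x \<bullet> b) *\<^sub>R ?f b)"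
    using lin by (simp add: linear_sum linear_cmul)
  finally have eq: "?f x = (\<Sum>b\<in>Basis. (x \<bullet> b) *\<^sub>R ?f b)" .
  have "norm (?f x) \<le> (\<Sum>b\<in>Basis. norm ((x \<bullet> b) *\<^sub>R ?f b))"
    unfolding eq by (rule norm_sum)
  also have "\<dots> \<le> (\<Sum>b\<in>Basis. norm x * norm (?f b))"
    by (intro sum_mono) (auto intro!: mult_right_mono Basis_le_norm)
  finally show ?thesis by (simp add: contraction_def sum_distrib_left mult.commute)
qed

lemma transpose_inv: "matrix_inv (transpose A) = transpose (matrix_inv A)"
proof -
  have d: "det (transpose A) \<noteq> 0" using det_nz by (simp add: det_transpose)
  have "transpose A ** transpose (matrix_inv A) = mat 1"
    unfolding matrix_transpose_mul[symmetric] matrix_inv_mult[OF det_nz] by (rule transpose_mat)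
  then have "matrix_inv (transpose A) ** (transpose A ** transpose (matrix_inv A)) = matrix_inv (transpose A)"
    by simp
  then show ?thesis unfolding matrix_mul_assoc matrix_inv_mult(2)[OF d] by simp
qed

lemma inv_transpose_funpow_le: "norm ((((*v) (matrix_inv (transpose A))) ^^ k) x) \<le> contraction k * norm x"
proof -
  let ?f = "((*v) (matrix_inv A)) ^^ k" and ?g = "((*v) (matrix_inv (transpose A))) ^^ k"
  have adj: "?g x \<bullet> y = x \<bullet> ?f y" for x y
    unfolding transpose_inv
  proof (induct k arbitrary: x y)
    case (Suc k)
    have "(((*v) (transpose (matrix_inv A))) ^^ Suc k) x \<bullet> y = (((*v) (transpose (matrix_inv A))) ^^ k) x \<bullet> (matrix_inv A *v y)"
      by (simp add: dot_lmul_matrix)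
    also have "\<dots> = x \<bullet> ((((*v) (matrix_inv A)) ^^ k) (matrix_inv A *v y))" by (rule Suc)
    also have "\<dots> = x \<bullet> ((((*v) (matrix_inv A)) ^^ Suc k) y)" by (simp add: funpow_swap1)
    finally show ?case .
  qed simp
  have "norm (?g x) * norm (?g x) = ?g x \<bullet> ?g x" by (simp only: dot_square_norm power2_eq_square)
  also have "\<dots> = x \<bullet> ?f (?g x)" by (rule adj)
  also have "\<dots> \<le> norm x * (contraction k * norm (?g x))"
    by (rule order.trans[OF norm_cauchy_schwarz]) (intro mult_left_mono inv_funpow_le norm_ge_zero)
  finally have *: "norm (?g x) * norm (?g x) \<le> (contraction k * norm x) * norm (?g x)" by (simp only: ac_simps)
  show ?thesis
  proof (cases "norm (?g x) = 0")
    case True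
    have "0 \<le> contraction k" by (simp add: contraction_def sum_nonneg)
    then show ?thesis using True by (simp only: mult_nonneg_nonneg norm_ge_zero)
  next
    case False
    then show ?thesis using * norm_ge_zero[of "?g x"] by (metis mult_right_le_imp_le order_le_less)
  qed
qed

text \<open>The entries of the powers of the inverse tend to \<open>0\<close>, hence so does their determinant.\<close>

lemma abs_det_gt_1: "\<bar>det A\<bar> > 1"
proof -
  let ?B = "matrix_inv A"
  define M where "M k = matrix (((*v) ?B) ^^ k)" for k
  have lin: "linear (((*v) ?B) ^^ k)" for k by (rule linear_funpow) (rule matrix_vector_mul_linear)
  have det_M: "det (M k) = det ?B ^ k" for k
  proof (induct k)
    case 0 then show ?case by (simp add: M_def matrix_id_mat_1)
  next
    case (Suc k)
    have "M (Suc k) = ?B ** M k"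
      unfolding M_def funpow.simps by (subst matrix_compose[OF lin]) auto
    then show ?case using Suc by (simp add: det_mul)
  qed
  have entries: "(\<lambda>k. M k $ i $ j) \<longlonglongrightarrow> 0" for i j
  proof -
    have "(\<lambda>k. (((*v) ?B ^^ k) (axis j 1)) $ i) \<longlonglongrightarrow> (0 :: real^'n) $ i"
      by (intro tendsto_vec_nth inv_funpow_tendsto_0)
    then show ?thesis by (simp add: M_def matrix_def)
  qed
  have "(\<lambda>k. det (M k)) \<longlonglongrightarrow> (\<Sum>p | p permutes (UNIV::'n set). of_int (sign p) * (\<Prod>i\<in>(UNIV::'n set). 0))"
    unfolding det_def by (intro tendsto_sum tendsto_mult tendsto_const tendsto_prod entries)
  then have "(\<lambda>k. det ?B ^ k) \<longlonglongrightarrow> 0" by (simp add: det_M power_0_left)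
  then have "\<exists>no. \<forall>k\<ge>no. norm (det ?B ^ k - 0) < 1" by (rule LIMSEQ_D) simp
  then obtain k where "norm (det ?B ^ k - 0) < 1" by blast
  then have "\<bar>det ?B\<bar> ^ k < 1" by (simp add: power_abs)
  then have "\<bar>det ?B\<bar> < 1" by (meson not_le one_le_power)
  then show ?thesis using det_nz by (simp add: det_matrix_inv abs_inverse inverse_less_1_iff)
qed

end

section \<open>Plancherel's theorem\<close>

text \<open>Fatou's lemma. It turns pointwise convergence of transforms, which is what dominated convergence
  provides, into membership in \<open>L\<^sup>2\<close> with a bound on the norm.\<close>

lemma nrm2_Fatou:
  assumes f: "\<And>k::nat. sq_integrable M (f k)" "\<And>k. nrm2 M (f k) \<le> b k" "b \<longlonglongrightarrow> B"
    and g: "g \<in> borel_measurable M" "AE x in M. (\<lambda>k. f k x) \<longlonglongrightarrow> g x"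
  shows "sq_integrable M g \<and> nrm2 M g \<le> B"
proof -
  have [measurable]: "f k \<in> borel_measurable M" "g \<in> borel_measurable M" for k
    using f g by (auto simp: sq_integrable_def)
  have "(\<integral>\<^sup>+x. ennreal ((cmod (g x))\<^sup>2) \<partial>M) = (\<integral>\<^sup>+x. liminf (\<lambda>k. ennreal ((cmod (f k x))\<^sup>2)) \<partial>M)"
  proof (rule nn_integral_cong_AE)
    show "AE x in M. ennreal ((cmod (g x))\<^sup>2) = liminf (\<lambda>k. ennreal ((cmod (f k x))\<^sup>2))"
      using g(2)
    proof eventually_elim
      case (elim x)
      then have "(\<lambda>k. ennreal ((cmod (f k x))\<^sup>2)) \<longlonglongrightarrow> ennreal ((cmod (g x))\<^sup>2)"
        by (intro tendsto_intros tendsto_ennrealI)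
      from lim_imp_Liminf[OF _ this] show ?case by simp
    qed
  qed
  also have "\<dots> \<le> liminf (\<lambda>k. \<integral>\<^sup>+x. ennreal ((cmod (f k x))\<^sup>2) \<partial>M)"
    by (rule nn_integral_liminf) measurable
  also have "\<dots> \<le> liminf (\<lambda>k. ennreal (b k))"
    by (rule Liminf_mono) (simp add: nn_integral_nrm2 f ennreal_leI)
  also have "\<dots> = ennreal B"
    by (rule lim_imp_Liminf) (auto intro: tendsto_ennrealI f)
  finally have le: "(\<integral>\<^sup>+x. ennreal ((cmod (g x))\<^sup>2) \<partial>M) \<le> ennreal B" .
  have "integrable M (\<lambda>x. (cmod (g x))\<^sup>2)"
    by (rule integrableI_bounded) (use le in \<open>auto simp: le_less_trans\<close>)
  then have s: "sq_integrable M g" by (simp add: sq_integrable_def)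
  have "0 \<le> B" using f(2) by (intro LIMSEQ_le_const[OF f(3)]) (meson nrm2_nonneg order.trans)
  then have "nrm2 M g \<le> B" using le unfolding nn_integral_nrm2[OF s] by simp
  with s show ?thesis by blast
qed

lemma borel_measurable_cis [measurable (raw)]:
  "f \<in> borel_measurable M \<Longrightarrow> (\<lambda>x. cis (f x)) \<in> borel_measurable M"
  by (rule borel_measurable_continuous_on[of cis]) (auto intro!: continuous_intros)

lemma integrable_cis_mult:
  assumes "integrable M f" "h \<in> borel_measurable M"
  shows "integrable M (\<lambda>x. f x * cis (h x))"
proof (rule Bochner_Integration.integrable_bound[OF assms(1)])
  show "(\<lambda>x. f x * cis (h x)) \<in> borel_measurable M" using assms by measurable
qed (auto simp: norm_mult)

lemma integrable_complex_of_real: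
  "integrable M (\<lambda>x. complex_of_real (f x)) \<longleftrightarrow> integrable M f"
  using Bochner_Integration.integrable_Re[of M "\<lambda>x. complex_of_real (f x)"] by auto

definition ft :: "('a::euclidean_space \<Rightarrow> complex) \<Rightarrow> 'a \<Rightarrow> complex" where
  "ft f \<xi> = (LINT x|lborel. f x * cis (- (x \<bullet> \<xi>)))"

lemma ft_measurable [measurable]:
  assumes [measurable]: "f \<in> borel_measurable borel"
  shows "ft f \<in> borel_measurable borel"
  unfolding ft_def[abs_def] by measurable

lemma ft_bound:
  assumes "integrable lborel f"
  shows "cmod (ft f \<xi>) \<le> (LINT x|lborel. cmod (f x))"
proof -
  have "cmod (ft f \<xi>) \<le> (LINT x|lborel. cmod (f x * cis (- (x \<bullet> \<xi>))))"
    unfolding ft_def by (rule integral_norm_bound)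
  then show ?thesis by (simp add: norm_mult)
qed

lemma ft_diff:
  assumes "integrable lborel f" "integrable lborel g"
  shows "ft (\<lambda>x. f x - g x) \<xi> = ft f \<xi> - ft g \<xi>"
  unfolding ft_def left_diff_distrib
  by (rule Bochner_Integration.integral_diff) (auto intro!: integrable_cis_mult assms)

text \<open>Fubini's theorem for the symmetric kernel of the transform.\<close>

lemma ft_multiplication:
  fixes f g :: "'a::euclidean_space \<Rightarrow> complex"
  assumes f: "integrable lborel f" and g: "integrable lborel g"
  shows "(LINT \<xi>|lborel. ft f \<xi> * g \<xi>) = (LINT x|lborel. f x * ft g x)"
proof -
  have [measurable]: "f \<in> borel_measurable borel" "g \<in> borel_measurable borel"
    using f g by auto
  let ?h = "\<lambda>\<xi> x. f x * g \<xi> * cis (- (x \<bullet> \<xi>))"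
  have int: "integrable (lborel \<Otimes>\<^sub>M lborel) (case_prod ?h)"
  proof (rule lborel_pair.Fubini_integrable)
    show "case_prod ?h \<in> borel_measurable (lborel \<Otimes>\<^sub>M lborel)" by measurable
    have "integrable lborel (\<lambda>\<xi>. cmod (g \<xi>) * (LINT x|lborel. cmod (f x)))"
      using g by simp
    then show "integrable lborel (\<lambda>\<xi>. LINT x|lborel. norm (case (\<xi>, x) of (\<xi>, x) \<Rightarrow> ?h \<xi> x))"
      by (simp add: norm_mult mult.commute)
    show "AE \<xi> in lborel. integrable lborel (\<lambda>x. case (\<xi>, x) of (\<xi>, x) \<Rightarrow> ?h \<xi> x)"
      using f by (auto intro!: integrable_cis_mult)
  qed
  have "(LINT \<xi>|lborel. ft f \<xi> * g \<xi>) = (LINT \<xi>|lborel. LINT x|lborel. ?h \<xi> x)"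
  proof (rule Bochner_Integration.integral_cong)
    fix \<xi>
    show "ft f \<xi> * g \<xi> = (LINT x|lborel. ?h \<xi> x)"
      unfolding ft_def integral_mult_left_zero[symmetric] by (simp only: ac_simps)
  qed simp
  also have "\<dots> = (LINT x|lborel. LINT \<xi>|lborel. ?h \<xi> x)"
    by (rule lborel_pair.Fubini_integral[OF int, symmetric])
  also have "\<dots> = (LINT x|lborel. f x * ft g x)"
  proof (rule Bochner_Integration.integral_cong)
    fix x
    show "(LINT \<xi>|lborel. ?h \<xi> x) = f x * ft g x"
      unfolding ft_def integral_mult_right_zero[symmetric] by (simp only: mult.assoc inner_commute)
  qed simp
  finally show ?thesis .
qed

subsection \<open>Gaussians\<close>

lemma
  fixes f :: "'a::euclidean_space \<Rightarrow> real \<Rightarrow> complex"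
  assumes f: "\<And>b. b \<in> Basis \<Longrightarrow> integrable lborel (f b)"
  shows integrable_lborel_prod: "integrable lborel (\<lambda>x::'a. \<Prod>b\<in>Basis. f b (x \<bullet> b))"
    and integral_lborel_prod: "(LINT x|lborel. (\<Prod>b\<in>Basis. f b (x \<bullet> b))) = (\<Prod>b\<in>(Basis :: 'a set). (LINT t|lborel. f b t))"
proof -
  let ?S = "\<lambda>y :: 'a \<Rightarrow> real. \<Sum>b\<in>Basis. y b *\<^sub>R b"
  have fm: "f b \<in> borel_measurable borel" if "b \<in> Basis" for b using f[OF that] by auto
  have [measurable]: "(\<lambda>x::'a. \<Prod>b\<in>Basis. f b (x \<bullet> b)) \<in> borel_measurable borel"
    by (intro borel_measurable_prod measurable_compose[OF _ fm]) auto
  have eq: "(\<Prod>b\<in>Basis. f b (?S y \<bullet> b)) = (\<Prod>b\<in>Basis. f b (y b))" for y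
    by (intro prod.cong) (auto simp: inner_sum_left_Basis)
  have "integrable (\<Pi>\<^sub>M b\<in>Basis. lborel) (\<lambda>y. \<Prod>b\<in>Basis. f b (y b))"
    using f by (intro lborel_product.product_integrable_prod) auto
  then show "integrable lborel (\<lambda>x::'a. \<Prod>b\<in>Basis. f b (x \<bullet> b))"
    by (subst lborel_eq, subst integrable_distr_eq) (auto simp: eq)
  have "(LINT x|lborel. (\<Prod>b\<in>Basis. f b (x \<bullet> b))) = (LINT y|(\<Pi>\<^sub>M b\<in>Basis. lborel). (\<Prod>b\<in>Basis. f b (?S y \<bullet> b)))"
    by (subst lborel_eq, subst integral_distr) auto
  also have "\<dots> = (\<Prod>b\<in>(Basis :: 'a set). (LINT t|lborel. f b t))"
    unfolding eq using f by (intro lborel_product.product_integral_prod) auto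
  finally show "(LINT x|lborel. (\<Prod>b\<in>Basis. f b (x \<bullet> b))) = (\<Prod>b\<in>(Basis :: 'a set). (LINT t|lborel. f b t))" .
qed

lemma gaussian_1d:
  shows integrable_gaussian_1d: "integrable lborel (\<lambda>t. complex_of_real (exp (- t\<^sup>2 / 2)) * cis (- (t * s)))"
    and integral_gaussian_1d: "(LINT t|lborel. complex_of_real (exp (- t\<^sup>2 / 2)) * cis (- (t * s))) =
        complex_of_real (sqrt (2 * pi) * exp (- s\<^sup>2 / 2))"
proof -
  have d: "exp (- t\<^sup>2 / 2) = sqrt (2 * pi) * std_normal_density t" for t
    by (simp add: std_normal_density_def)
  have "integrable lborel (\<lambda>t. complex_of_real (exp (- t\<^sup>2 / 2)))"
    unfolding d by (intro integrable_of_real integrable_mult_right) simp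
  then show "integrable lborel (\<lambda>t. complex_of_real (exp (- t\<^sup>2 / 2)) * cis (- (t * s)))"
    by (intro integrable_cis_mult) auto
  \<comment> \<open>The transform of the Gaussian is the characteristic function of the standard normal distribution.\<close>
  have "complex_of_real (exp (- (- s)\<^sup>2 / 2)) = char std_normal_distribution (- s)"
    unfolding char_std_normal_distribution by simp
  also have "\<dots> = (LINT t|lborel. std_normal_density t *\<^sub>R iexp (- s * t))"
    unfolding char_def by (subst integral_density) (auto simp: normal_density_nonneg)
  also have "\<dots> = (LINT t|lborel. complex_of_real (std_normal_density t) * cis (- (t * s)))"
    by (intro Bochner_Integration.integral_cong) (auto simp: scaleR_conv_of_real cis_conv_exp mult.commute)
  finally have e: "(LINT t|lborel. complex_of_real (std_normal_density t) * cis (- (t * s))) = complex_of_real (exp (- s\<^sup>2 / 2))"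
    by simp
  have "(LINT t|lborel. complex_of_real (exp (- t\<^sup>2 / 2)) * cis (- (t * s))) =
     (LINT t|lborel. complex_of_real (sqrt (2 * pi)) * (complex_of_real (std_normal_density t) * cis (- (t * s))))"
    unfolding d of_real_mult mult.assoc ..
  then show "(LINT t|lborel. complex_of_real (exp (- t\<^sup>2 / 2)) * cis (- (t * s))) =
        complex_of_real (sqrt (2 * pi) * exp (- s\<^sup>2 / 2))"
    unfolding integral_mult_right_zero e by simp
qed

definition gauss :: "'a::euclidean_space \<Rightarrow> real" where
  "gauss x = exp (- (norm x)\<^sup>2 / 2)"

lemma gauss_pos: "0 < gauss x" and gauss_0 [simp]: "gauss 0 = 1"
  by (simp_all add: gauss_def)

lemma gauss_measurable [measurable]: "gauss \<in> borel_measurable borel"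
  unfolding gauss_def[abs_def] by measurable

lemma gauss_prod: "gauss x = (\<Prod>b\<in>Basis. exp (- (x \<bullet> b)\<^sup>2 / 2))"
proof -
  have "(norm x)\<^sup>2 = (\<Sum>b\<in>Basis. (x \<bullet> b)\<^sup>2)"
    unfolding power2_norm_eq_inner by (subst euclidean_inner) (simp add: power2_eq_square)
  then have "- (norm x)\<^sup>2 / 2 = (\<Sum>b\<in>Basis. - (x \<bullet> b)\<^sup>2 / 2)"
    by (simp add: sum_negf sum_divide_distrib)
  then show ?thesis unfolding gauss_def by (simp only: exp_sum finite_Basis)
qed

lemma cis_sum: "cis (sum f I) = (\<Prod>i\<in>I. cis (f i))"
  by (induct I rule: infinite_finite_induct) (auto simp: cis_mult[symmetric])

lemma
  fixes \<xi> :: "'a::euclidean_space"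
  shows integrable_gauss: "integrable lborel (\<lambda>x::'a. complex_of_real (gauss x))"
    and ft_gauss: "ft (\<lambda>x. complex_of_real (gauss x)) \<xi> = complex_of_real (sqrt (2 * pi) ^ DIM('a) * gauss \<xi>)"
proof -
  let ?f = "\<lambda>\<xi> (b::'a) t. complex_of_real (exp (- t\<^sup>2 / 2)) * cis (- (t * (\<xi> \<bullet> b)))"
  have eq: "complex_of_real (gauss x) * cis (- (x \<bullet> \<xi>)) = (\<Prod>b\<in>Basis. ?f \<xi> b (x \<bullet> b))" for x \<xi> :: 'a
  proof -
    have "- (x \<bullet> \<xi>) = (\<Sum>b\<in>Basis. - ((x \<bullet> b) * (\<xi> \<bullet> b)))"
      by (subst euclidean_inner) (simp add: sum_negf)
    then show ?thesis by (simp add: gauss_prod cis_sum prod.distrib)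
  qed
  have i: "integrable lborel (?f \<xi> b)" for b \<xi> by (rule integrable_gaussian_1d)
  have "integrable lborel (\<lambda>x::'a. complex_of_real (gauss x) * cis (- (x \<bullet> 0)))"
    unfolding eq by (rule integrable_lborel_prod) (rule i)
  then show "integrable lborel (\<lambda>x::'a. complex_of_real (gauss x))" by simp
  have "ft (\<lambda>x. complex_of_real (gauss x)) \<xi> = (\<Prod>b\<in>Basis. (LINT t|lborel. ?f \<xi> b t))"
    unfolding ft_def eq by (rule integral_lborel_prod) (rule i)
  also have "\<dots> = complex_of_real (sqrt (2 * pi) ^ DIM('a) * gauss \<xi>)"
    unfolding integral_gaussian_1d by (simp add: gauss_prod prod.distrib flip: of_real_prod of_real_power)
  finally show "ft (\<lambda>x. complex_of_real (gauss x)) \<xi> = complex_of_real (sqrt (2 * pi) ^ DIM('a) * gauss \<xi>)" .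
qed

lemma
  fixes f :: "'a::euclidean_space \<Rightarrow> 'b::{banach, second_countable_topology}"
  assumes c: "c \<noteq> 0"
  shows integral_lborel_affine: "f \<in> borel_measurable borel \<Longrightarrow> (LINT x|lborel. f x) = \<bar>c\<bar> ^ DIM('a) *\<^sub>R (LINT x|lborel. f (t + c *\<^sub>R x))"
    and integrable_lborel_affine: "integrable lborel f \<Longrightarrow> integrable lborel (\<lambda>x. f (t + c *\<^sub>R x))"
proof -
  note d = lborel_affine[OF c, of t]
  show "(LINT x|lborel. f x) = \<bar>c\<bar> ^ DIM('a) *\<^sub>R (LINT x|lborel. f (t + c *\<^sub>R x))"
    if [measurable]: "f \<in> borel_measurable borel"
    by (subst d) (simp add: integral_density integral_distr)
  assume f: "integrable lborel f"
  then have [measurable]: "f \<in> borel_measurable borel" by auto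
  have "integrable lborel (\<lambda>x. \<bar>c\<bar> ^ DIM('a) *\<^sub>R f (t + c *\<^sub>R x))"
    using f by (subst (asm) d) (simp add: integrable_density integrable_distr_eq)
  from integrable_scaleR_right[OF this, of "inverse (\<bar>c\<bar> ^ DIM('a))"]
  show "integrable lborel (\<lambda>x. f (t + c *\<^sub>R x))" using c by simp
qed

lemma integrable_gauss_scaled:
  assumes "\<epsilon> \<noteq> 0"
  shows "integrable lborel (\<lambda>x::'a::euclidean_space. complex_of_real (gauss (\<epsilon> *\<^sub>R x)))"
  using integrable_lborel_affine[OF assms integrable_gauss, of 0] by simp

lemma ft_gauss_scaled:
  fixes x y :: "'a::euclidean_space"
  assumes e: "\<epsilon> > 0"
  shows "ft (\<lambda>\<xi>. complex_of_real (gauss (\<epsilon> *\<^sub>R \<xi>)) * cis (x \<bullet> \<xi>)) y =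
     complex_of_real (inverse (\<epsilon> ^ DIM('a)) * sqrt (2 * pi) ^ DIM('a) * gauss ((y - x) /\<^sub>R \<epsilon>))"
proof -
  let ?w = "(y - x) /\<^sub>R \<epsilon>"
  have "ft (\<lambda>x. complex_of_real (gauss x)) ?w =
      \<bar>\<epsilon>\<bar> ^ DIM('a) *\<^sub>R (LINT \<xi>|lborel. complex_of_real (gauss (0 + \<epsilon> *\<^sub>R \<xi>)) * cis (- ((0 + \<epsilon> *\<^sub>R \<xi>) \<bullet> ?w)))"
    unfolding ft_def by (rule integral_lborel_affine) (use e in auto)
  also have "(LINT \<xi>|lborel. complex_of_real (gauss (0 + \<epsilon> *\<^sub>R \<xi>)) * cis (- ((0 + \<epsilon> *\<^sub>R \<xi>) \<bullet> ?w))) =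
      ft (\<lambda>\<xi>. complex_of_real (gauss (\<epsilon> *\<^sub>R \<xi>)) * cis (x \<bullet> \<xi>)) y"
    unfolding ft_def
  proof (rule Bochner_Integration.integral_cong)
    fix \<xi>
    have *: "(0 + \<epsilon> *\<^sub>R \<xi>) \<bullet> ?w = \<xi> \<bullet> (y - x)" using e by simp
    have "cis (- ((0 + \<epsilon> *\<^sub>R \<xi>) \<bullet> ?w)) = cis (x \<bullet> \<xi>) * cis (- (\<xi> \<bullet> y))"
      unfolding * by (simp add: cis_mult inner_diff_right inner_commute)
    then show "complex_of_real (gauss (0 + \<epsilon> *\<^sub>R \<xi>)) * cis (- ((0 + \<epsilon> *\<^sub>R \<xi>) \<bullet> ?w)) =
        complex_of_real (gauss (\<epsilon> *\<^sub>R \<xi>)) * cis (x \<bullet> \<xi>) * cis (- (\<xi> \<bullet> y))" by simp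
  qed simp
  finally have "\<epsilon> ^ DIM('a) *\<^sub>R ft (\<lambda>\<xi>. complex_of_real (gauss (\<epsilon> *\<^sub>R \<xi>)) * cis (x \<bullet> \<xi>)) y =
      complex_of_real (sqrt (2 * pi) ^ DIM('a) * gauss ?w)"
    using e by (simp add: ft_gauss)
  then show ?thesis using e by (simp add: field_simps scaleR_conv_of_real)
qed

subsection \<open>Plancherel for integrable square-integrable functions\<close>

text \<open>Measurability is the only regularity imposed, so that the class is closed under cutting off level sets and
  contains the truncations of all square-integrable functions to bounded values on bounded sets.\<close>

definition test_function :: "('a::euclidean_space \<Rightarrow> complex) \<Rightarrow> bool" where
  "test_function f \<longleftrightarrow> f \<in> borel_measurable borel \<and> (\<exists>M R. \<forall>x. cmod (f x) \<le> M * indicator (cball 0 R) x)"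

lemma test_functionI:
  assumes "f \<in> borel_measurable borel" "\<And>x. cmod (f x) \<le> M" "\<And>x. norm x > R \<Longrightarrow> f x = 0"
  shows "test_function f"
  unfolding test_function_def
  using assms by (intro conjI exI[of _ M] exI[of _ R]) (auto simp: indicator_def not_le)

lemma test_functionE:
  assumes "test_function f"
  obtains M R where "f \<in> borel_measurable borel" "M > 0" "R > 0"
    "\<And>x. cmod (f x) \<le> M" "\<And>x. norm x > R \<Longrightarrow> f x = 0"
proof -
  obtain M R where f: "f \<in> borel_measurable borel" and b: "\<And>x. cmod (f x) \<le> M * indicator (cball 0 R) x"
    using assms by (auto simp: test_function_def)
  show ?thesis
  proof (rule that[of "\<bar>M\<bar> + 1" "\<bar>R\<bar> + 1"])
    show "cmod (f x) \<le> \<bar>M\<bar> + 1" for x using b[of x] by (cases "x \<in> cball 0 R") auto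
    show "f x = 0" if "norm x > \<bar>R\<bar> + 1" for x using b[of x] that by (cases "x \<in> cball 0 R") auto
  qed (use f in auto)
qed

lemma bounded_support_integrable:
  assumes "f \<in> borel_measurable borel" "\<And>x. cmod (f x) \<le> M" "\<And>x. norm x > R \<Longrightarrow> f x = 0"
  shows "integrable lborel f" "sq_integrable lborel f"
proof -
  have i: "integrable lborel (indicator (cball 0 R) :: 'a::euclidean_space \<Rightarrow> real)"
    by (intro integrable_real_indicator) (use emeasure_lborel_cball_finite[of 0 R] in auto)
  have M: "0 \<le> M" using assms(2)[of 0] norm_ge_zero order.trans by blast
  show "integrable lborel f"
    by (rule Bochner_Integration.integrable_bound[OF integrable_mult_right[OF i, of M]])
      (use assms M in \<open>auto simp: indicator_def not_le\<close>)
  have "integrable lborel (\<lambda>x. (cmod (f x))\<^sup>2)"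
    by (rule Bochner_Integration.integrable_bound[OF integrable_mult_right[OF i, of "M\<^sup>2"]])
      (use assms M in \<open>auto simp: indicator_def not_le intro!: power_mono\<close>)
  then show "sq_integrable lborel f" using assms(1) by (simp add: sq_integrable_def)
qed

lemma test_function_integrable:
  assumes "test_function f"
  shows "integrable lborel f" "sq_integrable lborel f" "f \<in> borel_measurable borel"
  using test_functionE[OF assms] bounded_support_integrable by metis+

lemma test_function_diff:
  assumes "test_function f" "test_function g"
  shows "test_function (\<lambda>x. f x - g x)"
proof -
  obtain M R where f: "f \<in> borel_measurable borel" "\<And>x. cmod (f x) \<le> M" "\<And>x. norm x > R \<Longrightarrow> f x = 0"
    using test_functionE[OF assms(1)] by metis
  obtain M' R' where g: "g \<in> borel_measurable borel" "\<And>x. cmod (g x) \<le> M'" "\<And>x. norm x > R' \<Longrightarrow> g x = 0"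
    using test_functionE[OF assms(2)] by metis
  show ?thesis
  proof (rule test_functionI[of _ "M + M'" "max R R'"])
    show "(\<lambda>x. f x - g x) \<in> borel_measurable borel" using f g by measurable
    show "cmod (f x - g x) \<le> M + M'" for x
      by (rule order.trans[OF norm_triangle_ineq4 add_mono]) (use f g in auto)
  qed (use f g in auto)
qed

lemma test_function_mult:
  assumes "test_function f" "h \<in> borel_measurable borel" "\<And>x. cmod (h x) \<le> C"
  shows "test_function (\<lambda>x. h x * f x)"
proof -
  obtain M R where f: "f \<in> borel_measurable borel" "\<And>x. cmod (f x) \<le> M" "\<And>x. norm x > R \<Longrightarrow> f x = 0"
    using test_functionE[OF assms(1)] by metis
  have C: "0 \<le> C" using assms(3)[of 0] norm_ge_zero order.trans by blast
  show ?thesis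
  proof (rule test_functionI[of _ "C * M" R])
    show "(\<lambda>x. h x * f x) \<in> borel_measurable borel" using f assms by measurable
    show "cmod (h x * f x) \<le> C * M" for x
      unfolding norm_mult by (rule mult_mono) (use f assms C in auto)
  qed (use f in auto)
qed

lemma test_function_cnj:
  assumes "test_function f"
  shows "test_function (\<lambda>x. cnj (f x))"
proof -
  obtain M R where f: "f \<in> borel_measurable borel" "\<And>x. cmod (f x) \<le> M" "\<And>x. norm x > R \<Longrightarrow> f x = 0"
    using test_functionE[OF assms(1)] by metis
  show ?thesis
    by (rule test_functionI[of _ M R]) (use f in \<open>auto intro: borel_measurable_cnj\<close>)
qed

definition cutoff :: "nat \<Rightarrow> ('a::euclidean_space \<Rightarrow> complex) \<Rightarrow> 'a \<Rightarrow> complex" where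
  "cutoff n f x = (if cmod (f x) \<le> real n \<and> norm x \<le> real n then f x else 0)"

lemma cmod_cutoff_le: "cmod (cutoff n f x) \<le> cmod (f x)"
  by (simp add: cutoff_def)

lemma test_function_cutoff: "f \<in> borel_measurable borel \<Longrightarrow> test_function (cutoff n f)"
  by (rule test_functionI[of _ "real n" "real n"]) (auto simp: cutoff_def[abs_def])

lemma cutoff_tendsto: "(\<lambda>n. cutoff n f x) \<longlonglongrightarrow> f x"
proof (rule tendsto_eventually)
  obtain K :: nat where K: "max (cmod (f x)) (norm x) \<le> real K" using real_arch_simple by blast
  show "\<forall>\<^sub>F n in sequentially. cutoff n f x = f x"
    using eventually_ge_at_top[of K] by eventually_elim (use K in \<open>auto simp: cutoff_def\<close>)
qed

definition plancherel :: "('a::euclidean_space \<Rightarrow> complex) \<Rightarrow> bool" where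
  "plancherel f \<longleftrightarrow> sq_integrable lborel (ft f) \<and> nrm2 lborel (ft f) = (2 * pi) ^ DIM('a) * nrm2 lborel f"

text \<open>With the factor \<open>gauss (\<epsilon> \<xi>)\<close> inserted, the integral of \<open>|ft f|\<^sup>2\<close> becomes, by the multiplication formula, the
  inner product of \<open>f\<close> with its convolution \<open>K\<close> with a narrow Gaussian. For \<open>\<epsilon> \<rightarrow> 0\<close> the former converges
  monotonically, and the latter by continuity of \<open>f\<close>.\<close>

lemma plancherel_continuous:
  fixes f :: "'a::euclidean_space \<Rightarrow> complex"
  assumes cont: "continuous_on UNIV f" and test: "test_function f"
  shows "plancherel f"
proof -
  define s where "s = sqrt (2 * pi) ^ DIM('a)"
  have s: "s > 0" by (simp add: s_def)
  have ss: "s * s = (2 * pi) ^ DIM('a)" unfolding s_def power_mult_distrib[symmetric] by simp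
  obtain M R where [measurable]: "f \<in> borel_measurable borel" and M: "\<And>x. cmod (f x) \<le> M"
    using test_functionE[OF test] by metis
  have M0: "M \<ge> 0" using M norm_ge_zero order.trans by blast
  note f = test_function_integrable[OF test]
  define L where "L = (LINT x|lborel. cmod (f x))"
  have L: "cmod (ft f \<xi>) \<le> L" for \<xi> unfolding L_def by (rule ft_bound[OF f(1)])
  define e where "e m = inverse (real (Suc m))" for m
  have e: "e m > 0" for m by (simp add: e_def)
  have e_lim: "e \<longlonglongrightarrow> 0" unfolding e_def[abs_def] by (rule LIMSEQ_inverse_real_of_nat)
  define K where "K m x = (LINT z|lborel. f (x + e m *\<^sub>R z) * complex_of_real (gauss z))" for m x
  define v where "v m \<xi> = cnj (ft f \<xi>) * complex_of_real (gauss (e m *\<^sub>R \<xi>))" for m \<xi>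
  have v_int: "integrable lborel (v m)" for m
  proof (rule Bochner_Integration.integrable_bound)
    show "integrable lborel (\<lambda>\<xi>::'a. L * complex_of_real (gauss (e m *\<^sub>R \<xi>)))"
      using integrable_gauss_scaled[of "e m"] e[of m] by auto
    show "AE x in lborel. norm (v m x) \<le> norm (L * complex_of_real (gauss (e m *\<^sub>R x)))"
      using L order.trans[OF norm_ge_zero L] by (auto simp: v_def norm_mult intro!: mult_right_mono)
  qed (unfold v_def, measurable)
  have ft_v: "ft (v m) x = cnj (complex_of_real s * K m x)" for m x
  proof -
    let ?g = "\<lambda>\<xi>. complex_of_real (gauss (e m *\<^sub>R \<xi>)) * cis (x \<bullet> \<xi>)"
    have g: "integrable lborel ?g"
      using e[of m] by (intro integrable_cis_mult integrable_gauss_scaled) auto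
    have "ft (v m) x = (LINT \<xi>|lborel. cnj (ft f \<xi> * ?g \<xi>))"
      unfolding ft_def[of "v m"] v_def by (simp add: inner_commute cis_cnj mult.assoc)
    also have "\<dots> = cnj (LINT \<xi>|lborel. ft f \<xi> * ?g \<xi>)" by (rule Bochner_Integration.integral_cnj)
    also have "(LINT \<xi>|lborel. ft f \<xi> * ?g \<xi>) = (LINT y|lborel. f y * ft ?g y)"
      by (rule ft_multiplication[OF f(1) g])
    also have "\<dots> = (LINT y|lborel. f y * complex_of_real (inverse (e m ^ DIM('a)) * s * gauss ((y - x) /\<^sub>R e m)))"
      unfolding ft_gauss_scaled[OF e] s_def ..
    also have "\<dots> = \<bar>e m\<bar> ^ DIM('a) *\<^sub>R (LINT z|lborel. f (x + e m *\<^sub>R z) *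
        complex_of_real (inverse (e m ^ DIM('a)) * s * gauss ((x + e m *\<^sub>R z - x) /\<^sub>R e m)))"
      using e[of m] by (intro integral_lborel_affine) auto
    also have "\<dots> = \<bar>e m\<bar> ^ DIM('a) *\<^sub>R (LINT z|lborel. complex_of_real (inverse (e m ^ DIM('a)) * s) *
        (f (x + e m *\<^sub>R z) * complex_of_real (gauss z)))"
      using e[of m] by (intro arg_cong[where f="\<lambda>z. \<bar>e m\<bar> ^ DIM('a) *\<^sub>R z"] Bochner_Integration.integral_cong) auto
    also have "\<dots> = complex_of_real s * K m x"
      unfolding integral_mult_right_zero K_def[symmetric] using e[of m] by (simp add: scaleR_conv_of_real field_simps)
    finally show ?thesis .
  qed
  have int_gauss: "integrable lborel (\<lambda>z::'a. gauss z)" using integrable_gauss unfolding integrable_complex_of_real .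
  have K_lim: "(\<lambda>m. K m x) \<longlonglongrightarrow> complex_of_real s * f x" for x
  proof -
    have "(\<lambda>m. K m x) \<longlonglongrightarrow> (LINT z|lborel. f (x + 0 *\<^sub>R z) * complex_of_real (gauss z))"
      unfolding K_def
    proof (rule integral_dominated_convergence)
      show "integrable lborel (\<lambda>z::'a. M * gauss z)" using int_gauss by simp
      show "AE z in lborel. norm (f (x + e m *\<^sub>R z) * complex_of_real (gauss z)) \<le> M * gauss z" for m
        using M by (intro AE_I2) (auto simp: norm_mult abs_of_pos[OF gauss_pos] intro!: mult_right_mono less_imp_le[OF gauss_pos])
      show "AE z in lborel. (\<lambda>m. f (x + e m *\<^sub>R z) * complex_of_real (gauss z)) \<longlonglongrightarrow> f (x + 0 *\<^sub>R z) * complex_of_real (gauss z)"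
      proof (rule AE_I2)
        fix z
        have "(\<lambda>m. f (x + e m *\<^sub>R z)) \<longlonglongrightarrow> f (x + 0 *\<^sub>R z)"
          by (rule continuous_on_tendsto_compose[OF cont]) (intro tendsto_intros e_lim, auto)
        then show "(\<lambda>m. f (x + e m *\<^sub>R z) * complex_of_real (gauss z)) \<longlonglongrightarrow> f (x + 0 *\<^sub>R z) * complex_of_real (gauss z)"
          by (intro tendsto_intros)
      qed
    qed measurable
    moreover have "(LINT z|lborel. complex_of_real (gauss (z::'a))) = complex_of_real s"
      using ft_gauss[of "0::'a"] by (simp add: ft_def s_def)
    ultimately show ?thesis by (simp add: mult.commute)
  qed
  have K_bound: "cmod (K m x) \<le> M * (LINT z|lborel. gauss (z::'a))" for m x
  proof -
    have "cmod (K m x) \<le> (LINT z|lborel. M * gauss (z::'a))"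
      unfolding K_def
    proof (rule order.trans[OF integral_norm_bound integral_mono])
      show "integrable lborel (\<lambda>z::'a. M * gauss z)" using int_gauss by simp
      then show "integrable lborel (\<lambda>z. cmod (f (x + e m *\<^sub>R z) * complex_of_real (gauss z)))"
        by (rule Bochner_Integration.integrable_bound)
          (use M0 M in \<open>auto simp: norm_mult abs_mult intro!: AE_I2 mult_right_mono\<close>)
      show "cmod (f (x + e m *\<^sub>R z) * complex_of_real (gauss z)) \<le> M * gauss z" for z
        using M by (auto simp: norm_mult abs_of_pos[OF gauss_pos] intro!: mult_right_mono less_imp_le[OF gauss_pos])
    qed
    then show ?thesis by simp
  qed
  have [measurable]: "K m \<in> borel_measurable borel" for m
    unfolding K_def[abs_def] by measurable
  let ?g = "\<lambda>m \<xi>. (cmod (ft f \<xi>))\<^sup>2 * gauss (e m *\<^sub>R \<xi>)"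
  have prod: "ft f \<xi> * v m \<xi> = complex_of_real (?g m \<xi>)" for m \<xi>
    unfolding v_def of_real_mult complex_norm_square by (simp only: mult.assoc)
  have g_int: "integrable lborel (?g m)" for m
  proof -
    have "integrable lborel (\<lambda>\<xi>. ft f \<xi> * v m \<xi>)"
    proof (rule Bochner_Integration.integrable_bound[OF integrable_mult_right[OF v_int[of m], of "complex_of_real L"]])
      show "AE x in lborel. norm (ft f x * v m x) \<le> norm (complex_of_real L * v m x)"
        using L order.trans[OF norm_ge_zero L] by (auto simp: norm_mult intro!: mult_right_mono)
    qed (unfold v_def, measurable)
    then show ?thesis unfolding prod integrable_complex_of_real .
  qed
  have "(\<lambda>m. LINT x|lborel. f x * cnj (complex_of_real s * K m x)) \<longlonglongrightarrow>
      (LINT x|lborel. f x * cnj (complex_of_real s * (complex_of_real s * f x)))"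
  proof (rule integral_dominated_convergence)
    show "integrable lborel (\<lambda>x. cmod (f x) * (s * (M * (LINT z|lborel. gauss (z::'a)))))" using f by simp
    show "AE x in lborel. (\<lambda>m. f x * cnj (complex_of_real s * K m x)) \<longlonglongrightarrow> f x * cnj (complex_of_real s * (complex_of_real s * f x))"
      by (intro AE_I2 tendsto_intros K_lim)
    show "AE x in lborel. norm (f x * cnj (complex_of_real s * K m x)) \<le> cmod (f x) * (s * (M * (LINT z|lborel. gauss (z::'a))))" for m
      using s K_bound by (intro AE_I2) (auto simp: norm_mult intro!: mult_left_mono)
  qed measurable
  moreover have "(LINT x|lborel. f x * cnj (complex_of_real s * K m x)) = complex_of_real (LINT \<xi>|lborel. ?g m \<xi>)" for m
  proof -
    have "(LINT x|lborel. f x * cnj (complex_of_real s * K m x)) = (LINT x|lborel. f x * ft (v m) x)"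
      unfolding ft_v ..
    also have "\<dots> = (LINT \<xi>|lborel. ft f \<xi> * v m \<xi>)"
      by (rule ft_multiplication[OF f(1) v_int, symmetric])
    finally show ?thesis unfolding prod integral_complex_of_real .
  qed
  moreover have "(LINT x|lborel. f x * cnj (complex_of_real s * (complex_of_real s * f x))) = complex_of_real (s * s * nrm2 lborel f)"
  proof -
    have "(LINT x|lborel. f x * cnj (complex_of_real s * (complex_of_real s * f x))) =
        (LINT x|lborel. complex_of_real (s * s) * (f x * cnj (f x)))"
      by (simp add: ac_simps)
    also have "\<dots> = complex_of_real (s * s) * ip lborel f f"
      unfolding ip_def by (rule integral_mult_right_zero)
    finally show ?thesis by (simp add: ip_self)
  qed
  ultimately have lim: "(\<lambda>m. LINT \<xi>|lborel. ?g m \<xi>) \<longlonglongrightarrow> s * s * nrm2 lborel f"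
    by (simp only: tendsto_of_real_iff)
  have "has_bochner_integral lborel (\<lambda>\<xi>. (cmod (ft f \<xi>))\<^sup>2) (s * s * nrm2 lborel f)"
  proof (rule has_bochner_integral_monotone_convergence[OF g_int _ _ lim])
    show "AE \<xi> in lborel. mono (\<lambda>m. ?g m \<xi>)"
    proof (intro AE_I2 monoI mult_left_mono)
      fix \<xi> :: 'a and m n :: nat assume "m \<le> n"
      then have "e n \<le> e m" by (simp add: e_def)
      then have "(norm (e n *\<^sub>R \<xi>))\<^sup>2 \<le> (norm (e m *\<^sub>R \<xi>))\<^sup>2"
        using e[of m] e[of n] by (intro power_mono) (auto intro!: mult_right_mono)
      then show "gauss (e m *\<^sub>R \<xi>) \<le> gauss (e n *\<^sub>R \<xi>)" by (simp add: gauss_def)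
    qed simp
    show "AE \<xi> in lborel. (\<lambda>m. ?g m \<xi>) \<longlonglongrightarrow> (cmod (ft f \<xi>))\<^sup>2"
    proof (rule AE_I2)
      fix \<xi> :: 'a
      have "(\<lambda>m. ?g m \<xi>) \<longlonglongrightarrow> (cmod (ft f \<xi>))\<^sup>2 * exp (- (norm (0 *\<^sub>R \<xi>))\<^sup>2 / 2)"
        unfolding gauss_def by (intro tendsto_intros e_lim) auto
      then show "(\<lambda>m. ?g m \<xi>) \<longlonglongrightarrow> (cmod (ft f \<xi>))\<^sup>2" by simp
    qed
  qed measurable
  then show ?thesis
    unfolding plancherel_def sq_integrable_def nrm2_def[of _ "ft f"]
    by (auto simp: has_bochner_integral_iff ss)
qed

text \<open>Along the sequence the transforms converge pointwise. Plancherel's theorem for the differences and Fatou's lemma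
  make this a convergence in \<open>L\<^sup>2\<close>, under which both sides of the identity are continuous.\<close>

lemma plancherel_limit:
  fixes f :: "'a::euclidean_space \<Rightarrow> complex" and F :: "nat \<Rightarrow> 'a \<Rightarrow> complex"
  assumes w: "integrable lborel w" "integrable lborel (\<lambda>x. (w x)\<^sup>2)"
    and F: "\<And>n. F n \<in> borel_measurable borel" "\<And>n. AE x in lborel. cmod (F n x) \<le> w x"
    and f: "f \<in> borel_measurable borel" "AE x in lborel. cmod (f x) \<le> w x"
    and lim: "AE x in lborel. (\<lambda>n. F n x) \<longlonglongrightarrow> f x"
    and pl: "\<And>n. plancherel (F n)" "\<And>m n. plancherel (\<lambda>x. F m x - F n x)"
  shows "plancherel f"
proof -
  note [measurable] = F(1) f(1)
  let ?N = "(2 * pi) ^ DIM('a)"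
  have wm: "w \<in> borel_measurable borel" using w(1) by auto
  have int: "integrable lborel h" "sq_integrable lborel h"
    if "h \<in> borel_measurable borel" "AE x in lborel. cmod (h x) \<le> w x" for h :: "'a \<Rightarrow> complex"
  proof -
    have b: "AE x in lborel. norm (h x) \<le> norm (w x)" using that(2) by eventually_elim auto
    show "integrable lborel h"
      by (rule Bochner_Integration.integrable_bound[OF w(1)]) (use that b in auto)
    have "sq_integrable lborel (\<lambda>x. complex_of_real (w x))"
      using w wm by (auto simp: sq_integrable_def)
    then show "sq_integrable lborel h"
      by (rule sq_integrable_bound[where C=1]) (use that b in auto)
  qed
  note Fi = int[OF F] and fi = int[OF f]
  have ft_lim: "(\<lambda>n. ft (F n) \<xi>) \<longlonglongrightarrow> ft f \<xi>" for \<xi>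
    unfolding ft_def
  proof (rule integral_dominated_convergence[OF _ _ w(1)])
    show "AE x in lborel. (\<lambda>i. F i x * cis (- (x \<bullet> \<xi>))) \<longlonglongrightarrow> f x * cis (- (x \<bullet> \<xi>))"
      using lim by eventually_elim (intro tendsto_intros)
    show "AE x in lborel. norm (F n x * cis (- (x \<bullet> \<xi>))) \<le> w x" for n
      using F(2)[of n] by eventually_elim (simp add: norm_mult)
  qed measurable
  have d0: "(\<lambda>n. nrm2 lborel (\<lambda>x. F n x - f x)) \<longlonglongrightarrow> 0"
    by (rule nrm2_dominated_convergence[OF w(2)]) (use F f lim in auto)
  have sqF: "sq_integrable lborel (ft (F n))" "nrm2 lborel (ft (F n)) = ?N * nrm2 lborel (F n)" for n
    using pl(1) by (auto simp: plancherel_def)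
  have key: "sq_integrable lborel (\<lambda>\<xi>. ft (F n) \<xi> - ft f \<xi>) \<and>
      nrm2 lborel (\<lambda>\<xi>. ft (F n) \<xi> - ft f \<xi>) \<le> ?N * nrm2 lborel (\<lambda>x. F n x - f x)" for n
  proof (rule nrm2_Fatou)
    have eq: "ft (\<lambda>x. F n x - F m x) = (\<lambda>\<xi>. ft (F n) \<xi> - ft (F m) \<xi>)" for m
      using ft_diff[OF Fi(1) Fi(1)] by auto
    show "sq_integrable lborel (\<lambda>\<xi>. ft (F n) \<xi> - ft (F m) \<xi>)" for m
      using pl(2)[of n m] unfolding plancherel_def eq by simp
    show "nrm2 lborel (\<lambda>\<xi>. ft (F n) \<xi> - ft (F m) \<xi>) \<le> ?N * nrm2 lborel (\<lambda>x. F n x - F m x)" for m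
      using pl(2)[of n m] unfolding plancherel_def eq by simp
    have d1: "(\<lambda>m. nrm2 lborel (\<lambda>x. (F n x - F m x) - (F n x - f x))) \<longlonglongrightarrow> 0"
      using d0 by (simp add: nrm2_minus_commute[of _ f])
    show "(\<lambda>m. ?N * nrm2 lborel (\<lambda>x. F n x - F m x)) \<longlonglongrightarrow> ?N * nrm2 lborel (\<lambda>x. F n x - f x)"
      by (intro tendsto_mult_left tendsto_nrm2[OF _ _ d1] sq_integrable_diff Fi(2) fi(2))
    show "AE \<xi> in lborel. (\<lambda>m. ft (F n) \<xi> - ft (F m) \<xi>) \<longlonglongrightarrow> ft (F n) \<xi> - ft f \<xi>"
      by (intro AE_I2 tendsto_intros ft_lim)
  qed measurable
  have sq: "sq_integrable lborel (ft f)"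
    using sq_integrable_diff[OF sqF(1)[of 0] conjunct1[OF key[of 0]]] by simp
  have "(\<lambda>n. nrm2 lborel (\<lambda>\<xi>. ft (F n) \<xi> - ft f \<xi>)) \<longlonglongrightarrow> 0"
  proof (rule tendsto_sandwich[OF _ _ tendsto_const])
    show "(\<lambda>n. ?N * nrm2 lborel (\<lambda>x. F n x - f x)) \<longlonglongrightarrow> 0"
      using tendsto_mult_left[OF d0, of ?N] by simp
  qed (use key in auto)
  then have "(\<lambda>n. nrm2 lborel (ft (F n))) \<longlonglongrightarrow> nrm2 lborel (ft f)"
    by (intro tendsto_nrm2 sqF sq)
  moreover have "(\<lambda>n. nrm2 lborel (ft (F n))) \<longlonglongrightarrow> ?N * nrm2 lborel f"
    unfolding sqF(2) by (intro tendsto_mult_left tendsto_nrm2[OF _ _ d0] Fi fi)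
  ultimately show ?thesis
    using sq LIMSEQ_unique by (auto simp: plancherel_def)
qed

text \<open>A measurable function is a limit almost everywhere of continuous functions \<open>g n\<close>. Composing these with the
  retraction \<open>c\<close> onto the disc of radius \<open>M\<close> and multiplying by the continuous bump \<open>k\<close>, which is \<open>1\<close> on the
  support of \<open>f\<close>, makes them uniformly bounded with bounded support and does not change the limit.\<close>

lemma continuous_approximation:
  fixes f :: "'a::euclidean_space \<Rightarrow> complex"
  assumes "test_function f"
  obtains F M R where "\<And>n. continuous_on UNIV (F n)" "\<And>n x. cmod (F n x) \<le> M * indicator (cball 0 R) x"
    "\<And>x. cmod (f x) \<le> M * indicator (cball 0 R) x" "AE x in lborel. (\<lambda>n. F n x) \<longlonglongrightarrow> f x"
proof -
  obtain M R where fm: "f \<in> borel_measurable borel" and M: "M > 0" "\<And>x. cmod (f x) \<le> M"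
    and R: "R > 0" "\<And>x. norm x > R \<Longrightarrow> f x = 0"
    using test_functionE[OF assms] by metis
  have "f \<in> borel_measurable lebesgue" using fm by (simp add: measurable_completion)
  then have "f measurable_on UNIV" by (rule lebesgue_measurable_imp_measurable_on) simp
  then obtain N g where N: "negligible N" and g: "\<And>n. continuous_on UNIV (g n)"
    and lim: "\<And>x. x \<notin> N \<Longrightarrow> (\<lambda>n. g n x) \<longlonglongrightarrow> f x"
    unfolding measurable_on_def by auto
  define c :: "complex \<Rightarrow> complex" where "c z = (M / max M (cmod z)) *\<^sub>R z" for z
  define k :: "'a \<Rightarrow> real" where "k x = max 0 (min 1 (R + 1 - norm x))" for x
  have c_cont: "continuous_on UNIV c"
    unfolding c_def[abs_def] using M by (intro continuous_intros) (auto simp: max_def)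
  have c_le: "cmod (c z) \<le> M" for z
    using M by (auto simp: c_def max_def field_simps)
  have c_id: "c z = z" if "cmod z \<le> M" for z using that M by (simp add: c_def)
  have c00: "c 0 = 0" by (simp add: c_def)
  have k01: "0 \<le> k x" "k x \<le> 1" for x by (auto simp: k_def)
  have k0: "k x = 0" if "norm x > R + 1" for x using that by (simp add: k_def)
  have k1: "k x = 1" if "norm x \<le> R" for x using that by (simp add: k_def)
  show ?thesis
  proof (rule that[of "\<lambda>n x. k x *\<^sub>R c (g n x)" M "R + 1"])
    show "continuous_on UNIV (\<lambda>x. k x *\<^sub>R c (g n x))" for n
    proof (intro continuous_on_scaleR)
      show "continuous_on UNIV k" unfolding k_def[abs_def] by (intro continuous_intros)
      show "continuous_on UNIV (\<lambda>x. c (g n x))"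
        by (rule continuous_on_compose2[OF c_cont g]) auto
    qed
    show "cmod (k x *\<^sub>R c (g n x)) \<le> M * indicator (cball 0 (R + 1)) x" for n x
    proof (cases "norm x \<le> R + 1")
      case True
      have "\<bar>k x\<bar> * cmod (c (g n x)) \<le> 1 * M" using k01[of x] by (intro mult_mono c_le) auto
      then show ?thesis using True by simp
    next
      case False then show ?thesis using k0[of x] by simp
    qed
    show "cmod (f x) \<le> M * indicator (cball 0 (R + 1)) x" for x
      using M(2)[of x] R(2)[of x] by (cases "norm x \<le> R + 1") auto
    have "AE x in lebesgue. x \<notin> N"
      using N by (intro AE_not_in) (simp add: negligible_iff_null_sets)
    then have "AE x in lborel. x \<notin> N" by (simp add: AE_completion_iff)
    then show "AE x in lborel. (\<lambda>n. k x *\<^sub>R c (g n x)) \<longlonglongrightarrow> f x"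
    proof eventually_elim
      case (elim x)
      have "(\<lambda>n. k x *\<^sub>R c (g n x)) \<longlonglongrightarrow> k x *\<^sub>R c (f x)"
        by (intro tendsto_scaleR tendsto_const continuous_on_tendsto_compose[OF c_cont lim[OF elim]]) auto
      moreover have "k x *\<^sub>R c (f x) = f x"
        using k1[of x] R(2)[of x] c_id[OF M(2)] c00 by (cases "norm x \<le> R") auto
      ultimately show ?case by simp
    qed
  qed
qed

lemma plancherel_test_function:
  fixes f :: "'a::euclidean_space \<Rightarrow> complex"
  assumes "test_function f"
  shows "plancherel f"
proof -
  obtain F M R where F: "\<And>n. continuous_on UNIV (F n)" "\<And>n x. cmod (F n x) \<le> M * indicator (cball 0 R) x"
    and f: "\<And>x. cmod (f x) \<le> M * indicator (cball 0 R) x" and lim: "AE x in lborel. (\<lambda>n. F n x) \<longlonglongrightarrow> f x"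
    using continuous_approximation[OF assms] by blast
  have Fm: "F n \<in> borel_measurable borel" for n using F(1) by (rule borel_measurable_continuous_onI)
  have t: "test_function (F n)" for n unfolding test_function_def using Fm F(2) by blast
  have i: "integrable lborel (indicator (cball (0::'a) R) :: 'a \<Rightarrow> real)"
    by (intro integrable_real_indicator) (use emeasure_lborel_cball_finite[of 0 R] in auto)
  have sq: "(M * indicator (cball 0 R) x)\<^sup>2 = M\<^sup>2 * indicator (cball 0 R) x" for x :: 'a
    by (simp add: indicator_def)
  show ?thesis
  proof (rule plancherel_limit[where F=F and w="\<lambda>x. M * indicator (cball 0 R) x"])
    show "integrable lborel (\<lambda>x::'a. M * indicator (cball 0 R) x)" using i by simp
    show "integrable lborel (\<lambda>x::'a. (M * indicator (cball 0 R) x)\<^sup>2)" unfolding sq using i by simp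
    show "plancherel (F n)" for n by (rule plancherel_continuous[OF F(1) t])
    show "plancherel (\<lambda>x. F m x - F n x)" for m n
      by (rule plancherel_continuous) (intro continuous_intros F test_function_diff t)+
    show "f \<in> borel_measurable borel" using assms by (rule test_function_integrable)
  qed (use F f lim Fm in auto)
qed

lemma plancherel_L1_L2:
  fixes f :: "'a::euclidean_space \<Rightarrow> complex"
  assumes f: "integrable lborel f" "sq_integrable lborel f"
  shows "plancherel f"
proof -
  have [measurable]: "f \<in> borel_measurable borel" using f by auto
  show ?thesis
  proof (rule plancherel_limit[where F="\<lambda>n. cutoff n f" and w="\<lambda>x. cmod (f x)"])
    show "AE x in lborel. (\<lambda>n. cutoff n f x) \<longlonglongrightarrow> f x" by (intro AE_I2 cutoff_tendsto)
    show "cutoff n f \<in> borel_measurable borel" for n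
      by (rule test_function_integrable(3)[OF test_function_cutoff]) simp
    show "plancherel (cutoff n f)" "plancherel (\<lambda>x. cutoff m f x - cutoff n f x)" for m n
      by (intro plancherel_test_function test_function_diff test_function_cutoff; simp)+
  qed (use f in \<open>auto simp: cmod_cutoff_le sq_integrable_def\<close>)
qed

subsection \<open>The transform on all square-integrable functions\<close>

definition truncation :: "real \<Rightarrow> ('a::euclidean_space \<Rightarrow> complex) \<Rightarrow> 'a \<Rightarrow> complex" where
  "truncation R f x = indicator (ball 0 R) x * f x"

lemma truncation_props:
  fixes f :: "'a::euclidean_space \<Rightarrow> complex"
  assumes f: "sq_integrable lborel f"
  shows "sq_integrable lborel (truncation R f)" "integrable lborel (truncation R f)"
    "truncation R f \<in> borel_measurable borel"
proof -
  have [measurable]: "f \<in> borel_measurable borel" using f by (auto simp: sq_integrable_def)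
  show sq: "sq_integrable lborel (truncation R f)"
    unfolding truncation_def[abs_def] by (rule sq_integrable_indicator[OF f]) simp
  then show "truncation R f \<in> borel_measurable borel" by (auto simp: sq_integrable_def)
  have "sq_integrable lborel (indicator (ball 0 R) :: 'a \<Rightarrow> complex)"
  proof (rule test_function_integrable)
    show "test_function (indicator (ball 0 R) :: 'a \<Rightarrow> complex)"
      by (rule test_functionI[of _ 1 R]) (auto simp: indicator_def intro!: borel_measurable_indicator)
  qed
  from integrable_mult_cnj[OF f this]
  show "integrable lborel (truncation R f)"
    unfolding truncation_def[abs_def]
    by (rule Bochner_Integration.integrable_cong[THEN iffD1, rotated -1]) (auto simp: indicator_def)
qed

lemma truncation_tendsto:
  fixes f :: "'a::euclidean_space \<Rightarrow> complex"
  assumes f: "sq_integrable lborel f"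
  shows "((\<lambda>R. nrm2 lborel (\<lambda>x. f x - truncation R f x)) \<longlongrightarrow> 0) at_top"
proof (rule tendsto_at_topI_sequentially)
  fix X :: "nat \<Rightarrow> real" assume X: "filterlim X at_top sequentially"
  have "(\<lambda>n. nrm2 lborel (\<lambda>x. truncation (X n) f x - f x)) \<longlonglongrightarrow> 0"
  proof (rule nrm2_dominated_convergence[where w="\<lambda>x. cmod (f x)"])
    show "AE x in lborel. (\<lambda>n. truncation (X n) f x) \<longlonglongrightarrow> f x"
    proof (rule AE_I2)
      fix x :: 'a
      have "\<forall>\<^sub>F n in sequentially. norm x < X n"
        using X by (auto simp: filterlim_at_top_dense)
      then have "\<forall>\<^sub>F n in sequentially. truncation (X n) f x = f x"
        by eventually_elim (simp add: truncation_def)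
      then show "(\<lambda>n. truncation (X n) f x) \<longlonglongrightarrow> f x" by (rule tendsto_eventually)
    qed
    show "truncation (X n) f \<in> borel_measurable lborel" for n
      using truncation_props(3)[OF f] by simp
  qed (use f in \<open>auto simp: sq_integrable_def truncation_def indicator_def\<close>)
  then show "(\<lambda>n. nrm2 lborel (\<lambda>x. f x - truncation (X n) f x)) \<longlonglongrightarrow> 0"
    by (subst nrm2_minus_commute)
qed

text \<open>A relation, since a transform is determined only up to null sets and any representative may occur.\<close>

definition is_ft :: "('a::euclidean_space \<Rightarrow> complex) \<Rightarrow> ('a \<Rightarrow> complex) \<Rightarrow> bool" where
  "is_ft f G \<longleftrightarrow> sq_integrable lborel f \<and> sq_integrable lborel G \<and>
     ((\<lambda>R. nrm2 lborel (\<lambda>\<xi>. ft (truncation R f) \<xi> - G \<xi>)) \<longlongrightarrow> 0) at_top"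

lemma plancherel_truncation_diff:
  fixes f :: "'a::euclidean_space \<Rightarrow> complex"
  assumes f: "sq_integrable lborel f"
  shows "sq_integrable lborel (ft (truncation R f))"
    "nrm2 lborel (ft (truncation R f)) = (2 * pi) ^ DIM('a) * nrm2 lborel (truncation R f)"
    "nrm2 lborel (\<lambda>\<xi>. ft (truncation R f) \<xi> - ft (truncation R' f) \<xi>) \<le>
       2 * (2 * pi) ^ DIM('a) * (nrm2 lborel (\<lambda>x. f x - truncation R f x) + nrm2 lborel (\<lambda>x. f x - truncation R' f x))"
proof -
  note t = truncation_props[OF f]
  show "sq_integrable lborel (ft (truncation R f))"
    "nrm2 lborel (ft (truncation R f)) = (2 * pi) ^ DIM('a) * nrm2 lborel (truncation R f)"
    using plancherel_L1_L2[OF t(2,1)] by (auto simp: plancherel_def)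
  have "nrm2 lborel (\<lambda>\<xi>. ft (truncation R f) \<xi> - ft (truncation R' f) \<xi>) =
      nrm2 lborel (ft (\<lambda>x. truncation R f x - truncation R' f x))"
    using ft_diff[OF t(2) t(2)] by (simp add: nrm2_def)
  also have "\<dots> = (2 * pi) ^ DIM('a) * nrm2 lborel (\<lambda>x. truncation R f x - truncation R' f x)"
    using plancherel_L1_L2[of "\<lambda>x. truncation R f x - truncation R' f x"] t
    by (auto simp: plancherel_def intro!: sq_integrable_diff)
  also have "nrm2 lborel (\<lambda>x. truncation R f x - truncation R' f x) =
      nrm2 lborel (\<lambda>x. (truncation R f x - f x) + (f x - truncation R' f x))" by simp
  also have "\<dots> \<le> 2 * nrm2 lborel (\<lambda>x. truncation R f x - f x) + 2 * nrm2 lborel (\<lambda>x. f x - truncation R' f x)"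
    by (intro nrm2_add_le sq_integrable_diff t f)
  also have "nrm2 lborel (\<lambda>x. truncation R f x - f x) = nrm2 lborel (\<lambda>x. f x - truncation R f x)"
    by (rule nrm2_minus_commute)
  finally show "nrm2 lborel (\<lambda>\<xi>. ft (truncation R f) \<xi> - ft (truncation R' f) \<xi>) \<le>
       2 * (2 * pi) ^ DIM('a) * (nrm2 lborel (\<lambda>x. f x - truncation R f x) + nrm2 lborel (\<lambda>x. f x - truncation R' f x))"
    by (simp add: mult_left_mono algebra_simps)
qed

text \<open>Along radii for which the tails decay like \<open>8\<^sup>-\<^sup>k\<close> the transforms of the truncations converge almost
  everywhere, because the increments, weighted with \<open>4\<^sup>k\<close>, are still square-summable: their squared norms decay like
  \<open>(4 / 8)\<^sup>k\<close>, and a bound \<open>C\<close> for the weighted sum bounds the \<open>k\<close>-th increment by \<open>C\<^sup>1\<^sup>/\<^sup>2 2\<^sup>-\<^sup>k\<close>.\<close>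

lemma is_ft_exists:
  fixes f :: "'a::euclidean_space \<Rightarrow> complex"
  assumes f: "sq_integrable lborel f"
  shows "\<exists>G. is_ft f G"
proof -
  let ?N = "(2 * pi) ^ DIM('a)"
  define a where "a R = nrm2 lborel (\<lambda>x. f x - truncation R f x)" for R
  have a_lim: "(a \<longlongrightarrow> 0) at_top" unfolding a_def[abs_def] by (rule truncation_tendsto[OF f])
  note pl = plancherel_truncation_diff[OF f, folded a_def]
  have "\<exists>R. a R < (1 / 8) ^ k" for k :: nat
    using eventually_happens[OF order_tendstoD(2)[OF a_lim, of "(1 / 8) ^ k"]] by auto
  then obtain r where r: "\<And>k. a (r k) < (1 / 8) ^ k" by metis
  have a0: "0 \<le> a R" for R by (simp add: a_def)
  define H where "H k = ft (truncation (r k) f)" for k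
  have Hsq: "sq_integrable lborel (H k)" for k unfolding H_def by (rule pl)
  have Hm [measurable]: "H k \<in> borel_measurable borel" for k using Hsq[of k] by (simp add: sq_integrable_def)
  have inc: "nrm2 lborel (\<lambda>\<xi>. H (Suc k) \<xi> - H k \<xi>) \<le> 4 * ?N * (1 / 8) ^ k" for k
  proof -
    have "nrm2 lborel (\<lambda>\<xi>. H (Suc k) \<xi> - H k \<xi>) \<le> 2 * ?N * (a (r (Suc k)) + a (r k))"
      unfolding H_def by (rule pl(3))
    also have "\<dots> \<le> 2 * ?N * ((1 / 8) ^ k + (1 / 8) ^ k)"
    proof (intro mult_left_mono add_mono)
      have "a (r (Suc k)) \<le> (1 / 8) ^ Suc k" using r[of "Suc k"] by simp
      also have "\<dots> \<le> (1 / 8) ^ k" by (rule power_decreasing) auto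
      finally show "a (r (Suc k)) \<le> (1 / 8) ^ k" .
    qed (use r[of k] in auto)
    finally show ?thesis by simp
  qed
  have "(\<integral>\<^sup>+\<xi>. (\<Sum>k. ennreal (4 ^ k * (cmod (H (Suc k) \<xi> - H k \<xi>))\<^sup>2)) \<partial>lborel) =
      (\<Sum>k. \<integral>\<^sup>+\<xi>. ennreal (4 ^ k * (cmod (H (Suc k) \<xi> - H k \<xi>))\<^sup>2) \<partial>lborel)"
    by (rule nn_integral_suminf) measurable
  also have "\<dots> \<le> (\<Sum>k. ennreal (4 * ?N * (1 / 2) ^ k))"
  proof (rule suminf_le)
    fix k
    have "(\<integral>\<^sup>+\<xi>. ennreal (4 ^ k * (cmod (H (Suc k) \<xi> - H k \<xi>))\<^sup>2) \<partial>lborel) =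
        ennreal (4 ^ k) * (\<integral>\<^sup>+\<xi>. ennreal ((cmod (H (Suc k) \<xi> - H k \<xi>))\<^sup>2) \<partial>lborel)"
      by (subst nn_integral_cmult[symmetric]) (auto simp: ennreal_mult)
    also have "\<dots> = ennreal (4 ^ k * nrm2 lborel (\<lambda>\<xi>. H (Suc k) \<xi> - H k \<xi>))"
      by (subst nn_integral_nrm2) (auto intro: sq_integrable_diff Hsq simp: ennreal_mult)
    also have "\<dots> \<le> ennreal (4 ^ k * (4 * ?N * (1 / 8) ^ k))"
      by (intro ennreal_leI mult_left_mono inc) auto
    also have "4 ^ k * (4 * ?N * (1 / 8) ^ k) = 4 * ?N * (1 / 2) ^ k"
    proof -
      have "(4::real) ^ k * (1 / 8) ^ k = (1 / 2) ^ k" unfolding power_mult_distrib[symmetric] by simp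
      moreover have "a * (4 * N * b) = 4 * N * (a * b)" for a b N :: real by simp
      ultimately show ?thesis by metis
    qed
    finally show "(\<integral>\<^sup>+\<xi>. ennreal (4 ^ k * (cmod (H (Suc k) \<xi> - H k \<xi>))\<^sup>2) \<partial>lborel) \<le> ennreal (4 * ?N * (1 / 2) ^ k)" .
  qed auto
  also have "\<dots> < \<infinity>"
  proof -
    have "summable (\<lambda>k. 4 * ?N * (1 / 2) ^ k :: real)" by (intro summable_mult summable_geometric) auto
    then show ?thesis by (subst suminf_ennreal2) auto
  qed
  finally have fin: "(\<integral>\<^sup>+\<xi>. (\<Sum>k. ennreal (4 ^ k * (cmod (H (Suc k) \<xi> - H k \<xi>))\<^sup>2)) \<partial>lborel) < \<infinity>" .
  have le_suminf: "h k \<le> (\<Sum>k. h k)" for h :: "nat \<Rightarrow> ennreal" and k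
    using sum_le_suminf[of h "{k}"] by (simp add: summableI)
  have "AE \<xi> in lborel. (\<Sum>k. ennreal (4 ^ k * (cmod (H (Suc k) \<xi> - H k \<xi>))\<^sup>2)) \<noteq> \<infinity>"
  proof (rule nn_integral_PInf_AE)
    show "(\<lambda>\<xi>. \<Sum>k. ennreal (4 ^ k * (cmod (H (Suc k) \<xi> - H k \<xi>))\<^sup>2)) \<in> borel_measurable lborel"
      by measurable
  qed (rule less_imp_neq[OF fin])
  then have conv: "AE \<xi> in lborel. convergent (\<lambda>k. H k \<xi>)"
  proof eventually_elim
    case (elim \<xi>)
    let ?d = "\<lambda>k. H (Suc k) \<xi> - H k \<xi>"
    define C where "C = enn2real (\<Sum>k. ennreal (4 ^ k * (cmod (?d k))\<^sup>2))"
    have C: "C \<ge> 0" "(\<Sum>k. ennreal (4 ^ k * (cmod (?d k))\<^sup>2)) = ennreal C"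
      unfolding C_def using elim by (simp_all only: enn2real_nonneg ennreal_enn2real_if infinity_ennreal_def if_False)
    have le: "cmod (?d k) \<le> sqrt C * (1 / 2) ^ k" for k
    proof -
      have "ennreal (4 ^ k * (cmod (?d k))\<^sup>2) \<le> ennreal C"
        unfolding C(2)[symmetric] by (rule le_suminf)
      then have "4 ^ k * (cmod (?d k))\<^sup>2 \<le> C" using C(1) by simp
      moreover have "((2::real) ^ k)\<^sup>2 = 4 ^ k"
        unfolding power2_eq_square power_mult_distrib[symmetric] by simp
      ultimately have "(2 ^ k * cmod (?d k))\<^sup>2 \<le> C" by (simp only: power_mult_distrib)
      then have "2 ^ k * cmod (?d k) \<le> sqrt C" by (rule real_le_rsqrt)
      then show ?thesis by (simp add: field_simps power_divide)
    qed
    have "summable (\<lambda>k. sqrt C * (1 / 2) ^ k)" by (intro summable_mult summable_geometric) auto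
    then have "summable ?d" by (rule summable_comparison_test') (use le in auto)
    then have "convergent (\<lambda>n. \<Sum>k<n. ?d k)" by (simp add: summable_iff_convergent)
    then have "convergent (\<lambda>n. H n \<xi> - H 0 \<xi>)" unfolding sum_lessThan_telescope[of "\<lambda>k. H k \<xi>"] .
    then show ?case using convergent_add_const_right_iff[of "\<lambda>n. H n \<xi> - H 0 \<xi>" "H 0 \<xi>"] by simp
  qed
  define G where "G \<xi> = lim (\<lambda>k. H k \<xi>)" for \<xi>
  have Gm [measurable]: "G \<in> borel_measurable borel"
    unfolding G_def[abs_def] by (rule borel_measurable_lim_metric) measurable
  have lim: "AE \<xi> in lborel. (\<lambda>k. H k \<xi>) \<longlonglongrightarrow> G \<xi>"
    using conv by eventually_elim (simp add: G_def convergent_LIMSEQ_iff)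
  have ar: "(\<lambda>k. a (r k)) \<longlonglongrightarrow> 0"
    by (rule tendsto_sandwich[OF _ _ tendsto_const LIMSEQ_power_zero[of "1 / 8"]])
      (use r a0 in \<open>auto intro!: always_eventually less_imp_le\<close>)
  have key: "sq_integrable lborel (\<lambda>\<xi>. ft (truncation R f) \<xi> - G \<xi>) \<and>
      nrm2 lborel (\<lambda>\<xi>. ft (truncation R f) \<xi> - G \<xi>) \<le> 2 * ?N * (a R + 0)" for R
  proof (rule nrm2_Fatou)
    show "sq_integrable lborel (\<lambda>\<xi>. ft (truncation R f) \<xi> - H k \<xi>)" for k
      by (intro sq_integrable_diff pl Hsq)
    show "nrm2 lborel (\<lambda>\<xi>. ft (truncation R f) \<xi> - H k \<xi>) \<le> 2 * ?N * (a R + a (r k))" for k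
      unfolding H_def by (rule pl(3))
    show "(\<lambda>k. 2 * ?N * (a R + a (r k))) \<longlonglongrightarrow> 2 * ?N * (a R + 0)"
      by (intro tendsto_intros ar)
    show "AE \<xi> in lborel. (\<lambda>k. ft (truncation R f) \<xi> - H k \<xi>) \<longlonglongrightarrow> ft (truncation R f) \<xi> - G \<xi>"
      using lim by eventually_elim (intro tendsto_intros)
    have [measurable]: "truncation R f \<in> borel_measurable borel" by (rule truncation_props[OF f])
    show "(\<lambda>\<xi>. ft (truncation R f) \<xi> - G \<xi>) \<in> borel_measurable lborel" by measurable
  qed
  have Gsq: "sq_integrable lborel G"
    using sq_integrable_diff[OF pl(1)[of 0] conjunct1[OF key[of 0]]] by simp
  have "((\<lambda>R. nrm2 lborel (\<lambda>\<xi>. ft (truncation R f) \<xi> - G \<xi>)) \<longlongrightarrow> 0) at_top"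
  proof (rule tendsto_sandwich[OF _ _ tendsto_const])
    show "((\<lambda>R. 2 * ?N * (a R + 0)) \<longlongrightarrow> 0) at_top"
      using tendsto_mult_left[OF a_lim, of "2 * ?N"] by simp
  qed (use key in \<open>auto intro!: always_eventually\<close>)
  then show ?thesis using f Gsq unfolding is_ft_def by blast
qed

lemma is_ft_nrm2:
  fixes f :: "'a::euclidean_space \<Rightarrow> complex"
  assumes "is_ft f G"
  shows "nrm2 lborel G = (2 * pi) ^ DIM('a) * nrm2 lborel f"
proof -
  have f: "sq_integrable lborel f" "sq_integrable lborel G"
    and lim: "((\<lambda>R. nrm2 lborel (\<lambda>\<xi>. ft (truncation R f) \<xi> - G \<xi>)) \<longlongrightarrow> 0) at_top"
    using assms by (auto simp: is_ft_def)
  note pl = plancherel_truncation_diff[OF f(1)]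
  have "((\<lambda>R. nrm2 lborel (ft (truncation R f))) \<longlongrightarrow> nrm2 lborel G) at_top"
    by (rule tendsto_nrm2[OF pl(1) f(2) lim])
  moreover have "((\<lambda>R. nrm2 lborel (\<lambda>x. truncation R f x - f x)) \<longlongrightarrow> 0) at_top"
    using truncation_tendsto[OF f(1)] by (subst nrm2_minus_commute)
  then have "((\<lambda>R. nrm2 lborel (ft (truncation R f))) \<longlongrightarrow> (2 * pi) ^ DIM('a) * nrm2 lborel f) at_top"
    unfolding pl(2) by (intro tendsto_mult_left tendsto_nrm2 truncation_props f)
  ultimately show ?thesis using tendsto_unique trivial_limit_at_top_linorder by blast
qed

subsection \<open>The inverse transform of test functions\<close>

definition ift :: "('a::euclidean_space \<Rightarrow> complex) \<Rightarrow> 'a \<Rightarrow> complex" where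
  "ift g x = complex_of_real (inverse ((2 * pi) ^ DIM('a))) * (LINT \<xi>|lborel. g \<xi> * cis (x \<bullet> \<xi>))"

lemma ift_eq_cnj_ft:
  fixes g :: "'a::euclidean_space \<Rightarrow> complex"
  shows "ift g x = complex_of_real (inverse ((2 * pi) ^ DIM('a))) * cnj (ft (\<lambda>\<xi>. cnj (g \<xi>)) x)"
  unfolding ift_def ft_def Bochner_Integration.integral_cnj[symmetric]
  by (simp add: cis_cnj inner_commute)

lemma
  fixes g :: "'a::euclidean_space \<Rightarrow> complex"
  assumes g: "test_function g"
  shows ift_sq_integrable: "sq_integrable lborel (ift g)"
    and ift_nrm2: "nrm2 lborel (ift g) = inverse ((2 * pi) ^ DIM('a)) * nrm2 lborel g"
proof -
  let ?N = "(2 * pi) ^ DIM('a)"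
  have pl: "sq_integrable lborel (ft (\<lambda>\<xi>. cnj (g \<xi>)))"
    "nrm2 lborel (ft (\<lambda>\<xi>. cnj (g \<xi>))) = ?N * nrm2 lborel (\<lambda>\<xi>. cnj (g \<xi>))"
    using plancherel_test_function[OF test_function_cnj[OF g]] by (auto simp: plancherel_def)
  show "sq_integrable lborel (ift g)"
    unfolding ift_eq_cnj_ft[abs_def] by (intro sq_integrable_cmult sq_integrable_cnj pl)
  have cnj: "nrm2 lborel (\<lambda>x. cnj (h x)) = nrm2 lborel h" for h :: "'a \<Rightarrow> complex" by (simp add: nrm2_def)
  show "nrm2 lborel (ift g) = inverse ((2 * pi) ^ DIM('a)) * nrm2 lborel g"
  proof -
    have scale: "(cmod (complex_of_real (inverse N)))\<^sup>2 * (N * x) = inverse N * x" if "N > 0" for N x :: real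
      using that by (simp add: power2_eq_square norm_inverse)
    show ?thesis unfolding ift_eq_cnj_ft[abs_def] nrm2_cmult cnj pl(2) by (rule scale) simp
  qed
qed

text \<open>For the truncations of \<open>f\<close> this is the multiplication formula. Both sides are continuous in \<open>f\<close>.\<close>

lemma ip_ift:
  fixes g :: "'a::euclidean_space \<Rightarrow> complex"
  assumes g: "test_function g" and f: "is_ft f G"
  shows "ip lborel (ift g) f = complex_of_real (inverse ((2 * pi) ^ DIM('a))) * ip lborel g G"
proof -
  let ?c = "complex_of_real (inverse ((2 * pi) ^ DIM('a)))"
  have sq: "sq_integrable lborel f" "sq_integrable lborel G"
    and lim: "((\<lambda>R. nrm2 lborel (\<lambda>\<xi>. ft (truncation R f) \<xi> - G \<xi>)) \<longlongrightarrow> 0) at_top"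
    using f by (auto simp: is_ft_def)
  note g' = test_function_integrable[OF g] and t = truncation_props[OF sq(1)]
  have gc: "integrable lborel (\<lambda>\<xi>. cnj (g \<xi>))" using g'(1) by simp
  have trunc: "ip lborel (ift g) (truncation R f) = ?c * ip lborel g (ft (truncation R f))" for R
  proof -
    have "ip lborel (ift g) (truncation R f) = (LINT x|lborel. ?c * cnj (ft (\<lambda>\<xi>. cnj (g \<xi>)) x * truncation R f x))"
      unfolding ip_def ift_eq_cnj_ft by (simp add: mult.assoc)
    also have "\<dots> = ?c * cnj (LINT x|lborel. ft (\<lambda>\<xi>. cnj (g \<xi>)) x * truncation R f x)"
      unfolding integral_mult_right_zero Bochner_Integration.integral_cnj ..
    also have "(LINT x|lborel. ft (\<lambda>\<xi>. cnj (g \<xi>)) x * truncation R f x) = (LINT \<xi>|lborel. cnj (g \<xi>) * ft (truncation R f) \<xi>)"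
      by (rule ft_multiplication[OF gc t(2)])
    also have "cnj \<dots> = ip lborel g (ft (truncation R f))"
      unfolding ip_def Bochner_Integration.integral_cnj[symmetric] by simp
    finally show ?thesis .
  qed
  have "((\<lambda>R. nrm2 lborel (\<lambda>x. truncation R f x - f x)) \<longlongrightarrow> 0) at_top"
    using truncation_tendsto[OF sq(1)] by (subst nrm2_minus_commute)
  then have "((\<lambda>R. ip lborel (ift g) (truncation R f)) \<longlongrightarrow> ip lborel (ift g) f) at_top"
    by (intro tendsto_ip_right t sq ift_sq_integrable[OF g])
  moreover have "((\<lambda>R. ip lborel (ift g) (truncation R f)) \<longlongrightarrow> ?c * ip lborel g G) at_top"
    unfolding trunc by (intro tendsto_mult_left tendsto_ip_right[OF _ _ _ lim] plancherel_truncation_diff(1) sq g')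
  ultimately show ?thesis using tendsto_unique trivial_limit_at_top_linorder by blast
qed

text \<open>Take for \<open>g\<close> a cutoff of a transform \<open>G\<close> of \<open>f\<close>. By \<open>ip_ift\<close> and Plancherel's theorem the norms and the inner
  product of \<open>ift g\<close> and \<open>f\<close> are those of \<open>g\<close> and \<open>G\<close>, up to a constant factor, and so is the distance.\<close>

lemma ift_dense:
  fixes f :: "'a::euclidean_space \<Rightarrow> complex"
  assumes f: "sq_integrable lborel f" and e: "e > 0"
  obtains g where "test_function g" "nrm2 lborel (\<lambda>x. f x - ift g x) < e"
proof -
  let ?c = "inverse ((2 * pi) ^ DIM('a)) :: real"
  obtain G where G: "is_ft f G" using is_ft_exists[OF f] by blast
  have Gsq: "sq_integrable lborel G" using G by (simp add: is_ft_def)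
  then have [measurable]: "G \<in> borel_measurable borel" by (simp add: sq_integrable_def)
  define g where "g n = cutoff n G" for n
  have t: "test_function (g n)" for n unfolding g_def by (rule test_function_cutoff) simp
  have "(\<lambda>n. nrm2 lborel (\<lambda>x. g n x - G x)) \<longlonglongrightarrow> 0"
  proof (rule nrm2_dominated_convergence[where w="\<lambda>x. cmod (G x)"])
    show "AE x in lborel. (\<lambda>n. g n x) \<longlonglongrightarrow> G x" unfolding g_def by (intro AE_I2 cutoff_tendsto)
    show "g n \<in> borel_measurable lborel" for n using test_function_integrable(3)[OF t] by simp
  qed (use Gsq in \<open>auto simp: sq_integrable_def g_def cmod_cutoff_le\<close>)
  then have "\<forall>\<^sub>F n in sequentially. nrm2 lborel (\<lambda>x. g n x - G x) < e / ?c"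
    by (rule order_tendstoD) (use e in auto)
  then obtain n where n: "nrm2 lborel (\<lambda>x. g n x - G x) < e / ?c"
    using eventually_happens' sequentially_bot by blast
  have "nrm2 lborel (\<lambda>x. ift (g n) x - f x) = ?c * nrm2 lborel (\<lambda>x. g n x - G x)"
  proof -
    have c: "?c * (2 * pi) ^ DIM('a) = 1" by (rule left_inverse) simp
    have "nrm2 lborel f = ?c * nrm2 lborel G"
      unfolding is_ft_nrm2[OF G] mult.assoc[symmetric] c by simp
    moreover have "Re (complex_of_real c * z) = c * Re z" for c z by simp
    ultimately show ?thesis
      unfolding nrm2_diff[OF ift_sq_integrable[OF t] f] nrm2_diff[OF test_function_integrable(2)[OF t] Gsq]
        ift_nrm2[OF t] ip_ift[OF t G] by (simp only: algebra_simps)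
  qed
  also have "\<dots> < e" using n by (simp add: field_simps)
  finally show ?thesis using that[OF t[of n]] nrm2_minus_commute[of lborel f] by simp
qed

lemma ift_modulation: "ift (\<lambda>\<xi>. cis (k \<bullet> \<xi>) * g \<xi>) x = ift g (x + k)"
  unfolding ift_def by (simp add: inner_add_left cis_mult[symmetric] ac_simps)

lemma ift_matrix:
  fixes B :: "real^'n^'n"
  assumes B: "det B \<noteq> 0" and g: "g \<in> borel_measurable borel"
  shows "ift (\<lambda>\<xi>. g (transpose B *v \<xi>)) x = complex_of_real (inverse \<bar>det B\<bar>) * ift g (matrix_inv B *v x)"
proof -
  have d: "det (transpose B) \<noteq> 0" using B by (simp add: det_transpose)
  note g[measurable]
  have eq: "(matrix_inv B *v x) \<bullet> (transpose B *v \<xi>) = x \<bullet> \<xi>" for \<xi>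
  proof -
    have "(matrix_inv B *v x) \<bullet> (transpose B *v \<xi>) = (\<xi> v* B) \<bullet> (matrix_inv B *v x)"
      unfolding transpose_matrix_vector by (rule inner_commute)
    also have "\<dots> = \<xi> \<bullet> (B *v (matrix_inv B *v x))" by (rule dot_lmul_matrix)
    also have "\<dots> = x \<bullet> \<xi>" unfolding matrix_inv_vec(1)[OF B] by (rule inner_commute)
    finally show ?thesis .
  qed
  have "(LINT \<xi>|lborel. g \<xi> * cis ((matrix_inv B *v x) \<bullet> \<xi>)) =
     \<bar>det (transpose B)\<bar> *\<^sub>R (LINT \<xi>|lborel. g (transpose B *v \<xi>) * cis ((matrix_inv B *v x) \<bullet> (transpose B *v \<xi>)))"
    by (rule integral_lborel_matrix[OF d]) measurable
  then have cov: "(LINT \<xi>|lborel. g \<xi> * cis ((matrix_inv B *v x) \<bullet> \<xi>)) =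
     \<bar>det B\<bar> *\<^sub>R (LINT \<xi>|lborel. g (transpose B *v \<xi>) * cis (x \<bullet> \<xi>))"
    unfolding eq det_transpose .
  have solve: "b = complex_of_real (inverse r) * a" if "a = r *\<^sub>R b" "r \<noteq> 0" for a b r
    using that by (simp add: scaleR_conv_of_real)
  have "(LINT \<xi>|lborel. g (transpose B *v \<xi>) * cis (x \<bullet> \<xi>)) =
      complex_of_real (inverse \<bar>det B\<bar>) * (LINT \<xi>|lborel. g \<xi> * cis ((matrix_inv B *v x) \<bullet> \<xi>))"
    by (rule solve[OF cov]) (use B in simp)
  then show ?thesis unfolding ift_def by simp
qed

section \<open>Sums as integrals over counting measures\<close>

text \<open>Unordered sums are integrals over counting measures; in this form Fubini's theorem exchanges them with
  Lebesgue integrals.\<close>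

lemma norm_summable_on_iff_integrable:
  fixes f :: "'i \<Rightarrow> 'b::{banach, second_countable_topology}"
  shows "(\<lambda>i. norm (f i)) summable_on I \<longleftrightarrow> integrable (count_space I) f"
  by (simp only: abs_summable_equivalent abs_summable_on_def)

lemma infsum_eq_integral_count_space_integrable:
  fixes f :: "'i \<Rightarrow> 'b::{banach, second_countable_topology}"
  assumes "integrable (count_space I) f"
  shows "infsum f I = integral\<^sup>L (count_space I) f"
  using infsetsum_infsum[OF abs_summable_on_def[THEN iffD2, OF assms]] by (simp only: infsetsum_def)

lemma infsum_eq_integral_count_space:
  fixes f :: "'i \<Rightarrow> complex"
  shows "infsum f I = integral\<^sup>L (count_space I) f"
proof (cases "integrable (count_space I) f")
  case True
  then show ?thesis by (rule infsum_eq_integral_count_space_integrable)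
next
  case False
  then have "\<not> f summable_on I"
    using summable_on_iff_abs_summable_on_complex[of f I] norm_summable_on_iff_integrable[of f I] by blast
  then show ?thesis using False by (simp add: infsum_not_exists not_integrable_integral_eq)
qed

lemma has_sum_iff_nn_integral_count_space:
  fixes f :: "'i \<Rightarrow> real"
  assumes f: "\<And>i. i \<in> I \<Longrightarrow> 0 \<le> f i" and S: "0 \<le> S"
  shows "(f has_sum S) I \<longleftrightarrow> (\<integral>\<^sup>+i. ennreal (f i) \<partial>count_space I) = ennreal S"
proof
  assume hs: "(f has_sum S) I"
  then have "f summable_on I" by (auto simp: summable_on_def)
  then have "(\<lambda>i. norm (f i)) summable_on I"
    using f by (subst summable_on_cong[where g=f]) auto
  then have int: "integrable (count_space I) f" by (simp only: norm_summable_on_iff_integrable)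
  have "integral\<^sup>L (count_space I) f = S"
    using infsum_eq_integral_count_space_integrable[OF int] infsumI[OF hs] by simp
  then show "(\<integral>\<^sup>+i. ennreal (f i) \<partial>count_space I) = ennreal S"
    using nn_integral_eq_integral[OF int] f by (auto simp: AE_count_space)
next
  assume n: "(\<integral>\<^sup>+i. ennreal (f i) \<partial>count_space I) = ennreal S"
  have "has_bochner_integral (count_space I) f S"
    by (rule has_bochner_integral_nn_integral) (use n f S in \<open>auto simp: AE_count_space\<close>)
  then have i: "integrable (count_space I) f" and "integral\<^sup>L (count_space I) f = S"
    by (auto simp: has_bochner_integral_iff)
  then have "infsum f I = S" using infsum_eq_integral_count_space_integrable[OF i] by simp
  moreover have "f summable_on I"
    using i unfolding norm_summable_on_iff_integrable[symmetric] by (rule abs_summable_summable)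
  ultimately show "(f has_sum S) I" using has_sum_infsum by blast
qed

lemma summable_on_iff_nn_integral_count_space:
  fixes f :: "'i \<Rightarrow> real"
  assumes f: "\<And>i. i \<in> I \<Longrightarrow> 0 \<le> f i"
  shows "f summable_on I \<longleftrightarrow> (\<integral>\<^sup>+i. ennreal (f i) \<partial>count_space I) < \<infinity>"
proof
  assume "f summable_on I"
  then have "(f has_sum infsum f I) I" by simp
  then show "(\<integral>\<^sup>+i. ennreal (f i) \<partial>count_space I) < \<infinity>"
    by (subst (asm) has_sum_iff_nn_integral_count_space) (auto simp: f infsum_nonneg)
next
  assume *: "(\<integral>\<^sup>+i. ennreal (f i) \<partial>count_space I) < \<infinity>"
  define S where "S = enn2real (\<integral>\<^sup>+i. ennreal (f i) \<partial>count_space I)"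
  have "(f has_sum S) I"
    by (subst has_sum_iff_nn_integral_count_space) (use * f in \<open>auto simp: S_def\<close>)
  then show "f summable_on I" by (auto simp: summable_on_def)
qed

lemma infsum_eq_nn_integral_count_space:
  fixes f :: "'i \<Rightarrow> real"
  assumes f: "\<And>i. i \<in> I \<Longrightarrow> 0 \<le> f i" and s: "f summable_on I"
  shows "(\<integral>\<^sup>+i. ennreal (f i) \<partial>count_space I) = ennreal (infsum f I)"
proof -
  have "0 \<le> infsum f I" using f by (rule infsum_nonneg)
  moreover have "(f has_sum infsum f I) I" using s by simp
  ultimately show ?thesis using has_sum_iff_nn_integral_count_space[of I f] f by blast
qed

lemma has_sum_integral:
  fixes f :: "'i \<Rightarrow> 'a \<Rightarrow> complex"
  assumes I: "countable I" and M: "sigma_finite_measure M"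
    and f: "\<And>i. i \<in> I \<Longrightarrow> integrable M (f i)"
    and s: "(\<lambda>i. LINT x|M. cmod (f i x)) summable_on I"
  shows "((\<lambda>i. LINT x|M. f i x) has_sum (LINT x|M. (\<Sum>\<^sub>\<infinity>i\<in>I. f i x))) I"
    and "integrable M (\<lambda>x. \<Sum>\<^sub>\<infinity>i\<in>I. f i x)"
proof -
  interpret I: sigma_finite_measure "count_space I" using I by (rule sigma_finite_measure_count_space_countable)
  interpret M: sigma_finite_measure M by fact
  interpret P: pair_sigma_finite "count_space I" M ..
  have norm: "integrable (count_space I) (\<lambda>i. LINT x|M. cmod (f i x))"
  proof -
    have "(\<lambda>i. norm (LINT x|M. cmod (f i x))) summable_on I" using s by simp
    then show ?thesis by (simp only: norm_summable_on_iff_integrable)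
  qed
  have int: "integrable (count_space I \<Otimes>\<^sub>M M) (\<lambda>(i, x). f i x)"
  proof (rule P.Fubini_integrable)
    show "(\<lambda>(i, x). f i x) \<in> borel_measurable (count_space I \<Otimes>\<^sub>M M)"
      by (rule measurable_pair_measure_countable1[OF I]) (use f in auto)
    show "integrable (count_space I) (\<lambda>i. LINT x|M. norm (case (i, x) of (i, x) \<Rightarrow> f i x))"
      using norm by simp
    show "AE i in count_space I. integrable M (\<lambda>x. case (i, x) of (i, x) \<Rightarrow> f i x)"
      using f by (simp add: AE_count_space)
  qed
  show "integrable M (\<lambda>x. \<Sum>\<^sub>\<infinity>i\<in>I. f i x)"
    unfolding infsum_eq_integral_count_space by (rule P.integrable_snd[OF int])
  have "integrable (count_space I) (\<lambda>i. LINT x|M. f i x)" by (rule P.integrable_fst[OF int])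
  then have "(\<lambda>i. LINT x|M. f i x) summable_on I"
    unfolding norm_summable_on_iff_integrable[symmetric] by (rule abs_summable_summable)
  moreover have "infsum (\<lambda>i. LINT x|M. f i x) I = (LINT x|M. (\<Sum>\<^sub>\<infinity>i\<in>I. f i x))"
    unfolding infsum_eq_integral_count_space by (rule P.Fubini_integral[OF int, symmetric])
  ultimately show "((\<lambda>i. LINT x|M. f i x) has_sum (LINT x|M. (\<Sum>\<^sub>\<infinity>i\<in>I. f i x))) I"
    using has_sum_infsum by metis
qed

section \<open>The integer lattice and Fourier series\<close>

lemma int_lattice_closed:
  "0 \<in> int_lattice" "x \<in> int_lattice \<Longrightarrow> y \<in> int_lattice \<Longrightarrow> x + y \<in> int_lattice"
  "x \<in> int_lattice \<Longrightarrow> y \<in> int_lattice \<Longrightarrow> x - y \<in> int_lattice"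
  "x \<in> int_lattice \<Longrightarrow> - x \<in> int_lattice"
  by (auto simp: int_lattice_def)

lemma int_lattice_inner: "x \<in> int_lattice \<Longrightarrow> y \<in> int_lattice \<Longrightarrow> x \<bullet> y \<in> \<int>"
  by (auto simp: int_lattice_def inner_vec_def intro!: Ints_sum Ints_mult)

lemma finite_int_lattice_ball: "finite {k \<in> int_lattice. norm (k :: real^'n) \<le> r}"
proof -
  let ?Z = "{z :: real. z \<in> \<int> \<and> \<bar>z\<bar> \<le> r}"
  have "?Z \<subseteq> real_of_int ` {- \<lceil>r\<rceil>..\<lceil>r\<rceil>}"
  proof
    fix z assume "z \<in> ?Z"
    then obtain m where "z = real_of_int m" "\<bar>real_of_int m\<bar> \<le> r" by (auto elim: Ints_cases)
    then show "z \<in> real_of_int ` {- \<lceil>r\<rceil>..\<lceil>r\<rceil>}" by (intro image_eqI[of _ _ m]) (auto, linarith+)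
  qed
  then have fin: "finite ?Z" by (rule finite_subset) simp
  have "{k \<in> int_lattice. norm (k :: real^'n) \<le> r} \<subseteq> {k. \<forall>i. k $ i \<in> ?Z}"
    using component_le_norm_cart order.trans by (fastforce simp: int_lattice_def)
  moreover have "{k :: real^'n. \<forall>i. k $ i \<in> ?Z} \<subseteq> vec_lambda ` (UNIV \<rightarrow>\<^sub>E ?Z)"
  proof
    fix k :: "real^'n" assume "k \<in> {k. \<forall>i. k $ i \<in> ?Z}"
    then have "($) k \<in> UNIV \<rightarrow>\<^sub>E ?Z" by auto
    then show "k \<in> vec_lambda ` (UNIV \<rightarrow>\<^sub>E ?Z)" by (rule image_eqI[rotated]) simp
  qed
  then have "finite {k :: real^'n. \<forall>i. k $ i \<in> ?Z}"
    by (rule finite_subset) (intro finite_imageI finite_PiE fin, simp)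
  ultimately show ?thesis by (rule finite_subset)
qed

lemma countable_int_lattice: "countable (int_lattice :: (real^'n) set)"
proof -
  have "(int_lattice :: (real^'n) set) = (\<Union>m. {k \<in> int_lattice. norm k \<le> real m})"
    using real_arch_simple by auto
  moreover have "countable (\<Union>m. {k \<in> int_lattice. norm (k :: real^'n) \<le> real m})"
    by (intro countable_UN countableI_type countable_finite finite_int_lattice_ball)
  ultimately show ?thesis by simp
qed

lemma norm_int_lattice_ge_1: "k \<in> int_lattice \<Longrightarrow> k \<noteq> 0 \<Longrightarrow> 1 \<le> norm (k :: real^'n)"
proof -
  assume k: "k \<in> int_lattice" "k \<noteq> 0"
  then obtain i where i: "k $ i \<noteq> 0" by (auto simp: vec_eq_iff)
  have "k $ i \<in> \<int>" using k by (simp add: int_lattice_def)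
  then have "1 \<le> \<bar>k $ i\<bar>" using i by (rule Ints_nonzero_abs_ge1)
  also have "\<dots> \<le> norm k" by (rule component_le_norm_cart)
  finally show ?thesis .
qed

text \<open>Half-open, so that the translates by lattice points are disjoint.\<close>

definition cube :: "real \<Rightarrow> (real^'n) set" where
  "cube a = {x. \<forall>i. - a / 2 \<le> x $ i \<and> x $ i < a / 2}"

lemma cube_measurable [measurable]: "cube a \<in> sets borel"
proof -
  have "cube a = (\<Inter>i. {x. - a / 2 \<le> x $ i} \<inter> {x. x $ i < a / 2})" by (auto simp: cube_def)
  also have "\<dots> \<in> sets borel"
    by (intro sets.finite_INT sets.Int borel_closed borel_open closed_Collect_le open_Collect_less continuous_intros) auto
  finally show ?thesis .
qed

lemma cube_bounded: "x \<in> cube a \<Longrightarrow> norm (x :: real^'n) \<le> real CARD('n) * \<bar>a\<bar>"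
proof -
  assume x: "x \<in> cube a"
  have "norm x \<le> (\<Sum>i\<in>UNIV. \<bar>x $ i\<bar>)" by (rule norm_le_l1_cart)
  also have "\<dots> \<le> (\<Sum>i\<in>(UNIV :: 'n set). \<bar>a\<bar>)"
  proof (rule sum_mono)
    fix i
    have "- a / 2 \<le> x $ i" "x $ i < a / 2" using x by (auto simp: cube_def)
    then show "\<bar>x $ i\<bar> \<le> \<bar>a\<bar>" by arith
  qed
  finally show ?thesis by simp
qed

lemma cube_cell:
  fixes x :: "real^'n"
  assumes a: "a > 0"
  shows "\<exists>k\<in>int_lattice. \<forall>l\<in>int_lattice. x - a *\<^sub>R l \<in> cube a \<longleftrightarrow> l = k"
proof -
  define k :: "real^'n" where "k = (\<chi> i. of_int \<lfloor>x $ i / a + 1 / 2\<rfloor>)"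
  have "x - a *\<^sub>R l \<in> cube a \<longleftrightarrow> l = k" if l: "l \<in> int_lattice" for l
  proof -
    have "(- a / 2 \<le> (x - a *\<^sub>R l) $ i \<and> (x - a *\<^sub>R l) $ i < a / 2) \<longleftrightarrow> l $ i = k $ i" for i
    proof -
      obtain m where m: "l $ i = of_int m" using l by (auto simp: int_lattice_def elim: Ints_cases)
      have "(- a / 2 \<le> x $ i - a * of_int m \<and> x $ i - a * of_int m < a / 2) \<longleftrightarrow>
          of_int m \<le> x $ i / a + 1 / 2 \<and> x $ i / a + 1 / 2 < of_int m + 1"
        using a by (auto simp: field_simps)
      also have "\<dots> \<longleftrightarrow> \<lfloor>x $ i / a + 1 / 2\<rfloor> = m" by (simp add: floor_eq_iff)
      finally show ?thesis using m by (auto simp: k_def)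
    qed
    then show ?thesis by (simp add: cube_def vec_eq_iff)
  qed
  moreover have "k \<in> int_lattice" by (simp add: k_def int_lattice_def)
  ultimately show ?thesis by blast
qed

text \<open>The translates of the cube by \<open>a\<close> times the lattice tile the space.\<close>

lemma nn_integral_cells:
  fixes f :: "real^'n \<Rightarrow> ennreal"
  assumes a: "a > 0" and [measurable]: "f \<in> borel_measurable borel"
  shows "(\<integral>\<^sup>+x. f x \<partial>lborel) = (\<integral>\<^sup>+k. (\<integral>\<^sup>+x. indicator (cube a) x * f (x + a *\<^sub>R k) \<partial>lborel) \<partial>count_space int_lattice)"
proof -
  have eq: "f x = (\<integral>\<^sup>+k. indicator (cube a) (x - a *\<^sub>R k) * f x \<partial>count_space int_lattice)" for x
  proof -
    obtain k where k: "k \<in> int_lattice" "\<And>l. l \<in> int_lattice \<Longrightarrow> x - a *\<^sub>R l \<in> cube a \<longleftrightarrow> l = k"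
      using cube_cell[OF a, of x] by blast
    have "(\<integral>\<^sup>+l. indicator (cube a) (x - a *\<^sub>R l) * f x \<partial>count_space int_lattice) =
        (\<integral>\<^sup>+l. f x * indicator {k} l \<partial>count_space int_lattice)"
      by (rule nn_integral_cong) (use k in \<open>auto simp: indicator_def\<close>)
    also have "\<dots> = f x" using k by (subst nn_integral_cmult_indicator) auto
    finally show ?thesis by simp
  qed
  have "(\<integral>\<^sup>+x. f x \<partial>lborel) = (\<integral>\<^sup>+x. \<integral>\<^sup>+k. indicator (cube a) (x - a *\<^sub>R k) * f x \<partial>count_space int_lattice \<partial>lborel)"
    by (subst eq) simp
  also have "\<dots> = (\<integral>\<^sup>+k. \<integral>\<^sup>+x. indicator (cube a) (x - a *\<^sub>R k) * f x \<partial>lborel \<partial>count_space int_lattice)"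
    by (rule nn_integral_count_space_nn_integral[OF countable_int_lattice]) measurable
  also have "\<dots> = (\<integral>\<^sup>+k. (\<integral>\<^sup>+x. indicator (cube a) x * f (x + a *\<^sub>R k) \<partial>lborel) \<partial>count_space int_lattice)"
  proof (rule nn_integral_cong)
    fix k :: "real^'n"
    have "(\<lambda>x. indicator (cube a) (x - a *\<^sub>R k) * f x) \<in> borel_measurable borel" by measurable
    from nn_integral_lborel_translate[OF this, of "a *\<^sub>R k"]
    show "(\<integral>\<^sup>+x. indicator (cube a) (x - a *\<^sub>R k) * f x \<partial>lborel) =
      (\<integral>\<^sup>+x. indicator (cube a) x * f (x + a *\<^sub>R k) \<partial>lborel)" by simp
  qed
  finally show ?thesis .
qed

text \<open>The tiling for complex integrands. All but finitely many tiles miss the support, so a finite sum remains.\<close>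

lemma integral_cells:
  fixes f :: "real^'n \<Rightarrow> complex"
  assumes a: "a > 0" and f: "integrable lborel f"
    and S: "finite S" "S \<subseteq> int_lattice" "\<And>x s. x \<in> cube a \<Longrightarrow> s \<in> int_lattice - S \<Longrightarrow> f (x + a *\<^sub>R s) = 0"
  shows "(LINT x|lborel. f x) = (\<Sum>s\<in>S. LINT x|lborel. indicator (cube a) x * f (x + a *\<^sub>R s))"
    and "s \<in> S \<Longrightarrow> integrable lborel (\<lambda>x. indicator (cube a) x * f (x + a *\<^sub>R s))"
proof -
  have [measurable]: "f \<in> borel_measurable borel" using f by auto
  have ind: "integrable lborel (\<lambda>x. indicator B x * h x)" if "integrable lborel h" "B \<in> sets borel" for h :: "real^'n \<Rightarrow> complex" and B
  proof (rule Bochner_Integration.integrable_bound[OF that(1)])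
    show "(\<lambda>x. indicator B x * h x) \<in> borel_measurable lborel" using that by measurable
  qed (auto simp: indicator_def)
  show "integrable lborel (\<lambda>x. indicator (cube a) x * f (x + a *\<^sub>R s))"
    by (rule ind) (auto intro: integrable_lborel_translate f)
  have eq: "f x = (\<Sum>s\<in>S. indicator (cube a) (x - a *\<^sub>R s) * f x)" for x
  proof -
    obtain k where k: "k \<in> int_lattice" "\<And>l. l \<in> int_lattice \<Longrightarrow> x - a *\<^sub>R l \<in> cube a \<longleftrightarrow> l = k"
      using cube_cell[OF a, of x] by blast
    have "(\<Sum>s\<in>S. indicator (cube a) (x - a *\<^sub>R s) * f x) = (\<Sum>s\<in>S. if s = k then f x else 0)"
      by (rule sum.cong) (use k S(2) in \<open>auto simp: indicator_def\<close>)
    also have "\<dots> = (if k \<in> S then f x else 0)" using S(1) by simp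
    also have "\<dots> = f x" using S(3)[of "x - a *\<^sub>R k" k] k by auto
    finally show ?thesis by simp
  qed
  have cm: "(\<lambda>x. x - a *\<^sub>R s) -` cube a \<in> sets borel" for s :: "real^'n"
    using measurable_sets[of "\<lambda>x. x - a *\<^sub>R s" borel borel "cube a"] by simp
  have int: "integrable lborel (\<lambda>x. indicator (cube a) (x - a *\<^sub>R s) * f x)" for s
    using ind[OF f cm[of s]] by (simp add: indicator_def)
  have "(LINT x|lborel. f x) = (\<Sum>s\<in>S. LINT x|lborel. indicator (cube a) (x - a *\<^sub>R s) * f x)"
    by (subst eq) (rule Bochner_Integration.integral_sum[OF int])
  also have "\<dots> = (\<Sum>s\<in>S. LINT x|lborel. indicator (cube a) x * f (x + a *\<^sub>R s))"
  proof (rule sum.cong)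
    fix s :: "real^'n"
    have "(\<lambda>x. indicator (cube a) (x - a *\<^sub>R s) * f x) \<in> borel_measurable borel" using int[of s] by auto
    from integral_lborel_translate[OF this, of "a *\<^sub>R s"]
    show "(LINT x|lborel. indicator (cube a) (x - a *\<^sub>R s) * f x) = (LINT x|lborel. indicator (cube a) x * f (x + a *\<^sub>R s))"
      by simp
  qed simp
  finally show "(LINT x|lborel. f x) = (\<Sum>s\<in>S. LINT x|lborel. indicator (cube a) x * f (x + a *\<^sub>R s))" .
qed

subsection \<open>Orthogonality of the exponentials\<close>

lemma integral_cis_period:
  assumes m: "m \<in> \<int>"
  shows "integrable lborel (\<lambda>t. indicator {- pi..<pi} t * cis (- (t * m)))"
    and "(LINT t|lborel. indicator {- pi..<pi} t * cis (- (t * m))) = (if m = 0 then 2 * complex_of_real pi else 0)"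
proof -
  have ae: "AE t in lborel. (indicator {- pi..<pi} t * cis (- (t * m)) :: complex) = indicator {- pi..pi} t *\<^sub>R cis (- (t * m))"
    using AE_lborel_singleton[of pi] by eventually_elim (auto simp: indicator_def)
  define F :: "real \<Rightarrow> complex" where "F t = (if m = 0 then of_real t else cis (- (t * m)) / (- \<i> * of_real m))" for t
  have D: "(F has_vector_derivative cis (- (t * m))) (at t within {- pi..pi})" for t
  proof (cases "m = 0")
    case True
    then show ?thesis unfolding F_def by (auto intro!: derivative_eq_intros)
  next
    case False
    have "((\<lambda>t. exp (- \<i> * of_real m * of_real t) / (- \<i> * of_real m)) has_vector_derivative exp (- \<i> * of_real m * of_real t)) (at t within {- pi..pi})"
      using False by (auto intro!: derivative_eq_intros has_vector_derivative_real_field)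
    then show ?thesis using False unfolding F_def by (simp add: cis_conv_exp mult.commute mult.left_commute)
  qed
  have C: "continuous_on {- pi..pi} (\<lambda>t. cis (- (t * m)))" by (intro continuous_intros)
  have b: "has_bochner_integral lborel (\<lambda>t. indicator {- pi..pi} t *\<^sub>R cis (- (t * m))) (F pi - F (- pi))"
    by (rule has_bochner_integral_FTC_Icc) (use D C in auto)
  have "has_bochner_integral lborel (\<lambda>t. indicator {- pi..<pi} t * cis (- (t * m))) (F pi - F (- pi))"
    using b ae by (subst has_bochner_integral_cong_AE) auto
  moreover have "F pi - F (- pi) = (if m = 0 then 2 * complex_of_real pi else 0)"
  proof (cases "m = 0")
    case False
    have "cis (- (pi * m)) = cis (pi * m) * cis (2 * pi * (- m))" by (simp add: cis_mult algebra_simps)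
    also have "cis (2 * pi * (- m)) = 1" by (rule cis_multiple_2pi) (use m in simp)
    finally show ?thesis using False by (simp add: F_def)
  qed (simp add: F_def)
  ultimately show "integrable lborel (\<lambda>t. indicator {- pi..<pi} t * cis (- (t * m)))"
    and "(LINT t|lborel. indicator {- pi..<pi} t * cis (- (t * m))) = (if m = 0 then 2 * complex_of_real pi else 0)"
    by (auto simp: has_bochner_integral_iff)
qed

lemma ft_cube_int_lattice:
  fixes k :: "real^'n"
  assumes k: "k \<in> int_lattice"
  shows "ft (indicator (cube (2 * pi))) k = (if k = 0 then complex_of_real ((2 * pi) ^ CARD('n)) else 0)"
proof -
  let ?f = "\<lambda>(b :: real^'n) t. indicator {- pi..<pi} t * cis (- (t * (k \<bullet> b)))"
  have kb: "k \<bullet> b \<in> \<int>" if "b \<in> Basis" for b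
    using that k by (auto simp: Basis_vec_def inner_axis int_lattice_def)
  have "indicator (cube (2 * pi)) x * cis (- (x \<bullet> k)) = (\<Prod>b\<in>Basis. ?f b (x \<bullet> b))" for x :: "real^'n"
  proof -
    have "- (x \<bullet> k) = (\<Sum>b\<in>Basis. - ((x \<bullet> b) * (k \<bullet> b)))"
      by (subst euclidean_inner) (simp add: sum_negf)
    then have c: "cis (- (x \<bullet> k)) = (\<Prod>b\<in>Basis. cis (- ((x \<bullet> b) * (k \<bullet> b))))" by (simp only: cis_sum)
    have "x \<in> cube (2 * pi) \<longleftrightarrow> (\<forall>b\<in>Basis. x \<bullet> b \<in> {- pi..<pi})"
      by (auto simp: cube_def Basis_vec_def inner_axis)
    then have "(indicator (cube (2 * pi)) x :: complex) = (\<Prod>b\<in>Basis. indicator {- pi..<pi} (x \<bullet> b))"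
      by (auto simp: indicator_def)
    then show ?thesis using c by (simp add: prod.distrib)
  qed
  then have "ft (indicator (cube (2 * pi))) k = (\<Prod>b\<in>Basis. (LINT t|lborel. ?f b t))"
    unfolding ft_def by (simp only:) (rule integral_lborel_prod, rule integral_cis_period[OF kb])
  also have "\<dots> = (\<Prod>b\<in>(Basis :: (real^'n) set). if k \<bullet> b = 0 then 2 * complex_of_real pi else 0)"
    by (rule prod.cong) (auto simp: integral_cis_period(2)[OF kb])
  also have "\<dots> = (if k = 0 then complex_of_real ((2 * pi) ^ CARD('n)) else 0)"
  proof (cases "k = 0")
    case False
    then obtain b where "b \<in> Basis" "k \<bullet> b \<noteq> 0" by (metis euclidean_all_zero_iff)
    then show ?thesis using False by (auto simp: prod_zero_iff)
  qed simp
  finally show ?thesis .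
qed

subsection \<open>Parseval's identity on the cube\<close>

lemma ip_cmult_left: "ip M (\<lambda>x. b * f x) g = b * ip M f g"
  unfolding ip_def by (simp add: mult.assoc)

lemma ip_cmult_right: "ip M f (\<lambda>x. b * g x) = cnj b * ip M f g"
  unfolding ip_def by (simp add: mult.left_commute)

text \<open>Each subtraction of a projection onto some \<open>e k\<close> lowers the squared norm of \<open>G\<close> by the corresponding term of the
  sum, divided by \<open>c\<close>, and the squared norm of the rest is nonnegative.\<close>

lemma Bessel_orthogonal:
  fixes e :: "'i \<Rightarrow> 'a \<Rightarrow> complex"
  assumes G: "sq_integrable M G" and e: "\<And>i. i \<in> I \<Longrightarrow> sq_integrable M (e i)" and c: "c > 0"
    and n: "\<And>i. i \<in> I \<Longrightarrow> nrm2 M (e i) = c" and o: "\<And>i j. i \<in> I \<Longrightarrow> j \<in> I \<Longrightarrow> i \<noteq> j \<Longrightarrow> ip M (e i) (e j) = 0"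
    and K: "finite K" "K \<subseteq> I"
  shows "(\<Sum>i\<in>K. (cmod (ip M G (e i)))\<^sup>2) \<le> c * nrm2 M G"
proof -
  have "\<exists>G'. sq_integrable M G' \<and> nrm2 M G' = nrm2 M G - (\<Sum>i\<in>K. (cmod (ip M G (e i)))\<^sup>2) / c \<and>
      (\<forall>l\<in>I - K. ip M G' (e l) = ip M G (e l))"
    using K
  proof (induct K rule: finite_induct)
    case empty
    then show ?case using G by (intro exI[of _ G]) auto
  next
    case (insert k K)
    then obtain G' where G': "sq_integrable M G'" "nrm2 M G' = nrm2 M G - (\<Sum>i\<in>K. (cmod (ip M G (e i)))\<^sup>2) / c"
      "\<And>l. l \<in> I - K \<Longrightarrow> ip M G' (e l) = ip M G (e l)" by auto
    have k: "k \<in> I" "k \<notin> K" using insert by auto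
    define a where "a = ip M G (e k)"
    let ?b = "a / complex_of_real c"
    have ek: "sq_integrable M (\<lambda>x. ?b * e k x)" by (rule sq_integrable_cmult[OF e[OF k(1)]])
    have "nrm2 M (\<lambda>x. G' x - ?b * e k x) = nrm2 M G' + (cmod ?b)\<^sup>2 * c - 2 * Re (cnj ?b * a)"
      unfolding nrm2_diff[OF G'(1) ek] nrm2_cmult ip_cmult_right n[OF k(1)] using G'(3)[of k] k by (simp add: a_def)
    also have "(cmod ?b)\<^sup>2 * c = (cmod a)\<^sup>2 / c"
      using c by (simp add: norm_divide power_divide power2_eq_square)
    also have "Re (cnj ?b * a) = (cmod a)\<^sup>2 / c"
      by (simp add: cmod_power2) (simp add: power2_eq_square)
    finally have 1: "nrm2 M (\<lambda>x. G' x - ?b * e k x) = nrm2 M G - (\<Sum>i\<in>insert k K. (cmod (ip M G (e i)))\<^sup>2) / c"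
      using insert k by (simp add: G'(2) a_def add_divide_distrib)
    have 2: "ip M (\<lambda>x. G' x - ?b * e k x) (e l) = ip M G (e l)" if "l \<in> I - insert k K" for l
    proof -
      have l: "l \<in> I" "l \<in> I - K" "k \<noteq> l" using that by auto
      show ?thesis
        unfolding ip_diff_left[OF G'(1) ek e[OF l(1)]] ip_cmult_left o[OF k(1) l(1,3)] G'(3)[OF l(2)] by simp
    qed
    show ?case
      by (intro exI[of _ "\<lambda>x. G' x - ?b * e k x"] conjI sq_integrable_diff G' ek 1 ballI 2)
  qed
  then obtain G' where "nrm2 M G' = nrm2 M G - (\<Sum>i\<in>K. (cmod (ip M G (e i)))\<^sup>2) / c" by blast
  then have "0 \<le> nrm2 M G - (\<Sum>i\<in>K. (cmod (ip M G (e i)))\<^sup>2) / c" by (metis nrm2_nonneg)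
  then show ?thesis using c by (simp add: field_simps)
qed

lemma summable_on_bounded_sums:
  fixes f :: "'i \<Rightarrow> real"
  assumes f: "\<And>i. i \<in> I \<Longrightarrow> 0 \<le> f i" and b: "\<And>K. finite K \<Longrightarrow> K \<subseteq> I \<Longrightarrow> sum f K \<le> B"
  shows "f summable_on I" "infsum f I \<le> B" "(\<integral>\<^sup>+i. ennreal (f i) \<partial>count_space I) \<le> ennreal B"
proof -
  show s: "f summable_on I"
    by (rule nonneg_bdd_above_summable_on) (use f b in \<open>auto simp: bdd_above_def\<close>)
  then show le: "infsum f I \<le> B" using b by (intro infsum_le_finite_sums) auto
  show "(\<integral>\<^sup>+i. ennreal (f i) \<partial>count_space I) \<le> ennreal B"
    using infsum_eq_nn_integral_count_space[of I f] f s le by (simp add: ennreal_leI)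
qed

lemma ft_shift: "ft G (t + k) = ft (\<lambda>x. cis (- (x \<bullet> t)) * G x) k"
  unfolding ft_def by (simp only: inner_add_right minus_add_distrib cis_mult[symmetric] ac_simps)

lemma sq_integrable_imp_integrable_bounded_support:
  fixes G :: "real^'n \<Rightarrow> complex"
  assumes G: "sq_integrable lborel G" and R: "\<And>x. norm x > R \<Longrightarrow> G x = 0"
  shows "integrable lborel G"
proof -
  have [measurable]: "G \<in> borel_measurable borel" using G by (simp add: sq_integrable_def)
  have "G = truncation (R + 1) G"
    using R by (auto simp: truncation_def indicator_def fun_eq_iff)
  then show ?thesis using truncation_props(2)[OF G, of "R + 1"] by simp
qed

lemma Bessel_cube:
  fixes G :: "real^'n \<Rightarrow> complex"
  assumes G: "sq_integrable lborel G" and supp: "\<And>x. x \<notin> cube (2 * pi) \<Longrightarrow> G x = 0"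
    and K: "finite K" "K \<subseteq> int_lattice"
  shows "(\<Sum>k\<in>K. (cmod (ft G k))\<^sup>2) \<le> (2 * pi) ^ CARD('n) * nrm2 lborel G"
proof -
  define e where "e k x = indicator (cube (2 * pi)) x * cis (x \<bullet> k)" for k x :: "real^'n"
  have ip_G: "ip lborel G (e k) = ft G k" for k
    unfolding ip_def ft_def
    by (intro Bochner_Integration.integral_cong) (use supp in \<open>auto simp: e_def indicator_def cis_cnj\<close>)
  have ip_e: "ip lborel (e k) (e l) = ft (indicator (cube (2 * pi))) (l - k)" for k l
    unfolding ip_def ft_def
    by (intro Bochner_Integration.integral_cong)
      (auto simp: e_def indicator_def cis_cnj cis_mult inner_diff_right)
  have sq: "sq_integrable lborel (e k)" for k
  proof (rule test_function_integrable)
    show "test_function (e k)"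
    proof (rule test_functionI[of _ 1 "real CARD('n) * \<bar>2 * pi\<bar>"])
      show "e k \<in> borel_measurable borel" unfolding e_def[abs_def] by measurable
      show "cmod (e k x) \<le> 1" for x by (simp add: e_def indicator_def norm_mult)
      show "e k x = 0" if "real CARD('n) * \<bar>2 * pi\<bar> < norm x" for x
        using cube_bounded[of x "2 * pi"] that by (auto simp: e_def indicator_def)
    qed
  qed
  have "complex_of_real (nrm2 lborel (e k)) = complex_of_real ((2 * pi) ^ CARD('n))" for k
    unfolding ip_self[symmetric] ip_e using ft_cube_int_lattice[of "0 :: real^'n"] int_lattice_closed(1) by simp
  then have n: "nrm2 lborel (e k) = (2 * pi) ^ CARD('n)" for k by (simp only: of_real_eq_iff)
  have "(\<Sum>k\<in>K. (cmod (ip lborel G (e k)))\<^sup>2) \<le> (2 * pi) ^ CARD('n) * nrm2 lborel G"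
  proof (rule Bessel_orthogonal[where I=int_lattice])
    show "ip lborel (e i) (e j) = 0" if "i \<in> int_lattice" "j \<in> int_lattice" "i \<noteq> j" for i j
      unfolding ip_e using ft_cube_int_lattice[OF int_lattice_closed(3)[OF that(2,1)]] that by simp
  qed (use G sq n K in auto)
  then show ?thesis unfolding ip_G .
qed

lemma emeasure_cube: "(\<integral>\<^sup>+x. indicator (cube 1) (x :: real^'n) \<partial>lborel) = 1"
proof -
  have "x \<in> cube 1 \<longleftrightarrow> (\<forall>b\<in>Basis. x \<bullet> b \<in> {- 1 / 2..<1 / 2})" for x :: "real^'n"
    by (auto simp: cube_def Basis_vec_def inner_axis)
  then have "(indicator (cube 1) x :: ennreal) = (\<Prod>b\<in>Basis. indicator {- 1 / 2..<1 / 2} (x \<bullet> b))" for x :: "real^'n"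
    by (auto simp: indicator_def)
  then have "(\<integral>\<^sup>+x. indicator (cube 1) (x :: real^'n) \<partial>lborel) =
      (\<Prod>b\<in>(Basis :: (real^'n) set). (\<integral>\<^sup>+x. indicator {- 1 / 2..<1 / 2 :: real} x \<partial>lborel))"
    by (simp only:) (rule nn_integral_lborel_prod, auto)
  then show ?thesis by simp
qed

text \<open>Parseval's identity follows from Plancherel's theorem and Bessel's inequality. By Plancherel the sums
  \<open>S(t)\<close> of the squared Fourier coefficients of \<open>G\<close> shifted by \<open>t\<close> have the mean value that Bessel's
  inequality gives as an upper bound for each of them. So this bound is attained for almost every \<open>t\<close>, and then
  for \<open>t = 0\<close> because \<open>S(t)\<^sup>1\<^sup>/\<^sup>2\<close> is continuous, once more by Bessel's inequality.\<close>

lemma Parseval_cube: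
  fixes G :: "real^'n \<Rightarrow> complex"
  assumes G: "sq_integrable lborel G" and supp: "\<And>x. x \<notin> cube (2 * pi) \<Longrightarrow> G x = 0"
  shows "((\<lambda>k. (cmod (ft G k))\<^sup>2) has_sum (2 * pi) ^ CARD('n) * nrm2 lborel G) int_lattice"
proof -
  let ?N = "(2 * pi) ^ CARD('n)"
  define B where "B = ?N * nrm2 lborel G"
  have [measurable]: "G \<in> borel_measurable borel" using G by (simp add: sq_integrable_def)
  have Gi: "integrable lborel G"
  proof (rule sq_integrable_imp_integrable_bounded_support[OF G])
    show "G x = 0" if "norm x > real CARD('n) * \<bar>2 * pi\<bar>" for x
      using supp[of x] cube_bounded[of x "2 * pi"] that by fastforce
  qed
  define Gt where "Gt t x = cis (- (x \<bullet> t)) * G x" for t x :: "real^'n"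
  have Gt_sq: "sq_integrable lborel (Gt t)" for t
    by (rule sq_integrable_bound[OF G, of _ 1]) (auto simp: Gt_def[abs_def] norm_mult)
  have Gt_nrm: "nrm2 lborel (Gt t) = nrm2 lborel G" for t
    by (simp add: nrm2_def Gt_def norm_mult)
  have ft_Gt: "ft G (t + k) = ft (Gt t) k" for t k
    unfolding Gt_def[abs_def] by (rule ft_shift)
  have Gt_int: "integrable lborel (Gt t)" for t
    by (rule Bochner_Integration.integrable_bound[OF Gi]) (auto simp: Gt_def[abs_def] norm_mult)
  define S where "S t = (\<integral>\<^sup>+k. ennreal ((cmod (ft G (t + k)))\<^sup>2) \<partial>count_space int_lattice)" for t
  have bess: "(\<Sum>k\<in>K. (cmod (ft G (t + k)))\<^sup>2) \<le> B" if "finite K" "K \<subseteq> int_lattice" for K t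
    unfolding ft_Gt B_def Gt_nrm[of t, symmetric]
    by (rule Bessel_cube[OF Gt_sq _ that]) (simp add: Gt_def supp)
  have S_le: "S t \<le> ennreal B" for t
    unfolding S_def by (rule summable_on_bounded_sums(3)) (use bess in auto)
  interpret L: sigma_finite_measure "count_space int_lattice :: (real^'n) measure"
    by (rule sigma_finite_measure_count_space_countable[OF countable_int_lattice])
  have S_meas [measurable]: "S \<in> borel_measurable borel"
    unfolding S_def[abs_def]
  proof (rule L.borel_measurable_nn_integral)
    have "(\<lambda>(k, t). ennreal ((cmod (ft G (t + k)))\<^sup>2)) \<in> borel_measurable (count_space int_lattice \<Otimes>\<^sub>M borel)"
      by (rule measurable_pair_measure_countable1[OF countable_int_lattice]) simp
    then show "(\<lambda>(t, k). ennreal ((cmod (ft G (t + k)))\<^sup>2)) \<in> borel_measurable (borel \<Otimes>\<^sub>M count_space int_lattice)"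
      by (subst measurable_pair_swap_iff) (simp add: case_prod_unfold)
  qed
  \<comment> \<open>The unit cubes around the lattice points tile the space, so the mean of \<open>S\<close> is the squared norm of \<open>ft G\<close>.\<close>
  have total: "(\<integral>\<^sup>+t. indicator (cube 1) t * S t \<partial>lborel) = ennreal B"
  proof -
    have "plancherel G" by (rule plancherel_L1_L2[OF Gi G])
    then have "ennreal B = (\<integral>\<^sup>+t. ennreal ((cmod (ft G t))\<^sup>2) \<partial>lborel)"
      by (subst nn_integral_nrm2) (auto simp: plancherel_def B_def)
    also have "\<dots> = (\<integral>\<^sup>+k. (\<integral>\<^sup>+t. indicator (cube 1) t * ennreal ((cmod (ft G (t + 1 *\<^sub>R k)))\<^sup>2) \<partial>lborel) \<partial>count_space int_lattice)"
      by (rule nn_integral_cells) auto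
    also have "\<dots> = (\<integral>\<^sup>+t. (\<integral>\<^sup>+k. indicator (cube 1) t * ennreal ((cmod (ft G (t + 1 *\<^sub>R k)))\<^sup>2) \<partial>count_space int_lattice) \<partial>lborel)"
      by (rule nn_integral_count_space_nn_integral[OF countable_int_lattice, symmetric]) measurable
    also have "\<dots> = (\<integral>\<^sup>+t. indicator (cube 1) t * S t \<partial>lborel)"
      unfolding S_def by (intro nn_integral_cong) (simp add: nn_integral_cmult)
    finally show ?thesis by simp
  qed
  have "(\<integral>\<^sup>+t. (indicator (cube 1) t * ennreal B - indicator (cube 1) t * S t) \<partial>lborel) =
      (\<integral>\<^sup>+t. indicator (cube 1) (t :: real^'n) * ennreal B \<partial>lborel) - (\<integral>\<^sup>+t. indicator (cube 1) t * S t \<partial>lborel)"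
    by (rule nn_integral_diff) (use total S_le in \<open>auto intro!: mult_left_mono\<close>)
  also have "(\<integral>\<^sup>+t. indicator (cube 1) (t :: real^'n) * ennreal B \<partial>lborel) = ennreal B"
    by (subst nn_integral_multc) (auto simp: emeasure_cube simp del: nn_integral_indicator)
  also have "ennreal B - (\<integral>\<^sup>+t. indicator (cube 1) t * S t \<partial>lborel) = 0"
    unfolding total by (rule diff_eq_0_ennreal) auto
  finally have "AE t in lborel. indicator (cube 1) t * ennreal B - indicator (cube 1) t * S t = 0"
    by (rule nn_integral_0_iff_AE[THEN iffD1, rotated]) measurable
  then have AE: "AE t in lborel. t \<in> cube 1 \<longrightarrow> ennreal B \<le> S t"
    by eventually_elim (auto simp: diff_eq_0_iff_ennreal)
  \<comment> \<open>Every ball around \<open>0\<close> contains a point where the bound is attained, as it is not a null set.\<close>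
  have ex: "\<exists>t. norm t < r \<and> ennreal B \<le> S t" if r: "r > 0" for r
  proof (rule ccontr)
    assume no: "\<nexists>t. norm t < r \<and> ennreal B \<le> S t"
    let ?b = "ball (0 :: real^'n) (min r (1 / 2))"
    have sub: "t \<in> cube 1" if "t \<in> ?b" for t
      unfolding cube_def
    proof (rule CollectI, rule allI)
      fix i have "\<bar>t $ i\<bar> < 1 / 2" using that component_le_norm_cart[of t i] by simp
      then show "- 1 / 2 \<le> t $ i \<and> t $ i < 1 / 2" by arith
    qed
    have "AE t in lborel. t \<notin> ?b"
      using AE by eventually_elim (use sub no in auto)
    then have "?b \<in> null_sets lborel" by (subst AE_iff_null_sets) auto
    then have "measure lborel ?b = 0" by (simp add: measure_def null_setsD1)
    then show False using content_ball_pos[of "min r (1 / 2)" "0 :: real^'n"] r by simp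
  qed
  have "\<exists>t. norm t < inverse (real (Suc n)) \<and> ennreal B \<le> S t" for n by (rule ex) simp
  then obtain t where t: "\<And>n. norm (t n) < inverse (real (Suc n))" "\<And>n. ennreal B \<le> S (t n)" by metis
  have t0: "t \<longlonglongrightarrow> 0"
    by (rule Lim_null_comparison[OF _ LIMSEQ_inverse_real_of_nat]) (use t(1) in \<open>auto intro!: always_eventually less_imp_le\<close>)
  \<comment> \<open>By Bessel's inequality \<open>d n\<close> bounds the change of the coefficients under the shift by \<open>t n\<close>.\<close>
  define d where "d n = nrm2 lborel (\<lambda>x. Gt (t n) x - G x)" for n
  have d0: "d \<longlonglongrightarrow> 0"
    unfolding d_def[abs_def]
  proof (rule nrm2_dominated_convergence[where w="\<lambda>x. cmod (G x)"])
    show "AE x in lborel. (\<lambda>n. Gt (t n) x) \<longlonglongrightarrow> G x"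
    proof (rule AE_I2)
      fix x
      have "(\<lambda>n. Gt (t n) x) \<longlonglongrightarrow> cis (- (x \<bullet> 0)) * G x"
        unfolding Gt_def by (intro tendsto_intros t0)
      then show "(\<lambda>n. Gt (t n) x) \<longlonglongrightarrow> G x" by simp
    qed
  qed (use G Gt_sq in \<open>auto simp: sq_integrable_def Gt_def norm_mult\<close>)
  have sum0: "(\<lambda>k. (cmod (ft G k))\<^sup>2) summable_on int_lattice" "infsum (\<lambda>k. (cmod (ft G k))\<^sup>2) int_lattice \<le> B"
  proof -
    have b0: "(\<Sum>k\<in>K. (cmod (ft G k))\<^sup>2) \<le> B" if "finite K" "K \<subseteq> int_lattice" for K
      using bess[OF that, of 0] by simp
    show "(\<lambda>k. (cmod (ft G k))\<^sup>2) summable_on int_lattice"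
      by (rule summable_on_bounded_sums(1)[OF _ b0]) auto
    show "infsum (\<lambda>k. (cmod (ft G k))\<^sup>2) int_lattice \<le> B"
      by (rule summable_on_bounded_sums(2)[OF _ b0]) auto
  qed
  define s0 where "s0 = infsum (\<lambda>k. (cmod (ft G k))\<^sup>2) int_lattice"
  have s0: "0 \<le> s0" unfolding s0_def by (rule infsum_nonneg) simp
  have B0: "0 \<le> B" by (simp add: B_def)
  have le: "B \<le> (sqrt s0 + sqrt (?N * d n))\<^sup>2" for n
  proof -
    have "(\<Sum>k\<in>K. (cmod (ft G (t n + k)))\<^sup>2) \<le> (sqrt s0 + sqrt (?N * d n))\<^sup>2" if K: "finite K" "K \<subseteq> int_lattice" for K
    proof -
      have diff: "ft G (t n + k) - ft G k = ft (\<lambda>x. Gt (t n) x - G x) k" for k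
        unfolding ft_Gt by (rule ft_diff[OF Gt_int Gi, symmetric])
      show ?thesis
      proof (rule sum_cmod2_perturbation)
        show "(\<Sum>k\<in>K. (cmod (ft G k))\<^sup>2) \<le> s0"
          unfolding s0_def by (intro finite_sum_le_infsum sum0 K) auto
        show "(\<Sum>k\<in>K. (cmod (ft G (t n + k) - ft G k))\<^sup>2) \<le> ?N * d n"
          unfolding diff d_def by (intro Bessel_cube K sq_integrable_diff Gt_sq G) (simp add: Gt_def supp)
      qed
    qed
    then have "S (t n) \<le> ennreal ((sqrt s0 + sqrt (?N * d n))\<^sup>2)"
      unfolding S_def by (intro summable_on_bounded_sums(3)) auto
    then have "ennreal B \<le> ennreal ((sqrt s0 + sqrt (?N * d n))\<^sup>2)" using t(2) order.trans by blast
    then show ?thesis by simp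
  qed
  have "(\<lambda>n. (sqrt s0 + sqrt (?N * d n))\<^sup>2) \<longlonglongrightarrow> (sqrt s0 + sqrt (?N * 0))\<^sup>2"
    by (intro tendsto_intros d0)
  then have "B \<le> (sqrt s0 + sqrt (?N * 0))\<^sup>2"
    by (rule LIMSEQ_le_const) (use le in auto)
  then have "B \<le> s0" using s0 by simp
  then have "s0 = B" using sum0(2) by (simp add: s0_def)
  then show ?thesis using has_sum_infsum[OF sum0(1)] by (simp add: s0_def B_def)
qed

subsection \<open>Periodization\<close>

text \<open>Parseval's identity is applied to the periodization \<open>P\<close>, which has the same coefficients as \<open>F\<close>. The product of
  two shifts of \<open>F\<close> in \<open>|P|\<^sup>2\<close> depends, after a translation, only on the difference \<open>r\<close> of the shifts. The sum over
  the other shift turns the integral over the cube into one over the whole space.\<close>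

lemma ft_periodization:
  fixes F :: "real^'n \<Rightarrow> complex"
  assumes F: "sq_integrable lborel F" and supp: "\<And>x. norm x > \<rho> \<Longrightarrow> F x = 0"
    and R: "finite R" "R \<subseteq> int_lattice"
      "\<And>r x. r \<in> int_lattice - R \<Longrightarrow> F x * cnj (F (x + (2 * pi) *\<^sub>R r)) = 0"
  shows "((\<lambda>k. (cmod (ft F k))\<^sup>2) has_sum
     (2 * pi) ^ CARD('n) * Re (\<Sum>r\<in>R. LINT x|lborel. F x * cnj (F (x + (2 * pi) *\<^sub>R r)))) int_lattice"
proof -
  let ?Q = "cube (2 * pi) :: (real^'n) set" and ?p = "2 * pi"
  have [measurable]: "F \<in> borel_measurable borel" using F by (simp add: sq_integrable_def)
  have Fi: "integrable lborel F" by (rule sq_integrable_imp_integrable_bounded_support[OF F supp])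
  \<comment> \<open>Outside \<open>S\<close> a shift moves the support away from the cube.\<close>
  define S :: "(real^'n) set" where "S = {s \<in> int_lattice. norm s \<le> \<bar>\<rho>\<bar> + real CARD('n) * \<bar>?p\<bar>}"
  have S: "finite S" "S \<subseteq> int_lattice" unfolding S_def by (auto intro: finite_int_lattice_ball)
  have S0: "F (x + ?p *\<^sub>R s) = 0" if x: "x \<in> ?Q" and s: "s \<in> int_lattice - S" for x s
  proof (rule supp)
    have "\<bar>\<rho>\<bar> + real CARD('n) * \<bar>?p\<bar> < norm s" using s by (auto simp: S_def)
    also have "norm s \<le> ?p * norm s" using pi_gt3 by (simp add: mult_le_cancel_right1)
    also have "\<dots> = norm (?p *\<^sub>R s)" by simp
    also have "\<dots> \<le> norm (x + ?p *\<^sub>R s) + norm x"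
      using norm_triangle_ineq4[of "x + ?p *\<^sub>R s" x] by simp
    also have "norm x \<le> real CARD('n) * \<bar>?p\<bar>" by (rule cube_bounded[OF x])
    finally show "norm (x + ?p *\<^sub>R s) > \<rho>" by linarith
  qed
  have p0: "?p > 0" by simp
  define P where "P x = indicator ?Q x * (\<Sum>s\<in>S. F (x + ?p *\<^sub>R s))" for x
  have sq_trans: "sq_integrable lborel (\<lambda>x. F (x + v))" for v
    using F integrable_lborel_translate[of "\<lambda>x. (cmod (F x))\<^sup>2" v] by (auto simp: sq_integrable_def)
  have "sq_integrable lborel (\<lambda>x. \<Sum>s\<in>S. F (x + ?p *\<^sub>R s))"
    using S(1)
  proof (induct S rule: finite_induct)
    case empty show ?case by (simp add: sq_integrable_def)
  next
    case (insert s S)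
    then show ?case using sq_integrable_add[OF sq_trans insert(3)] by simp
  qed
  then have Psq: "sq_integrable lborel P"
    unfolding P_def[abs_def] by (rule sq_integrable_indicator) simp
  have ftP: "ft P k = ft F k" if k: "k \<in> int_lattice" for k
  proof -
    let ?h = "\<lambda>x. F x * cis (- (x \<bullet> k))"
    have hi: "integrable lborel ?h" by (intro integrable_cis_mult Fi) simp
    have h0: "?h (x + ?p *\<^sub>R s) = 0" if "x \<in> ?Q" "s \<in> int_lattice - S" for x s
      using S0[OF that] by simp
    have per: "cis (- ((x + ?p *\<^sub>R s) \<bullet> k)) = cis (- (x \<bullet> k))" if "s \<in> S" for x s
    proof -
      have "- (s \<bullet> k) \<in> \<int>" using that k S(2) int_lattice_inner by (auto intro: Ints_minus)
      then have "cis (?p * (- (s \<bullet> k))) = 1" by (rule cis_multiple_2pi)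
      moreover have "- ((x + ?p *\<^sub>R s) \<bullet> k) = - (x \<bullet> k) + ?p * (- (s \<bullet> k))" by (simp add: inner_add_left)
      ultimately show ?thesis by (simp only: cis_mult[symmetric]) simp
    qed
    have "ft F k = (\<Sum>s\<in>S. LINT x|lborel. indicator ?Q x * ?h (x + ?p *\<^sub>R s))"
      unfolding ft_def by (rule integral_cells(1)[OF p0 hi S h0])
    also have "\<dots> = (LINT x|lborel. (\<Sum>s\<in>S. indicator ?Q x * ?h (x + ?p *\<^sub>R s)))"
      by (rule Bochner_Integration.integral_sum[symmetric]) (rule integral_cells(2)[OF p0 hi S h0])
    also have "\<dots> = ft P k"
      unfolding ft_def P_def
      by (intro Bochner_Integration.integral_cong) (auto simp: per sum_distrib_left sum_distrib_right mult.assoc intro!: sum.cong)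
    finally show ?thesis by simp
  qed
  have "((\<lambda>k. (cmod (ft P k))\<^sup>2) has_sum (2 * pi) ^ CARD('n) * nrm2 lborel P) int_lattice"
    by (rule Parseval_cube[OF Psq]) (simp add: P_def)
  then have hs: "((\<lambda>k. (cmod (ft F k))\<^sup>2) has_sum (2 * pi) ^ CARD('n) * nrm2 lborel P) int_lattice"
    by (subst (asm) has_sum_cong[where g="\<lambda>k. (cmod (ft F k))\<^sup>2"]) (auto simp: ftP)
  let ?H = "\<lambda>r x. F x * cnj (F (x + ?p *\<^sub>R r))"
  have Hi: "integrable lborel (?H r)" for r by (rule integrable_mult_cnj[OF F sq_trans])
  have H0: "?H r (x + ?p *\<^sub>R s) = 0" if "x \<in> ?Q" "s \<in> int_lattice - S" for x s r
    using S0[OF that] by simp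
  have "(\<Sum>r\<in>R. LINT x|lborel. ?H r x) = (\<Sum>r\<in>R. \<Sum>s\<in>S. LINT x|lborel. indicator ?Q x * ?H r (x + ?p *\<^sub>R s))"
    by (rule sum.cong[OF refl], rule integral_cells(1)[OF p0 Hi S H0])
  also have "\<dots> = (LINT x|lborel. (\<Sum>r\<in>R. \<Sum>s\<in>S. indicator ?Q x * ?H r (x + ?p *\<^sub>R s)))"
  proof -
    have ii: "integrable lborel (\<lambda>x. indicator ?Q x * ?H r (x + ?p *\<^sub>R s))" if "s \<in> S" for r s
      by (rule integral_cells(2)[OF p0 Hi S H0 that])
    then show ?thesis
      by (simp only: Bochner_Integration.integral_sum Bochner_Integration.integrable_sum)
  qed
  also have "\<dots> = ip lborel P P"
    unfolding ip_def
  proof (rule Bochner_Integration.integral_cong)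
    fix x :: "real^'n"
    show "(\<Sum>r\<in>R. \<Sum>s\<in>S. indicator ?Q x * ?H r (x + ?p *\<^sub>R s)) = P x * cnj (P x)"
    proof (cases "x \<in> ?Q")
      case False then show ?thesis by (simp add: P_def)
    next
      case True
      let ?f = "\<lambda>s. F (x + ?p *\<^sub>R s)"
      \<comment> \<open>For \<open>s'\<close> in \<open>s + R\<close> outside \<open>S\<close> the point leaves the support, and for \<open>s'\<close> in \<open>S\<close> outside \<open>s + R\<close>
        the product vanishes by the choice of \<open>R\<close>.\<close>
      have inner: "(\<Sum>r\<in>R. ?f s * cnj (?f (s + r))) = (\<Sum>s'\<in>S. ?f s * cnj (?f s'))" if s: "s \<in> S" for s
      proof -
        let ?T = "S \<inter> (\<lambda>r. s + r) ` R"
        have "(\<Sum>r\<in>R. ?f s * cnj (?f (s + r))) = (\<Sum>s'\<in>(\<lambda>r. s + r) ` R. ?f s * cnj (?f s'))"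
          by (subst sum.reindex) (auto simp: inj_on_def)
        also have "\<dots> = (\<Sum>s'\<in>?T. ?f s * cnj (?f s'))"
        proof (rule sum.mono_neutral_right)
          show "\<forall>s'\<in>(\<lambda>r. s + r) ` R - ?T. ?f s * cnj (?f s') = 0"
          proof
            fix s' assume "s' \<in> (\<lambda>r. s + r) ` R - ?T"
            then have "s' \<in> int_lattice - S" using s S(2) R(2) by (auto intro!: int_lattice_closed(2))
            then show "?f s * cnj (?f s') = 0" using S0[OF True] by simp
          qed
        qed (use R in auto)
        also have "\<dots> = (\<Sum>s'\<in>S. ?f s * cnj (?f s'))"
        proof (rule sum.mono_neutral_left)
          show "\<forall>s'\<in>S - ?T. ?f s * cnj (?f s') = 0"
          proof
            fix s' assume s': "s' \<in> S - ?T"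
            have "s' - s \<in> int_lattice" using s s' S(2) by (auto intro!: int_lattice_closed(3))
            moreover have "s' - s \<notin> R"
            proof
              assume "s' - s \<in> R"
              then have "s + (s' - s) \<in> (\<lambda>r. s + r) ` R" by (rule imageI)
              then show False using s' by simp
            qed
            ultimately have "F (x + ?p *\<^sub>R s) * cnj (F (x + ?p *\<^sub>R s + ?p *\<^sub>R (s' - s))) = 0" by (intro R(3)) simp
            then show "?f s * cnj (?f s') = 0" by (simp add: algebra_simps)
          qed
        qed (use S in auto)
        finally show ?thesis .
      qed
      have "(\<Sum>r\<in>R. \<Sum>s\<in>S. indicator ?Q x * ?H r (x + ?p *\<^sub>R s)) = (\<Sum>s\<in>S. \<Sum>r\<in>R. ?f s * cnj (?f (s + r)))"
        using True by (subst sum.swap) (simp add: scaleR_add_right add.assoc)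
      also have "\<dots> = (\<Sum>s\<in>S. \<Sum>s'\<in>S. ?f s * cnj (?f s'))" using inner by simp
      also have "\<dots> = P x * cnj (P x)" using True by (simp add: P_def sum_product cnj_sum)
      finally show ?thesis .
    qed
  qed simp
  finally have "(\<Sum>r\<in>R. LINT x|lborel. ?H r x) = complex_of_real (nrm2 lborel P)" by (simp only: ip_self)
  then show ?thesis using hs by simp
qed

section \<open>Frame identities extend from dense sets\<close>

lemma approximating_sequence:
  assumes dense: "\<And>e. e > 0 \<Longrightarrow> \<exists>u\<in>U. nrm2 M (\<lambda>x. f x - u x) < e"
  obtains u where "\<And>n. u n \<in> U" "(\<lambda>n::nat. nrm2 M (\<lambda>x. u n x - f x)) \<longlonglongrightarrow> 0"
proof -
  have "\<exists>u\<in>U. nrm2 M (\<lambda>x. f x - u x) < inverse (real (Suc n))" for n by (rule dense) simp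
  then obtain u where u: "\<And>n. u n \<in> U" "\<And>n. nrm2 M (\<lambda>x. f x - u n x) < inverse (real (Suc n))" by metis
  have "(\<lambda>n. nrm2 M (\<lambda>x. f x - u n x)) \<longlonglongrightarrow> 0"
    by (rule Lim_null_comparison[OF _ LIMSEQ_inverse_real_of_nat])
      (use u(2) in \<open>auto intro!: always_eventually less_imp_le\<close>)
  then show ?thesis using that[of u] u(1) by (simp add: nrm2_minus_commute[of M f])
qed

lemma Bessel_extension:
  fixes e :: "'i \<Rightarrow> 'a \<Rightarrow> complex"
  assumes dense: "\<And>e. e > 0 \<Longrightarrow> \<exists>u\<in>U. nrm2 M (\<lambda>x. f x - u x) < e"
    and f: "sq_integrable M f" and U: "\<And>u. u \<in> U \<Longrightarrow> sq_integrable M u"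
    and e: "\<And>i. i \<in> K \<Longrightarrow> sq_integrable M (e i)"
    and bessel: "\<And>u. u \<in> U \<Longrightarrow> (\<Sum>i\<in>K. (cmod (ip M u (e i)))\<^sup>2) \<le> nrm2 M u"
  shows "(\<Sum>i\<in>K. (cmod (ip M f (e i)))\<^sup>2) \<le> nrm2 M f"
proof -
  obtain u where u: "\<And>n. u n \<in> U" and lim: "(\<lambda>n::nat. nrm2 M (\<lambda>x. u n x - f x)) \<longlonglongrightarrow> 0"
    using approximating_sequence[OF dense] by blast
  show ?thesis
  proof (rule LIMSEQ_le)
    show "(\<lambda>n. \<Sum>i\<in>K. (cmod (ip M (u n) (e i)))\<^sup>2) \<longlonglongrightarrow> (\<Sum>i\<in>K. (cmod (ip M f (e i)))\<^sup>2)"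
      by (intro tendsto_intros tendsto_ip_left lim U u f e)
    show "(\<lambda>n. nrm2 M (u n)) \<longlonglongrightarrow> nrm2 M f" by (intro tendsto_nrm2 lim U u f)
  qed (use bessel u in auto)
qed

text \<open>Bessel's inequality extends to the closure by continuity of finite sums. By linearity it also bounds the
  square sum of the change of the coefficients, and therefore the reverse inequality extends, too.\<close>

lemma tight_frame_extension:
  fixes e :: "'i \<Rightarrow> 'a \<Rightarrow> complex"
  assumes dense: "\<And>f e. sq_integrable M f \<Longrightarrow> e > 0 \<Longrightarrow> \<exists>u\<in>U. nrm2 M (\<lambda>x. f x - u x) < e"
    and f: "sq_integrable M f" and U: "\<And>u. u \<in> U \<Longrightarrow> sq_integrable M u"
    and e: "\<And>i. i \<in> I \<Longrightarrow> sq_integrable M (e i)"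
    and tight: "\<And>u. u \<in> U \<Longrightarrow> ((\<lambda>i. (cmod (ip M u (e i)))\<^sup>2) has_sum nrm2 M u) I"
  shows "((\<lambda>i. (cmod (ip M f (e i)))\<^sup>2) has_sum nrm2 M f) I"
proof -
  have bess: "(\<Sum>i\<in>K. (cmod (ip M h (e i)))\<^sup>2) \<le> nrm2 M h"
    if "finite K" "K \<subseteq> I" "sq_integrable M h" for K h
  proof (rule Bessel_extension[OF dense[OF that(3)] that(3) U])
    show "(\<Sum>i\<in>K. (cmod (ip M u (e i)))\<^sup>2) \<le> nrm2 M u" if "u \<in> U" for u
      by (rule finite_sum_le_has_sum[OF tight[OF that]]) (use \<open>finite K\<close> \<open>K \<subseteq> I\<close> in auto)
  qed (use that e in auto)
  define s where "s = infsum (\<lambda>i. (cmod (ip M f (e i)))\<^sup>2) I"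
  have s: "(\<lambda>i. (cmod (ip M f (e i)))\<^sup>2) summable_on I" "s \<le> nrm2 M f"
  proof -
    have b: "(\<Sum>i\<in>K. (cmod (ip M f (e i)))\<^sup>2) \<le> nrm2 M f" if "finite K" "K \<subseteq> I" for K
      by (rule bess[OF that f])
    show "(\<lambda>i. (cmod (ip M f (e i)))\<^sup>2) summable_on I"
      by (rule summable_on_bounded_sums(1)[OF _ b]) auto
    show "s \<le> nrm2 M f" unfolding s_def by (rule summable_on_bounded_sums(2)[OF _ b]) auto
  qed
  have s0: "0 \<le> s" unfolding s_def by (rule infsum_nonneg) simp
  obtain u where u: "\<And>n. u n \<in> U" and lim: "(\<lambda>n::nat. nrm2 M (\<lambda>x. u n x - f x)) \<longlonglongrightarrow> 0"
    using approximating_sequence[OF dense[OF f]] by blast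
  define d where "d n = nrm2 M (\<lambda>x. u n x - f x)" for n
  have le: "nrm2 M (u n) \<le> (sqrt s + sqrt (d n))\<^sup>2" for n
  proof (rule has_sum_le_finite_sums[OF tight[OF u]])
    fix K assume K: "finite K" "K \<subseteq> I"
    have diff: "ip M (u n) (e i) - ip M f (e i) = ip M (\<lambda>x. u n x - f x) (e i)" if "i \<in> K" for i
      using that K e by (subst ip_diff_left) (auto intro: U u f)
    show "(\<Sum>i\<in>K. (cmod (ip M (u n) (e i)))\<^sup>2) \<le> (sqrt s + sqrt (d n))\<^sup>2"
    proof (rule sum_cmod2_perturbation)
      show "(\<Sum>i\<in>K. (cmod (ip M f (e i)))\<^sup>2) \<le> s"
        unfolding s_def by (intro finite_sum_le_infsum s K) auto
      show "(\<Sum>i\<in>K. (cmod (ip M (u n) (e i) - ip M f (e i)))\<^sup>2) \<le> d n"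
        using bess[OF K sq_integrable_diff[OF U[OF u[of n]] f]] unfolding d_def by (simp add: diff)
    qed
  qed
  have "(\<lambda>n. (sqrt s + sqrt (d n))\<^sup>2) \<longlonglongrightarrow> (sqrt s + sqrt 0)\<^sup>2"
    unfolding d_def by (intro tendsto_intros lim)
  moreover have "(\<lambda>n. nrm2 M (u n)) \<longlonglongrightarrow> nrm2 M f" by (intro tendsto_nrm2 lim U u f)
  ultimately have "nrm2 M f \<le> (sqrt s + sqrt 0)\<^sup>2" using le LIMSEQ_le by blast
  then have "s = nrm2 M f" using s s0 by simp
  then show ?thesis using has_sum_infsum[OF s(1)] by (simp add: s_def)
qed

section \<open>Translations and dilations\<close>

lemma translation_sq_integrable:
  assumes "sq_integrable lborel f"
  shows "sq_integrable lborel (translation k f)"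
  using assms integrable_lborel_translate[of "\<lambda>x. (cmod (f x))\<^sup>2" "- k"]
  by (auto simp: sq_integrable_def translation_def)

lemma dilation_sq_integrable:
  fixes B :: "real^'n^'n"
  assumes B: "det B \<noteq> 0" and f: "sq_integrable lborel f"
  shows "sq_integrable lborel (dilation B f)"
proof -
  have [measurable]: "f \<in> borel_measurable borel" using f by (simp add: sq_integrable_def)
  have "sq_integrable lborel (\<lambda>x. f (B *v x))"
    using integrable_lborel_matrix[OF B sq_integrableD[OF f]] by (simp add: sq_integrable_def)
  then show ?thesis unfolding dilation_def by (rule sq_integrable_cmult)
qed

lemma dilation_ip:
  fixes B :: "real^'n^'n"
  assumes B: "det B \<noteq> 0" and f: "sq_integrable lborel f" and g: "sq_integrable lborel g"
  shows "ip lborel (dilation B f) (dilation B g) = ip lborel f g"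
proof -
  have [measurable]: "f \<in> borel_measurable borel" "g \<in> borel_measurable borel"
    using f g by (auto simp: sq_integrable_def)
  have "ip lborel f g = \<bar>det B\<bar> *\<^sub>R (LINT x|lborel. f (B *v x) * cnj (g (B *v x)))"
    unfolding ip_def by (rule integral_lborel_matrix[OF B]) measurable
  also have "\<dots> = ip lborel (dilation B f) (dilation B g)"
  proof -
    have "complex_of_real (sqrt \<bar>det B\<bar>) * a * cnj (complex_of_real (sqrt \<bar>det B\<bar>) * b) = complex_of_real \<bar>det B\<bar> * (a * cnj b)" for a b
    proof -
      have "complex_of_real (sqrt \<bar>det B\<bar>) * complex_of_real (sqrt \<bar>det B\<bar>) = complex_of_real \<bar>det B\<bar>"
        by (simp flip: of_real_mult)
      then show ?thesis by (metis (no_types, lifting) complex_cnj_complex_of_real complex_cnj_mult mult.assoc mult.left_commute)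
    qed
    then show ?thesis unfolding ip_def dilation_def by (simp only: integral_mult_right_zero scaleR_conv_of_real)
  qed
  finally show ?thesis by simp
qed

lemma dilation_inverse:
  fixes B :: "real^'n^'n"
  assumes B: "det B \<noteq> 0"
  shows "dilation (matrix_inv B) (dilation B f) = f" "dilation B (dilation (matrix_inv B) f) = f"
proof -
  have "invertible B" using B by (simp add: invertible_det_nz)
  note b = bij_dilation[OF this] inv_dilation[OF this]
  show "dilation (matrix_inv B) (dilation B f) = f"
    unfolding b(2)[symmetric] using b(1) by (simp add: bij_is_inj)
  show "dilation B (dilation (matrix_inv B) f) = f"
    unfolding b(2)[symmetric] using b(1) by (simp add: bij_is_surj surj_f_inv_f)
qed

lemma dilation_nrm2:
  fixes B :: "real^'n^'n"
  assumes B: "det B \<noteq> 0" and f: "sq_integrable lborel f"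
  shows "nrm2 lborel (dilation B f) = nrm2 lborel f"
  using dilation_ip[OF B f f] unfolding ip_self by simp

lemma funpow_dilation:
  fixes B :: "real^'n^'n"
  assumes B: "det B \<noteq> 0" and f: "sq_integrable lborel f"
  shows funpow_dilation_sq: "sq_integrable lborel ((dilation B ^^ n) f)"
    and funpow_dilation_nrm2: "nrm2 lborel ((dilation B ^^ n) f) = nrm2 lborel f"
  by (induct n) (simp_all add: f dilation_sq_integrable[OF B] dilation_nrm2[OF B])

lemma zpow_dilation:
  fixes B :: "real^'n^'n"
  assumes B: "det B \<noteq> 0"
  shows "zpow (dilation B) j = (if 0 \<le> j then dilation B ^^ nat j else dilation (matrix_inv B) ^^ nat (- j))"
  using inv_dilation[of B] B by (simp add: zpow_def invertible_det_nz)

lemma zpow_dilation_sq: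
  fixes B :: "real^'n^'n"
  assumes B: "det B \<noteq> 0" and f: "sq_integrable lborel f"
  shows "sq_integrable lborel (zpow (dilation B) j f)"
  using B funpow_dilation_sq[OF B f] funpow_dilation_sq[of "matrix_inv B", OF _ f]
  by (simp add: zpow_dilation[OF B] det_matrix_inv)

lemma funpow_dilation_adjoint:
  fixes B :: "real^'n^'n"
  assumes B: "det B \<noteq> 0" and f: "sq_integrable lborel f" and g: "sq_integrable lborel g"
  shows "ip lborel f ((dilation B ^^ n) g) = ip lborel ((dilation (matrix_inv B) ^^ n) f) g"
proof -
  have B': "det (matrix_inv B) \<noteq> 0" using B by (simp add: det_matrix_inv)
  have "(dilation B ^^ n) ((dilation (matrix_inv B) ^^ n) f) = f"
  proof (induct n)
    case (Suc n)
    have "(dilation B ^^ Suc n) h = (dilation B ^^ n) (dilation B h)" for h by (simp add: funpow_swap1)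
    then show ?case using Suc by (simp add: dilation_inverse[OF B])
  qed simp
  moreover have "ip lborel ((dilation B ^^ n) u) ((dilation B ^^ n) g) = ip lborel u g"
    if "sq_integrable lborel u" for u
    by (induct n) (simp_all add: dilation_ip[OF B] funpow_dilation_sq[OF B that] funpow_dilation_sq[OF B g])
  ultimately show ?thesis using funpow_dilation_sq[OF B' f, of n] by metis
qed

lemma zpow_dilation_adjoint:
  fixes B :: "real^'n^'n"
  assumes B: "det B \<noteq> 0" and f: "sq_integrable lborel f" and g: "sq_integrable lborel g"
  shows "ip lborel f (zpow (dilation B) j g) = ip lborel (zpow (dilation B) (- j) f) g"
  using funpow_dilation_adjoint[OF B f g] funpow_dilation_adjoint[of "matrix_inv B", OF _ f g] B
  by (cases "j = 0") (simp_all add: zpow_dilation[OF B] det_matrix_inv matrix_inv_matrix_inv)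

lemma zpow_dilation_step:
  fixes B :: "real^'n^'n"
  assumes B: "det B \<noteq> 0"
  shows "zpow (dilation B) (- (j + 1)) f = dilation (matrix_inv B) (zpow (dilation B) (- j) f)"
proof (cases "j \<ge> 0")
  case True
  then have "nat (j + 1) = Suc (nat j)" "nat (1 + j) = Suc (nat j)" by simp_all
  then show ?thesis using True by (cases "j = 0") (auto simp: zpow_dilation[OF B])
next
  case False
  then have n: "nat (- j) = Suc (nat (- (j + 1)))" by simp
  have "zpow (dilation B) (- j) f = dilation B ((dilation B ^^ nat (- (j + 1))) f)"
    using False unfolding zpow_dilation[OF B] n by simp
  then show ?thesis using False by (simp add: dilation_inverse[OF B]) (simp add: zpow_dilation[OF B])
qed

lemma test_function_matrix:
  fixes C :: "real^'n^'n"
  assumes g: "test_function g" and C: "det C \<noteq> 0"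
  shows "test_function (\<lambda>x. b * g (C *v x))"
proof -
  obtain M R where [measurable]: "g \<in> borel_measurable borel" and M: "\<And>x. cmod (g x) \<le> M"
    and R: "R > 0" "\<And>x. norm x > R \<Longrightarrow> g x = 0" using test_functionE[OF g] by metis
  let ?L = "onorm ((*v) (matrix_inv C))"
  have L: "norm x \<le> ?L * norm (C *v x)" for x
    using onorm[OF matrix_vector_mul_bounded_linear, of "matrix_inv C" "C *v x"] C by simp
  have L0: "?L \<ge> 0" by (intro onorm_pos_le matrix_vector_mul_bounded_linear)
  show ?thesis
  proof (rule test_functionI[of _ "cmod b * M" "?L * R"])
    show "cmod (b * g (C *v x)) \<le> cmod b * M" for x unfolding norm_mult by (intro mult_left_mono M) simp
    show "b * g (C *v x) = 0" if "?L * R < norm x" for x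
    proof -
      have "?L * R < ?L * norm (C *v x)" using that L[of x] by linarith
      then have "R < norm (C *v x)" using L0 by (simp add: mult_less_cancel_left)
      then show ?thesis using R by simp
    qed
  qed measurable
qed

lemma ift_cmult: "ift (\<lambda>\<xi>. b * g \<xi>) x = b * ift g x"
  unfolding ift_def by (simp add: mult.assoc)

text \<open>On the Fourier side the inverse dilation by \<open>B\<close> is the dilation by the transpose of \<open>B\<close>.\<close>

lemma dilation_inv_ift:
  fixes B :: "real^'n^'n"
  assumes B: "det B \<noteq> 0" and g: "g \<in> borel_measurable borel"
  shows "dilation (matrix_inv B) (ift g) = ift (\<lambda>\<xi>. complex_of_real (sqrt \<bar>det B\<bar>) * g (transpose B *v \<xi>))"
proof
  fix x
  have d: "\<bar>det B\<bar> > 0" using B by simp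
  have "sqrt (inverse \<bar>det B\<bar>) = sqrt \<bar>det B\<bar> * inverse \<bar>det B\<bar>"
  proof -
    have "inverse s = s * inverse (s * s)" if "s \<noteq> 0" for s :: real using that by simp
    from this[of "sqrt \<bar>det B\<bar>"] show ?thesis using d by (simp add: real_sqrt_inverse)
  qed
  then show "dilation (matrix_inv B) (ift g) x = ift (\<lambda>\<xi>. complex_of_real (sqrt \<bar>det B\<bar>) * g (transpose B *v \<xi>)) x"
    unfolding ift_cmult ift_matrix[OF B g] dilation_def det_matrix_inv[OF B] abs_inverse
    by (simp only: of_real_mult mult.assoc)
qed

lemma dilation_ift:
  fixes B :: "real^'n^'n"
  assumes B: "det B \<noteq> 0" and g: "test_function g"
  shows "\<exists>g'. test_function g' \<and> dilation B (ift g) = ift g'"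
proof -
  have B': "det (matrix_inv B) \<noteq> 0" using B by (simp add: det_matrix_inv)
  let ?g = "\<lambda>\<xi>. complex_of_real (sqrt \<bar>det (matrix_inv B)\<bar>) * g (transpose (matrix_inv B) *v \<xi>)"
  have "dilation B (ift g) = ift ?g"
    using dilation_inv_ift[OF B' test_function_integrable(3)[OF g]] unfolding matrix_inv_matrix_inv[OF B] .
  moreover have "test_function ?g" by (rule test_function_matrix[OF g]) (use B' in \<open>simp add: det_transpose\<close>)
  ultimately show ?thesis by blast
qed

section \<open>The energy of a shift-invariant system\<close>

lemma has_sum_finite_sum:
  fixes f :: "'r \<Rightarrow> 'i \<Rightarrow> 'b::topological_comm_monoid_add"
  assumes "finite R" "\<And>r. r \<in> R \<Longrightarrow> (f r has_sum a r) I"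
  shows "((\<lambda>i. \<Sum>r\<in>R. f r i) has_sum (\<Sum>r\<in>R. a r)) I"
  using assms by (induct R rule: finite_induct) (auto intro!: has_sum_add)

lemma borel_measurable_infsum_complex:
  fixes f :: "'i \<Rightarrow> 'a \<Rightarrow> complex"
  assumes I: "countable I" and f: "\<And>i. i \<in> I \<Longrightarrow> f i \<in> borel_measurable M"
  shows "(\<lambda>x. \<Sum>\<^sub>\<infinity>i\<in>I. f i x) \<in> borel_measurable M"
proof -
  interpret I: sigma_finite_measure "count_space I" using I by (rule sigma_finite_measure_count_space_countable)
  show ?thesis
    unfolding infsum_eq_integral_count_space
  proof (rule I.borel_measurable_lebesgue_integral)
    have "(\<lambda>(i, x). f i x) \<in> borel_measurable (count_space I \<Otimes>\<^sub>M M)"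
      by (rule measurable_pair_measure_countable1[OF I]) (use f in auto)
    then show "(\<lambda>(x, i). f i x) \<in> borel_measurable (M \<Otimes>\<^sub>M count_space I)"
      by (subst measurable_pair_swap_iff) (simp add: case_prod_unfold)
  qed
qed

text \<open>The energy of \<open>ift g\<close> is expressed through the correlations of the transforms \<open>G i\<close> at lattice distances.
  Only the finitely many shifts in \<open>R\<close> for which the support of \<open>g\<close> meets its translate contribute.\<close>

locale shift_system =
  fixes I :: "'i set" and \<theta> G :: "'i \<Rightarrow> real^'n \<Rightarrow> complex"
  assumes I: "countable I" and ft: "\<And>i. i \<in> I \<Longrightarrow> is_ft (\<theta> i) (G i)"
    and summable: "(\<lambda>i. nrm2 lborel (G i)) summable_on I"
begin

definition correlation :: "real^'n \<Rightarrow> real^'n \<Rightarrow> complex" where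
  "correlation r \<xi> = (\<Sum>\<^sub>\<infinity>i\<in>I. G i \<xi> * cnj (G i (\<xi> + (2 * pi) *\<^sub>R r)))"

lemma G_sq: "i \<in> I \<Longrightarrow> sq_integrable lborel (G i)" and \<theta>_sq: "i \<in> I \<Longrightarrow> sq_integrable lborel (\<theta> i)"
  using ft by (auto simp: is_ft_def)

lemma correlation_measurable [measurable]: "correlation r \<in> borel_measurable borel"
  unfolding correlation_def[abs_def]
proof (rule borel_measurable_infsum_complex[OF I])
  fix i assume "i \<in> I"
  then have [measurable]: "G i \<in> borel_measurable borel" using G_sq by (simp add: sq_integrable_def)
  show "(\<lambda>\<xi>. G i \<xi> * cnj (G i (\<xi> + (2 * pi) *\<^sub>R r))) \<in> borel_measurable borel" by measurable
qed

text \<open>The interchange of sum and integral is justified by the Cauchy-Schwarz inequality: the \<open>i\<close>-th integral is at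
  most \<open>M\<^sup>2\<close> times the squared norm of \<open>G i\<close>.\<close>

lemma correlation_integral:
  assumes g: "test_function g"
  shows "((\<lambda>i. LINT \<xi>|lborel. cnj (g \<xi>) * g (\<xi> + (2 * pi) *\<^sub>R r) * (G i \<xi> * cnj (G i (\<xi> + (2 * pi) *\<^sub>R r)))) has_sum
      (LINT \<xi>|lborel. cnj (g \<xi>) * g (\<xi> + (2 * pi) *\<^sub>R r) * correlation r \<xi>)) I"
    and "integrable lborel (\<lambda>\<xi>. cnj (g \<xi>) * g (\<xi> + (2 * pi) *\<^sub>R r) * correlation r \<xi>)"
proof -
  obtain M where gm [measurable]: "g \<in> borel_measurable borel" and M: "\<And>x. cmod (g x) \<le> M"
    using test_functionE[OF g] by metis
  have M0: "0 \<le> M" using M norm_ge_zero order.trans by blast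
  let ?v = "(2 * pi) *\<^sub>R r"
  let ?f = "\<lambda>i \<xi>. cnj (g \<xi>) * g (\<xi> + ?v) * (G i \<xi> * cnj (G i (\<xi> + ?v)))"
  have Gt: "sq_integrable lborel (\<lambda>\<xi>. G i (\<xi> + ?v))" "nrm2 lborel (\<lambda>\<xi>. G i (\<xi> + ?v)) = nrm2 lborel (G i)"
    if "i \<in> I" for i
  proof -
    have [measurable]: "G i \<in> borel_measurable borel" using G_sq[OF that] by (simp add: sq_integrable_def)
    show "sq_integrable lborel (\<lambda>\<xi>. G i (\<xi> + ?v))"
      using integrable_lborel_translate[OF sq_integrableD[OF G_sq[OF that]], of ?v] by (simp add: sq_integrable_def)
    have "(\<lambda>\<xi>. (cmod (G i \<xi>))\<^sup>2) \<in> borel_measurable borel" by measurable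
    from integral_lborel_translate[OF this, of ?v]
    show "nrm2 lborel (\<lambda>\<xi>. G i (\<xi> + ?v)) = nrm2 lborel (G i)" by (simp add: nrm2_def)
  qed
  have b: "cmod (?f i \<xi>) \<le> M * M * (cmod (G i \<xi>) * cmod (G i (\<xi> + ?v)))" for i \<xi>
    unfolding norm_mult complex_mod_cnj using M M0 by (intro mult_right_mono mult_mono) auto
  have dom: "integrable lborel (\<lambda>\<xi>. M * M * (cmod (G i \<xi>) * cmod (G i (\<xi> + ?v))))" if "i \<in> I" for i
    using integrable_cmod_mult[OF G_sq[OF that] Gt(1)[OF that]] by simp
  have fi: "integrable lborel (?f i)" if "i \<in> I" for i
  proof (rule Bochner_Integration.integrable_bound[OF dom[OF that]])
    have [measurable]: "G i \<in> borel_measurable borel" using G_sq[OF that] by (simp add: sq_integrable_def)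
    show "?f i \<in> borel_measurable lborel" by measurable
    show "AE \<xi> in lborel. norm (?f i \<xi>) \<le> norm (M * M * (cmod (G i \<xi>) * cmod (G i (\<xi> + ?v))))"
      by (rule AE_I2) (rule order.trans[OF b], simp)
  qed
  have s: "(\<lambda>i. LINT \<xi>|lborel. cmod (?f i \<xi>)) summable_on I"
  proof (rule summable_on_comparison_test)
    show "(\<lambda>i. M * M * nrm2 lborel (G i)) summable_on I" by (intro summable_on_cmult_right summable)
    show "(LINT \<xi>|lborel. cmod (?f i \<xi>)) \<le> M * M * nrm2 lborel (G i)" if i: "i \<in> I" for i
    proof -
      have "(LINT \<xi>|lborel. cmod (?f i \<xi>)) \<le> (LINT \<xi>|lborel. M * M * (cmod (G i \<xi>) * cmod (G i (\<xi> + ?v))))"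
        by (rule integral_mono[OF _ dom[OF i] b]) (use fi[OF i] in auto)
      also have "\<dots> = M * M * (LINT \<xi>|lborel. cmod (G i \<xi>) * cmod (G i (\<xi> + ?v)))" by simp
      also have "(LINT \<xi>|lborel. cmod (G i \<xi>) * cmod (G i (\<xi> + ?v))) \<le> nrm2 lborel (G i)"
        using Cauchy_Schwarz_cmod[OF G_sq[OF i] Gt(1)[OF i]] unfolding Gt(2)[OF i] power2_eq_square[symmetric]
        by (rule power2_le_imp_le) simp
      finally show ?thesis using M0 by (simp add: mult_left_mono)
    qed
  qed simp
  have inf: "(\<Sum>\<^sub>\<infinity>i\<in>I. ?f i \<xi>) = cnj (g \<xi>) * g (\<xi> + ?v) * correlation r \<xi>" for \<xi>
    unfolding correlation_def by (rule infsum_cmult_right')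
  show "((\<lambda>i. LINT \<xi>|lborel. ?f i \<xi>) has_sum (LINT \<xi>|lborel. cnj (g \<xi>) * g (\<xi> + ?v) * correlation r \<xi>)) I"
    using has_sum_integral(1)[OF I sigma_finite_lborel fi s] unfolding inf .
  show "integrable lborel (\<lambda>\<xi>. cnj (g \<xi>) * g (\<xi> + ?v) * correlation r \<xi>)"
    using has_sum_integral(2)[OF I sigma_finite_lborel fi s] unfolding inf .
qed

definition energy :: "(real^'n \<Rightarrow> complex) \<Rightarrow> real" where
  "energy u = (\<Sum>\<^sub>\<infinity>(i, k)\<in>I \<times> int_lattice. (cmod (ip lborel u (translation k (\<theta> i))))\<^sup>2)"

text \<open>A translation by \<open>k\<close> is a modulation on the Fourier side, which makes the inner product a Fourier coefficient.\<close>

lemma ip_ift_translation: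
  assumes g: "test_function g" and i: "i \<in> I"
  shows "ip lborel (ift g) (translation k (\<theta> i)) =
    complex_of_real (inverse ((2 * pi) ^ CARD('n))) * cnj (ft (\<lambda>\<xi>. cnj (g \<xi>) * G i \<xi>) k)"
proof -
  have [measurable]: "\<theta> i \<in> borel_measurable borel" using \<theta>_sq[OF i] by (simp add: sq_integrable_def)
  have [measurable]: "ift g \<in> borel_measurable borel" using ift_sq_integrable[OF g] by (simp add: sq_integrable_def)
  let ?g = "\<lambda>\<xi>. cis (k \<bullet> \<xi>) * g \<xi>"
  have tg: "test_function ?g" by (rule test_function_mult[OF g, of _ 1]) auto
  have "ip lborel (ift g) (translation k (\<theta> i)) = (LINT x|lborel. (\<lambda>x. ift g x * cnj (\<theta> i (x - k))) (x + k))"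
    unfolding ip_def translation_def by (rule integral_lborel_translate[symmetric]) measurable
  also have "\<dots> = ip lborel (ift ?g) (\<theta> i)" unfolding ip_def ift_modulation by simp
  also have "\<dots> = complex_of_real (inverse ((2 * pi) ^ CARD('n))) * ip lborel ?g (G i)"
    using ip_ift[OF tg ft[OF i]] by simp
  also have "ip lborel ?g (G i) = cnj (ft (\<lambda>\<xi>. cnj (g \<xi>) * G i \<xi>) k)"
    unfolding ip_def ft_def Bochner_Integration.integral_cnj[symmetric]
    by (intro Bochner_Integration.integral_cong) (auto simp: cis_cnj inner_commute)
  finally show ?thesis .
qed

lemma energy_ift:
  assumes g: "test_function g" and R: "finite R" "R \<subseteq> int_lattice"
    "\<And>r \<xi>. r \<in> int_lattice - R \<Longrightarrow> g \<xi> * cnj (g (\<xi> + (2 * pi) *\<^sub>R r)) = 0"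
  shows "((\<lambda>(i, k). (cmod (ip lborel (ift g) (translation k (\<theta> i))))\<^sup>2) has_sum energy (ift g)) (I \<times> int_lattice)"
    and "energy (ift g) = inverse ((2 * pi) ^ CARD('n)) *
      Re (\<Sum>r\<in>R. LINT \<xi>|lborel. cnj (g \<xi>) * g (\<xi> + (2 * pi) *\<^sub>R r) * correlation r \<xi>)"
proof -
  let ?N = "(2 * pi) ^ CARD('n)"
  obtain M \<rho> where gm [measurable]: "g \<in> borel_measurable borel" and M: "\<And>x. cmod (g x) \<le> M"
    and \<rho>: "\<And>x. norm x > \<rho> \<Longrightarrow> g x = 0" using test_functionE[OF g] by metis
  let ?F = "\<lambda>i \<xi>. cnj (g \<xi>) * G i \<xi>"
  let ?c = "\<lambda>i r. LINT \<xi>|lborel. cnj (g \<xi>) * g (\<xi> + (2 * pi) *\<^sub>R r) * (G i \<xi> * cnj (G i (\<xi> + (2 * pi) *\<^sub>R r)))"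
  let ?E = "\<lambda>(i, k). (cmod (ip lborel (ift g) (translation k (\<theta> i))))\<^sup>2"
  define S where "S = inverse ?N * Re (\<Sum>r\<in>R. LINT \<xi>|lborel. cnj (g \<xi>) * g (\<xi> + (2 * pi) *\<^sub>R r) * correlation r \<xi>)"
  have per: "((\<lambda>k. ?E (i, k)) has_sum inverse ?N * Re (\<Sum>r\<in>R. ?c i r)) int_lattice" if i: "i \<in> I" for i
  proof -
    have [measurable]: "G i \<in> borel_measurable borel" using G_sq[OF i] by (simp add: sq_integrable_def)
    have "sq_integrable lborel (?F i)"
    proof (rule sq_integrable_bound[OF G_sq[OF i], of _ M])
      show "AE x in lborel. cmod (cnj (g x) * G i x) \<le> M * cmod (G i x)"
        unfolding norm_mult complex_mod_cnj using M by (intro AE_I2 mult_right_mono) auto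
    qed measurable
    then have "((\<lambda>k. (cmod (ft (?F i) k))\<^sup>2) has_sum ?N * Re (\<Sum>r\<in>R. LINT x|lborel. ?F i x * cnj (?F i (x + (2 * pi) *\<^sub>R r)))) int_lattice"
    proof (rule ft_periodization[where \<rho>=\<rho>])
      show "?F i x = 0" if "\<rho> < norm x" for x using \<rho>[OF that] by simp
      show "?F i x * cnj (?F i (x + (2 * pi) *\<^sub>R r)) = 0" if "r \<in> int_lattice - R" for r x
        using R(3)[OF that, of x] by auto
    qed (use R in auto)
    also have "(\<Sum>r\<in>R. LINT x|lborel. ?F i x * cnj (?F i (x + (2 * pi) *\<^sub>R r))) = (\<Sum>r\<in>R. ?c i r)"
      by (simp add: ac_simps)
    finally have "((\<lambda>k. (inverse ?N)\<^sup>2 * (cmod (ft (?F i) k))\<^sup>2) has_sum (inverse ?N)\<^sup>2 * (?N * Re (\<Sum>r\<in>R. ?c i r))) int_lattice"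
      by (rule has_sum_cmult_right)
    also have "(inverse ?N)\<^sup>2 * (?N * Re (\<Sum>r\<in>R. ?c i r)) = inverse ?N * Re (\<Sum>r\<in>R. ?c i r)"
    proof -
      have scale: "(inverse N)\<^sup>2 * (N * x) = inverse N * x" if "N \<noteq> 0" for N x :: real
        using that by (simp add: power2_eq_square)
      show ?thesis by (rule scale) simp
    qed
    also have "(\<lambda>k. (inverse ?N)\<^sup>2 * (cmod (ft (?F i) k))\<^sup>2) = (\<lambda>k. ?E (i, k))"
    proof
      fix k
      have cm: "a\<^sup>2 * (cmod z)\<^sup>2 = (cmod (complex_of_real a * cnj z))\<^sup>2" for a z
        by (simp add: norm_mult power_mult_distrib)
      show "(inverse ?N)\<^sup>2 * (cmod (ft (?F i) k))\<^sup>2 = ?E (i, k)"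
        unfolding prod.case ip_ift_translation[OF g i] by (rule cm)
    qed
    finally show ?thesis .
  qed
  have tot: "((\<lambda>i. inverse ?N * Re (\<Sum>r\<in>R. ?c i r)) has_sum S) I"
    unfolding S_def
    by (intro has_sum_cmult_right has_sum_Re has_sum_finite_sum R correlation_integral(1) g)
  have sm: "?E summable_on (I \<times> int_lattice)"
    by (rule summable_on_SigmaI[OF per]) (use tot in \<open>auto simp: summable_on_def\<close>)
  have hs: "(?E has_sum S) (I \<times> int_lattice)"
    by (rule has_sum_SigmaI[OF per tot sm])
  then have "energy (ift g) = S" unfolding energy_def by (rule infsumI)
  then show "(?E has_sum energy (ift g)) (I \<times> int_lattice)"
    and "energy (ift g) = inverse ?N * Re (\<Sum>r\<in>R. LINT \<xi>|lborel. cnj (g \<xi>) * g (\<xi> + (2 * pi) *\<^sub>R r) * correlation r \<xi>)"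
    using hs by (simp_all add: S_def)
qed

end

section \<open>Iterated matrices\<close>

lemma AE_funpow_matrix:
  fixes C :: "real^'n^'n"
  assumes C: "det C \<noteq> 0" and P: "AE x in lborel. P x"
  shows "AE x in lborel. P ((((*v) C) ^^ m) x)"
proof (induct m)
  case (Suc m)
  from AE_lborel_matrix[OF C Suc] show ?case by (simp add: funpow_swap1)
qed (simp add: P)

lemma integral_funpow_matrix:
  fixes C :: "real^'n^'n" and f :: "real^'n \<Rightarrow> 'b::{banach, second_countable_topology}"
  assumes C: "det C \<noteq> 0" and f: "f \<in> borel_measurable borel"
  shows "(LINT x|lborel. f x) = \<bar>det C\<bar> ^ m *\<^sub>R (LINT x|lborel. f ((((*v) C) ^^ m) x))"
  using f
proof (induct m arbitrary: f)
  case (Suc m)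
  note Suc(2)[measurable]
  have "(LINT x|lborel. f x) = \<bar>det C\<bar> *\<^sub>R (LINT x|lborel. f (C *v x))"
    by (rule integral_lborel_matrix[OF C Suc(2)])
  also have "(LINT x|lborel. f (C *v x)) = \<bar>det C\<bar> ^ m *\<^sub>R (LINT x|lborel. f (C *v ((((*v) C) ^^ m) x)))"
    by (rule Suc(1)) measurable
  finally show ?case by simp
qed simp

lemma integrable_funpow_matrix:
  fixes C :: "real^'n^'n" and f :: "real^'n \<Rightarrow> 'b::{banach, second_countable_topology}"
  assumes C: "det C \<noteq> 0" and f: "integrable lborel f"
  shows "integrable lborel (\<lambda>x. f ((((*v) C) ^^ m) x))"
proof (induct m)
  case (Suc m)
  from integrable_lborel_matrix[OF C Suc] show ?case by (simp add: funpow_swap1)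
qed (simp add: f)

lemma funpow_inverse_cancel:
  fixes C :: "real^'n^'n"
  assumes C: "det C \<noteq> 0"
  shows "(((*v) (matrix_inv C)) ^^ m) ((((*v) C) ^^ m) x) = x"
proof (induct m)
  case (Suc m)
  have "(((*v) (matrix_inv C)) ^^ Suc m) ((((*v) C) ^^ Suc m) x) =
      (((*v) (matrix_inv C)) ^^ m) (matrix_inv C *v (C *v ((((*v) C) ^^ m) x)))"
    by (simp add: funpow_swap1)
  then show ?case using Suc C by simp
qed simp

lemma funpow_matrix_borel [measurable]:
  "(((*v) (C :: real^'n^'n)) ^^ m) \<in> borel_measurable borel"
proof (induct m)
  case (Suc m)
  have "(\<lambda>x. C *v ((((*v) C) ^^ m) x)) \<in> borel_measurable borel"
    using Suc by measurable
  then show ?case by (simp add: o_def)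
qed (simp add: id_def)

lemma funpow_dilation_apply:
  "((dilation B ^^ m) f) x = complex_of_real (sqrt \<bar>det B\<bar> ^ m) * f ((((*v) B) ^^ m) x)"
proof (induct m arbitrary: f)
  case (Suc m)
  have "((dilation B ^^ Suc m) f) x = ((dilation B ^^ m) (dilation B f)) x" by (simp add: funpow_swap1)
  also have "\<dots> = complex_of_real (sqrt \<bar>det B\<bar> ^ m) * dilation B f ((((*v) B) ^^ m) x)" by (rule Suc)
  finally show ?case unfolding dilation_def[of B f] by (simp add: ac_simps)
qed simp

lemma funpow_dilation_diff:
  "(dilation B ^^ m) (\<lambda>x. f x - g x) = (\<lambda>x. (dilation B ^^ m) f x - (dilation B ^^ m) g x)"
  by (simp add: fun_eq_iff funpow_dilation_apply right_diff_distrib)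

lemma sum_le_nn_integral_count_space:
  fixes f :: "'i \<Rightarrow> ennreal"
  assumes "finite K" "K \<subseteq> X"
  shows "sum f K \<le> (\<integral>\<^sup>+i. f i \<partial>count_space X)"
proof -
  have "sum f K = (\<integral>\<^sup>+i. f i \<partial>count_space K)" by (rule nn_integral_count_space_finite[OF assms(1), symmetric])
  also have "\<dots> = (\<integral>\<^sup>+i. f i * indicator K i \<partial>count_space UNIV)" by (subst nn_integral_count_space_indicator) auto
  also have "\<dots> \<le> (\<integral>\<^sup>+i. f i * indicator X i \<partial>count_space UNIV)"
    using assms(2) by (intro nn_integral_mono) (auto simp: indicator_def)
  also have "\<dots> = (\<integral>\<^sup>+i. f i \<partial>count_space X)" by (subst (2) nn_integral_count_space_indicator) auto
  finally show ?thesis .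
qed

lemma has_sum_telescoping_int:
  fixes a b :: "int \<Rightarrow> real"
  assumes step: "\<And>j. a (j + 1) = a j + b j" and b: "\<And>j. 0 \<le> b j"
    and top: "(\<lambda>m. a (int m)) \<longlonglongrightarrow> L" and bot: "(\<lambda>m. a (- int m)) \<longlonglongrightarrow> 0"
  shows "(b has_sum L) UNIV"
proof -
  have sum: "(\<Sum>j\<in>{- int M..<int M'}. b j) = a (int M') - a (- int M)" for M M'
  proof (induct M')
    case 0
    show ?case
    proof (induct M)
      case (Suc M)
      have "{- int (Suc M)..<int 0} = insert (- int (Suc M)) {- int M..<int 0}" by auto
      then show ?case using Suc step[of "- int (Suc M)"] by simp
    qed simp
  next
    case (Suc M')
    have "{- int M..<int (Suc M')} = insert (int M') {- int M..<int M'}" by auto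
    then show ?case using Suc step[of "int M'"] by (simp add: add.commute)
  qed
  have up: "a (int m) \<le> L" for m
  proof (rule incseq_le[OF incseq_SucI top])
    show "a (int n) \<le> a (int (Suc n))" for n using step[of "int n"] b[of "int n"] by (simp add: add.commute)
  qed
  have lo: "0 \<le> a (- int m)" for m
  proof (rule decseq_ge[OF decseq_SucI bot])
    show "a (- int (Suc n)) \<le> a (- int n)" for n using step[of "- int (Suc n)"] b[of "- int (Suc n)"] by simp
  qed
  \<comment> \<open>Every finite set is covered by an interval around \<open>0\<close>, whose sum telescopes.\<close>
  have bd: "sum b K \<le> L" if fin: "finite K" for K
  proof -
    obtain M where M: "\<And>j. j \<in> K \<Longrightarrow> \<bar>j\<bar> \<le> int M"
    proof -
      have "finite ((\<lambda>j. nat \<bar>j\<bar>) ` K)" using fin by simp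
      then obtain M where "\<forall>n\<in>(\<lambda>j. nat \<bar>j\<bar>) ` K. n \<le> M" using finite_nat_set_iff_bounded_le by blast
      then show ?thesis by (intro that[of M]) force
    qed
    have "sum b K \<le> (\<Sum>j\<in>{- int (Suc M)..<int (Suc M)}. b j)"
      by (rule sum_mono2) (use M b in fastforce)+
    also have "\<dots> \<le> L" unfolding sum using up[of "Suc M"] lo[of "Suc M"] by linarith
    finally show ?thesis .
  qed
  have s: "b summable_on UNIV" "infsum b UNIV \<le> L"
    by (rule summable_on_bounded_sums(1,2)[of UNIV b L]; use b bd in blast)+
  have "(\<lambda>m. a (int m) - a (- int m)) \<longlonglongrightarrow> L - 0" by (intro tendsto_intros top bot)
  then have "L - 0 \<le> infsum b UNIV"
  proof (rule LIMSEQ_le_const2)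
    show "\<exists>N. \<forall>m\<ge>N. a (int m) - a (- int m) \<le> infsum b UNIV"
      using finite_sum_le_infsum[OF s(1), of "{- int m..<int m}" for m] b unfolding sum by auto
  qed
  then show ?thesis using s has_sum_infsum[OF s(1)] by simp
qed

lemma finitely_many_overlaps:
  fixes g :: "real^'n \<Rightarrow> complex"
  assumes g: "test_function g"
  obtains R where "finite R" "R \<subseteq> int_lattice"
    "\<And>r \<xi>. r \<in> int_lattice - R \<Longrightarrow> g \<xi> * cnj (g (\<xi> + (2 * pi) *\<^sub>R r)) = 0"
proof -
  obtain \<rho> where \<rho>: "\<And>x. norm x > \<rho> \<Longrightarrow> g x = 0" using test_functionE[OF g] by metis
  show ?thesis
  proof (rule that[of "{r \<in> int_lattice. norm r \<le> \<bar>\<rho>\<bar>}"])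
    show "g \<xi> * cnj (g (\<xi> + (2 * pi) *\<^sub>R r)) = 0" if r: "r \<in> int_lattice - {r \<in> int_lattice. norm r \<le> \<bar>\<rho>\<bar>}" for r \<xi>
    proof (rule ccontr)
      assume "g \<xi> * cnj (g (\<xi> + (2 * pi) *\<^sub>R r)) \<noteq> 0"
      then have "norm \<xi> \<le> \<rho>" "norm (\<xi> + (2 * pi) *\<^sub>R r) \<le> \<rho>" using \<rho> by (force simp: not_less[symmetric])+
      then have "norm ((2 * pi) *\<^sub>R r) \<le> 2 * \<rho>" using norm_triangle_ineq4[of "\<xi> + (2 * pi) *\<^sub>R r" \<xi>] by simp
      \<comment> \<open>The crude bound \<open>2 \<le> 2 \<pi>\<close> makes the radius \<open>\<rho>\<close> sufficient for \<open>R\<close>.\<close>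
      moreover have "norm ((2 * pi) *\<^sub>R r) \<ge> 2 * norm r" using pi_gt3 by (simp add: mult_le_cancel_right1)
      ultimately show False using r by auto
    qed
  qed (auto intro: finite_int_lattice_ball)
qed

section \<open>The tight frame property\<close>

text \<open>A matrix that preserves the lattice has integer entries.\<close>

lemma transpose_int_lattice:
  fixes A :: "real^'n^'n"
  assumes integral: "(*v) A ` int_lattice \<subseteq> int_lattice" and r: "r \<in> int_lattice"
  shows "transpose A *v r \<in> int_lattice"
proof -
  have A: "A $ i $ j \<in> \<int>" for i j
  proof -
    have "axis j 1 \<in> (int_lattice :: (real^'n) set)" by (auto simp: int_lattice_def axis_def)
    then have "A *v axis j 1 \<in> int_lattice" using integral by blast
    moreover have "(A *v axis j 1) $ i = A $ i $ j"
      by (simp add: matrix_vector_mult_def axis_def if_distrib[of "\<lambda>x. z * x" for z] cong: if_cong)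
    ultimately show ?thesis unfolding int_lattice_def by (metis mem_Collect_eq)
  qed
  show ?thesis
    using r A by (auto simp: int_lattice_def matrix_vector_mult_def transpose_def intro!: Ints_sum Ints_mult)
qed

text \<open>\<open>\<phi> i\<close> and \<open>\<psi> j\<close> are Borel representatives of the elements of \<open>\<Phi>\<close> and \<open>\<Psi>\<close>, and \<open>P i\<close> and \<open>S j\<close> are Borel
  representatives of their transforms.\<close>

locale refinable_pair = expansive_matrix A
  for A :: "real^'n^'n" +
  fixes I :: "'i set" and \<phi> P :: "'i \<Rightarrow> real^'n \<Rightarrow> complex"
    and J :: "'j set" and \<psi> S :: "'j \<Rightarrow> real^'n \<Rightarrow> complex"
  assumes integral: "(*v) A ` int_lattice \<subseteq> int_lattice"
    and I: "countable I" and J: "finite J"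
    and ft_\<phi>: "\<And>i. i \<in> I \<Longrightarrow> is_ft (\<phi> i) (P i)" and ft_\<psi>: "\<And>j. j \<in> J \<Longrightarrow> is_ft (\<psi> j) (S j)"
    and pointwise_summable: "AE \<xi> in lborel. (\<lambda>i. (cmod (P i \<xi>))\<^sup>2) summable_on I"
    and off_lattice: "AE \<xi> in lborel. \<forall>s \<in> int_lattice - (*v) (transpose A) ` int_lattice.
        - (\<Sum>\<^sub>\<infinity>i\<in>I. P i \<xi> * cnj (P i (\<xi> + (2 * pi) *\<^sub>R s)))
        = (\<Sum>j\<in>J. S j \<xi> * cnj (S j (\<xi> + (2 * pi) *\<^sub>R s)))"
    and on_lattice: "AE \<xi> in lborel. \<forall>s \<in> (*v) (transpose A) ` int_lattice.
        (\<Sum>\<^sub>\<infinity>i\<in>I. P i (matrix_inv (transpose A) *v \<xi>)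
                * cnj (P i (matrix_inv (transpose A) *v (\<xi> + (2 * pi) *\<^sub>R s))))
        - (\<Sum>\<^sub>\<infinity>i\<in>I. P i \<xi> * cnj (P i (\<xi> + (2 * pi) *\<^sub>R s)))
        = (\<Sum>j\<in>J. S j \<xi> * cnj (S j (\<xi> + (2 * pi) *\<^sub>R s)))"
    and limit_infinity: "AE \<xi> in lborel.
        (\<lambda>m. \<Sum>\<^sub>\<infinity>i\<in>I. (cmod (P i (((*v) (transpose A) ^^ m) \<xi>)))\<^sup>2) \<longlonglongrightarrow> 0"
    and limit_zero: "AE \<xi> in lborel.
        (\<lambda>m. \<Sum>\<^sub>\<infinity>i\<in>I. (cmod (P i (((*v) (matrix_inv (transpose A)) ^^ m) \<xi>)))\<^sup>2) \<longlonglongrightarrow> 1"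
begin

abbreviation T :: "real^'n^'n" where "T \<equiv> transpose A"
abbreviation B :: "real^'n^'n" where "B \<equiv> matrix_inv (transpose A)"

lemma det_T: "det T \<noteq> 0" and det_B: "det B \<noteq> 0"
  using det_nz by (simp_all add: det_transpose det_matrix_inv)

lemma BT: "B *v (T *v x) = x"
  by (rule matrix_inv_vec[OF det_T])

lemma P_sq: "i \<in> I \<Longrightarrow> sq_integrable lborel (P i)" and S_sq: "j \<in> J \<Longrightarrow> sq_integrable lborel (S j)"
  using ft_\<phi> ft_\<psi> by (auto simp: is_ft_def)

definition h :: "real^'n \<Rightarrow> real" where
  "h \<xi> = (\<Sum>\<^sub>\<infinity>i\<in>I. (cmod (P i \<xi>))\<^sup>2)"

definition q :: "real^'n \<Rightarrow> real" where
  "q \<xi> = (\<Sum>j\<in>J. (cmod (S j \<xi>))\<^sup>2)"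

lemma q_nonneg: "0 \<le> q \<xi>"
  by (simp add: q_def sum_nonneg)

lemma q_integrable: "integrable lborel q"
  unfolding q_def[abs_def] using S_sq by (auto simp: sq_integrable_def)

lemma h_nonneg: "0 \<le> h \<xi>"
  unfolding h_def by (rule infsum_nonneg) simp

lemma h_complex:
  assumes "(\<lambda>i. (cmod (P i \<xi>))\<^sup>2) summable_on I"
  shows "(\<Sum>\<^sub>\<infinity>i\<in>I. P i \<xi> * cnj (P i \<xi>)) = complex_of_real (h \<xi>)"
proof -
  have "((\<lambda>i. complex_of_real ((cmod (P i \<xi>))\<^sup>2)) has_sum complex_of_real (h \<xi>)) I"
    unfolding h_def using assms by (intro has_sum_of_real has_sum_infsum)
  then show ?thesis unfolding complex_norm_square by (rule infsumI)
qed

text \<open>The equation for the shift \<open>0\<close>.\<close>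

lemma h_refinement: "AE \<xi> in lborel. h (B *v \<xi>) = h \<xi> + q \<xi>"
  using on_lattice pointwise_summable AE_lborel_matrix[OF det_B pointwise_summable]
proof eventually_elim
  case (elim \<xi>)
  have "0 \<in> (*v) T ` int_lattice"
    using int_lattice_closed(1) by (intro image_eqI[of _ _ 0]) auto
  with elim(1) have "(\<Sum>\<^sub>\<infinity>i\<in>I. P i (B *v \<xi>) * cnj (P i (B *v (\<xi> + (2 * pi) *\<^sub>R 0)))) -
      (\<Sum>\<^sub>\<infinity>i\<in>I. P i \<xi> * cnj (P i (\<xi> + (2 * pi) *\<^sub>R 0))) = (\<Sum>j\<in>J. S j \<xi> * cnj (S j (\<xi> + (2 * pi) *\<^sub>R 0)))"
    by blast
  then have "complex_of_real (h (B *v \<xi>)) - complex_of_real (h \<xi>) = (\<Sum>j\<in>J. S j \<xi> * cnj (S j \<xi>))"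
    by (simp only: scaleR_zero_right add_0_right h_complex[OF elim(2)] h_complex[OF elim(3)])
  also have "\<dots> = complex_of_real (q \<xi>)"
    unfolding q_def of_real_sum complex_norm_square ..
  finally show ?case by (simp flip: of_real_diff)
qed

text \<open>By the refinement equation \<open>h\<close> increases along the orbit of \<open>\<xi>\<close> under \<open>B\<close>, where it tends to \<open>1\<close>.\<close>

lemma h_le_1: "AE \<xi> in lborel. h \<xi> \<le> 1"
proof -
  have "AE \<xi> in lborel. \<forall>m. h (B *v (((*v) B ^^ m) \<xi>)) = h (((*v) B ^^ m) \<xi>) + q (((*v) B ^^ m) \<xi>)"
    unfolding AE_all_countable by (intro allI AE_funpow_matrix[OF det_B h_refinement])
  with limit_zero show ?thesis
  proof eventually_elim
    case (elim \<xi>)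
    have "h (((*v) B ^^ 0) \<xi>) \<le> 1"
    proof (rule incseq_le)
      show "incseq (\<lambda>m. h (((*v) B ^^ m) \<xi>))"
        by (rule incseq_SucI) (use elim(2) q_nonneg in auto)
      show "(\<lambda>m. h (((*v) B ^^ m) \<xi>)) \<longlonglongrightarrow> 1" using elim(1) by (simp add: h_def)
    qed
    then show ?case by simp
  qed
qed

text \<open>The refinement equation telescopes along the orbit of \<open>\<xi>\<close> under \<open>T\<close>, where \<open>h\<close> tends to \<open>0\<close>.\<close>

lemma h_sums: "AE \<xi> in lborel. (\<lambda>m. q (((*v) T ^^ Suc m) \<xi>)) sums h \<xi>"
proof -
  have "AE \<xi> in lborel. \<forall>m. h (B *v (((*v) T ^^ m) \<xi>)) = h (((*v) T ^^ m) \<xi>) + q (((*v) T ^^ m) \<xi>)"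
    unfolding AE_all_countable by (intro allI AE_funpow_matrix[OF det_T h_refinement])
  with limit_infinity show ?thesis
  proof eventually_elim
    case (elim \<xi>)
    have "(\<lambda>m. h (((*v) T ^^ m) \<xi>)) \<longlonglongrightarrow> 0" using elim(1) by (simp add: h_def)
    from telescope_sums'[OF this]
    have "(\<lambda>m. h (((*v) T ^^ m) \<xi>) - h (((*v) T ^^ Suc m) \<xi>)) sums h \<xi>" by simp
    moreover have "h (((*v) T ^^ m) \<xi>) - h (((*v) T ^^ Suc m) \<xi>) = q (((*v) T ^^ Suc m) \<xi>)" for m
      using elim(2)[rule_format, of "Suc m"] BT by simp
    ultimately show ?case by simp
  qed
qed

text \<open>The sum of the squared norms is the integral of \<open>h\<close>. The \<open>m\<close>-th term of the series for \<open>h\<close> contributes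
  \<open>|det T|\<^sup>-\<^sup>m\<close> times the integral of \<open>q\<close>.\<close>

lemma P_summable: "(\<lambda>i. nrm2 lborel (P i)) summable_on I"
proof -
  have [measurable]: "P i \<in> borel_measurable borel" if "i \<in> I" for i
    using P_sq[OF that] by (simp add: sq_integrable_def)
  have [measurable]: "q \<in> borel_measurable borel" using q_integrable by auto
  define r where "r = inverse \<bar>det T\<bar>"
  have r: "0 < r" "r < 1" using abs_det_gt_1 by (simp_all add: r_def det_transpose inverse_less_1_iff)
  have int_q: "(LINT \<xi>|lborel. q (((*v) T ^^ m) \<xi>)) = r ^ m * (LINT \<xi>|lborel. q \<xi>)" for m
  proof -
    have qm: "q \<in> borel_measurable borel" by measurable
    have "(LINT \<xi>|lborel. q \<xi>) = \<bar>det T\<bar> ^ m *\<^sub>R (LINT \<xi>|lborel. q (((*v) T ^^ m) \<xi>))"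
      by (rule integral_funpow_matrix[OF det_T qm])
    then show ?thesis using det_T unfolding r_def by (simp add: power_inverse field_simps)
  qed
  have "(\<integral>\<^sup>+i. ennreal (nrm2 lborel (P i)) \<partial>count_space I) = (\<integral>\<^sup>+i. \<integral>\<^sup>+\<xi>. ennreal ((cmod (P i \<xi>))\<^sup>2) \<partial>lborel \<partial>count_space I)"
    by (rule nn_integral_cong) (simp add: nn_integral_nrm2 P_sq)
  also have "\<dots> = (\<integral>\<^sup>+\<xi>. \<integral>\<^sup>+i. ennreal ((cmod (P i \<xi>))\<^sup>2) \<partial>count_space I \<partial>lborel)"
    by (rule nn_integral_count_space_nn_integral[OF I, symmetric]) measurable
  also have "\<dots> = (\<integral>\<^sup>+\<xi>. (\<Sum>m. ennreal (q (((*v) T ^^ Suc m) \<xi>))) \<partial>lborel)"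
  proof (rule nn_integral_cong_AE)
    show "AE \<xi> in lborel. (\<integral>\<^sup>+i. ennreal ((cmod (P i \<xi>))\<^sup>2) \<partial>count_space I) = (\<Sum>m. ennreal (q (((*v) T ^^ Suc m) \<xi>)))"
      using pointwise_summable h_sums
    proof eventually_elim
      case (elim \<xi>)
      have "(\<integral>\<^sup>+i. ennreal ((cmod (P i \<xi>))\<^sup>2) \<partial>count_space I) = ennreal (h \<xi>)"
        unfolding h_def by (rule infsum_eq_nn_integral_count_space) (use elim in auto)
      also have "\<dots> = (\<Sum>m. ennreal (q (((*v) T ^^ Suc m) \<xi>)))"
        by (rule suminf_ennreal_eq[OF _ elim(2), symmetric]) (rule q_nonneg)
      finally show ?case .
    qed
  qed
  also have "\<dots> = (\<Sum>m. \<integral>\<^sup>+\<xi>. ennreal (q (((*v) T ^^ Suc m) \<xi>)) \<partial>lborel)"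
  proof (rule nn_integral_suminf)
    fix m
    have [measurable]: "((*v) T ^^ Suc m) \<in> borel_measurable borel" by (rule funpow_matrix_borel)
    show "(\<lambda>\<xi>. ennreal (q (((*v) T ^^ Suc m) \<xi>))) \<in> borel_measurable lborel" by measurable
  qed
  also have "\<dots> = (\<Sum>m. ennreal (r ^ Suc m * (LINT \<xi>|lborel. q \<xi>)))"
  proof (rule suminf_cong)
    fix m
    show "(\<integral>\<^sup>+\<xi>. ennreal (q (((*v) T ^^ Suc m) \<xi>)) \<partial>lborel) = ennreal (r ^ Suc m * (LINT \<xi>|lborel. q \<xi>))"
      unfolding int_q[symmetric]
      by (rule nn_integral_eq_integral) (intro integrable_funpow_matrix det_T q_integrable, simp add: q_nonneg)
  qed
  also have "\<dots> < \<infinity>"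
  proof -
    have "summable (\<lambda>m. r ^ m)" using r by (intro summable_geometric) auto
    then have "summable (\<lambda>m. r ^ Suc m * (LINT \<xi>|lborel. q \<xi>))"
      by (intro summable_mult2) (subst summable_Suc_iff)
    moreover have "0 \<le> (LINT \<xi>|lborel. q \<xi>)" by (simp add: q_nonneg)
    ultimately show ?thesis using r by (subst suminf_ennreal2) auto
  qed
  finally show ?thesis by (subst summable_on_iff_nn_integral_count_space) auto
qed

sublocale \<Phi>: shift_system I \<phi> P
  by unfold_locales (use I ft_\<phi> P_summable in auto)

sublocale \<Psi>: shift_system J \<psi> S
  by unfold_locales (use J ft_\<psi> in \<open>auto simp: countable_finite\<close>)

lemma T_lattice: "r \<in> int_lattice \<Longrightarrow> T *v r \<in> int_lattice"
  using integral by (rule transpose_int_lattice)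

text \<open>The inverse dilation replaces \<open>g\<close> by a multiple of \<open>g \<circ> T\<close>. After the substitution \<open>\<xi> = B \<eta>\<close> the shift by \<open>r\<close>
  has become the shift by \<open>T r\<close>, and the equation for shifts in \<open>T\<close> of the lattice applies. By the other
  equation the remaining shifts contribute nothing to the right hand side.\<close>

lemma energy_refinement:
  assumes g: "test_function g"
  shows "\<Phi>.energy (dilation (matrix_inv A) (ift g)) = \<Phi>.energy (ift g) + \<Psi>.energy (ift g)"
proof -
  let ?p = "2 * pi"
  have gm [measurable]: "g \<in> borel_measurable borel" by (rule test_function_integrable[OF g])
  obtain R where R: "finite R" "R \<subseteq> int_lattice"
    and R0: "\<And>r \<xi>. r \<in> int_lattice - R \<Longrightarrow> g \<xi> * cnj (g (\<xi> + ?p *\<^sub>R r)) = 0"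
    using finitely_many_overlaps[OF g] by metis
  \<comment> \<open>The shifts \<open>r\<close> for which the supports of \<open>g \<circ> T\<close> and of its translate can meet.\<close>
  define R1 where "R1 = {r \<in> int_lattice. T *v r \<in> R}"
  have inj: "inj ((*v) T)" by (metis BT injI)
  have R1: "finite R1" "R1 \<subseteq> int_lattice"
    using finite_vimageI[OF R(1) inj] unfolding R1_def by (auto intro: finite_subset[rotated])
  define c where "c = complex_of_real (sqrt \<bar>det A\<bar>)"
  have cc: "cnj c * c = complex_of_real \<bar>det T\<bar>" unfolding c_def det_transpose by (simp flip: of_real_mult)
  let ?g = "\<lambda>\<xi>. c * g (T *v \<xi>)"
  have tg: "test_function ?g" by (rule test_function_matrix[OF g det_T])
  have R10: "?g \<xi> * cnj (?g (\<xi> + ?p *\<^sub>R r)) = 0" if r: "r \<in> int_lattice - R1" for r \<xi>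
  proof -
    have "T *v r \<in> int_lattice - R" using r T_lattice by (auto simp: R1_def)
    from R0[OF this, of "T *v \<xi>"] show ?thesis
      by (auto simp: matrix_vector_right_distrib matrix_vector_mult_scaleR)
  qed
  define X where "X s = (LINT \<xi>|lborel. cnj (g \<xi>) * g (\<xi> + ?p *\<^sub>R s) * \<Phi>.correlation s \<xi>)" for s
  define Y where "Y s = (LINT \<xi>|lborel. cnj (g \<xi>) * g (\<xi> + ?p *\<^sub>R s) * \<Psi>.correlation s \<xi>)" for s
  have XY: "X s + Y s = (LINT \<xi>|lborel. cnj (g \<xi>) * g (\<xi> + ?p *\<^sub>R s) * (\<Phi>.correlation s \<xi> + \<Psi>.correlation s \<xi>))" for s
    unfolding X_def Y_def distrib_left
    by (rule Bochner_Integration.integral_add[symmetric]) (rule \<Phi>.correlation_integral(2)[OF g] \<Psi>.correlation_integral(2)[OF g])+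
  \<comment> \<open>The determinant of the substitution cancels the normalization of the dilation.\<close>
  have on: "(LINT \<xi>|lborel. cnj (?g \<xi>) * ?g (\<xi> + ?p *\<^sub>R r) * \<Phi>.correlation r \<xi>) = X (T *v r) + Y (T *v r)"
    if r: "r \<in> R1" for r
  proof -
    let ?f = "\<lambda>\<eta>. cnj (g \<eta>) * g (\<eta> + ?p *\<^sub>R (T *v r)) * \<Phi>.correlation r (B *v \<eta>)"
    have fm: "?f \<in> borel_measurable borel" by measurable
    have "(LINT \<xi>|lborel. cnj (?g \<xi>) * ?g (\<xi> + ?p *\<^sub>R r) * \<Phi>.correlation r \<xi>) = (LINT \<xi>|lborel. (cnj c * c) * ?f (T *v \<xi>))"
      by (intro Bochner_Integration.integral_cong)
        (auto simp: BT[unfolded transpose_matrix_vector] matrix_vector_right_distrib matrix_vector_mult_scaleR ac_simps)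
    also have "\<dots> = \<bar>det T\<bar> *\<^sub>R (LINT \<xi>|lborel. ?f (T *v \<xi>))"
      unfolding cc integral_mult_right_zero scaleR_conv_of_real ..
    also have "\<dots> = (LINT \<eta>|lborel. ?f \<eta>)" by (rule integral_lborel_matrix[OF det_T fm, symmetric])
    also have "\<dots> = (LINT \<eta>|lborel. cnj (g \<eta>) * g (\<eta> + ?p *\<^sub>R (T *v r)) * (\<Phi>.correlation (T *v r) \<eta> + \<Psi>.correlation (T *v r) \<eta>))"
    proof (rule integral_cong_AE)
      show "AE \<eta> in lborel. ?f \<eta> = cnj (g \<eta>) * g (\<eta> + ?p *\<^sub>R (T *v r)) * (\<Phi>.correlation (T *v r) \<eta> + \<Psi>.correlation (T *v r) \<eta>)"
        using on_lattice
      proof eventually_elim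
        case (elim \<eta>)
        have "T *v r \<in> (*v) T ` int_lattice" using r by (auto simp: R1_def)
        from bspec[OF elim this] have e: "(\<Sum>\<^sub>\<infinity>i\<in>I. P i (B *v \<eta>) * cnj (P i (B *v (\<eta> + ?p *\<^sub>R (T *v r)))))
            - \<Phi>.correlation (T *v r) \<eta> = \<Psi>.correlation (T *v r) \<eta>"
          unfolding \<Phi>.correlation_def \<Psi>.correlation_def infsum_finite[OF J] .
        have "B *v (\<eta> + ?p *\<^sub>R (T *v r)) = B *v \<eta> + ?p *\<^sub>R r"
          by (simp only: matrix_vector_right_distrib matrix_vector_mult_scaleR BT)
        then have "\<Phi>.correlation r (B *v \<eta>) = \<Phi>.correlation (T *v r) \<eta> + \<Psi>.correlation (T *v r) \<eta>"
          using e unfolding \<Phi>.correlation_def[of r] by (simp add: algebra_simps)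
        then show ?case by simp
      qed
    qed measurable
    finally show ?thesis unfolding XY .
  qed
  have off: "X s + Y s = 0" if s: "s \<in> int_lattice - (*v) T ` int_lattice" for s
  proof -
    have "AE \<xi> in lborel. cnj (g \<xi>) * g (\<xi> + ?p *\<^sub>R s) * (\<Phi>.correlation s \<xi> + \<Psi>.correlation s \<xi>) = 0"
      using off_lattice
    proof eventually_elim
      case (elim \<xi>)
      with s have "- \<Phi>.correlation s \<xi> = \<Psi>.correlation s \<xi>"
        unfolding \<Phi>.correlation_def \<Psi>.correlation_def using J by simp
      then show ?case by (metis add.right_inverse mult_zero_right)
    qed
    then show ?thesis unfolding XY by (rule integral_eq_zero_AE)
  qed
  have "(\<Sum>r\<in>R1. X (T *v r) + Y (T *v r)) = (\<Sum>s\<in>(*v) T ` R1. X s + Y s)"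
    using inj by (subst sum.reindex) (auto simp: inj_on_def)
  also have "\<dots> = (\<Sum>s\<in>R. X s + Y s)"
  proof (rule sum.mono_neutral_left[OF R(1)])
    show "(*v) T ` R1 \<subseteq> R" by (auto simp: R1_def)
    show "\<forall>s\<in>R - (*v) T ` R1. X s + Y s = 0"
      using R(2) by (intro ballI off) (auto simp: R1_def)
  qed
  finally have sum: "(\<Sum>r\<in>R1. X (T *v r) + Y (T *v r)) = (\<Sum>s\<in>R. X s) + (\<Sum>s\<in>R. Y s)"
    by (simp only: sum.distrib)
  have "dilation (matrix_inv A) (ift g) = ift ?g"
    unfolding c_def by (rule dilation_inv_ift[OF det_nz gm])
  then have "\<Phi>.energy (dilation (matrix_inv A) (ift g)) = inverse (?p ^ CARD('n)) * Re (\<Sum>r\<in>R1. X (T *v r) + Y (T *v r))"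
    using \<Phi>.energy_ift(2)[OF tg R1 R10] on by simp
  also have "\<dots> = inverse (?p ^ CARD('n)) * Re (\<Sum>s\<in>R. X s) + inverse (?p ^ CARD('n)) * Re (\<Sum>s\<in>R. Y s)"
    unfolding sum by (simp only: plus_complex.simps distrib_left)
  also have "\<dots> = \<Phi>.energy (ift g) + \<Psi>.energy (ift g)"
  proof -
    have "\<Phi>.energy (ift g) = inverse (?p ^ CARD('n)) * Re (\<Sum>s\<in>R. X s)"
      unfolding X_def by (rule \<Phi>.energy_ift(2)[OF g R R0])
    moreover have "\<Psi>.energy (ift g) = inverse (?p ^ CARD('n)) * Re (\<Sum>s\<in>R. Y s)"
      unfolding Y_def by (rule \<Psi>.energy_ift(2)[OF g R R0])
    ultimately show ?thesis by simp
  qed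
  finally show ?thesis .
qed

lemma funpow_dilation_ift:
  assumes g: "test_function g"
  shows "test_function (\<lambda>\<xi>. complex_of_real (sqrt \<bar>det A\<bar> ^ m) * g (((*v) T ^^ m) \<xi>))"
    and "(dilation (matrix_inv A) ^^ m) (ift g) = ift (\<lambda>\<xi>. complex_of_real (sqrt \<bar>det A\<bar> ^ m) * g (((*v) T ^^ m) \<xi>))"
proof -
  let ?g = "\<lambda>m \<xi>. complex_of_real (sqrt \<bar>det A\<bar> ^ m) * g (((*v) T ^^ m) \<xi>)"
  have step: "?g (Suc m) = (\<lambda>\<xi>. complex_of_real (sqrt \<bar>det A\<bar>) * ?g m (T *v \<xi>))" for m
    by (simp add: fun_eq_iff funpow_swap1 mult.assoc)
  show t: "test_function (?g m)" for m
  proof (induct m)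
    case 0 show ?case using g by simp
  next
    case (Suc m)
    show ?case unfolding step by (rule test_function_matrix[OF Suc det_T])
  qed
  show "(dilation (matrix_inv A) ^^ m) (ift g) = ift (?g m)"
  proof (induct m)
    case 0 show ?case by simp
  next
    case (Suc m)
    have "(dilation (matrix_inv A) ^^ Suc m) (ift g) = dilation (matrix_inv A) (ift (?g m))"
      unfolding funpow.simps o_apply Suc ..
    also have "\<dots> = ift (?g (Suc m))"
      unfolding step by (rule dilation_inv_ift[OF det_nz test_function_integrable(3)[OF t]])
    finally show ?case .
  qed
qed

lemma zpow_dilation_ift:
  assumes g: "test_function g"
  shows "\<exists>g'. test_function g' \<and> zpow (dilation A) j (ift g) = ift g'"
proof -
  have "\<exists>g'. test_function g' \<and> (dilation A ^^ m) (ift g) = ift g'" for m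
  proof (induct m)
    case 0 show ?case using g by auto
  next
    case (Suc m)
    then show ?case using dilation_ift[OF det_nz] by auto
  qed
  then show ?thesis using funpow_dilation_ift[OF g] by (auto simp: zpow_dilation[OF det_nz])
qed

text \<open>For large \<open>m\<close> only the shift \<open>0\<close> contributes to the energy, which then is the integral of
  \<open>|g \<eta>|\<^sup>2 h (B\<^sup>m \<eta>)\<close> up to normalization.\<close>

lemma energy_limit:
  assumes g: "test_function g"
  shows "(\<lambda>m. \<Phi>.energy ((dilation (matrix_inv A) ^^ m) (ift g))) \<longlonglongrightarrow> nrm2 lborel (ift g)"
proof -
  let ?N = "(2 * pi) ^ CARD('n)"
  obtain M \<rho> where gm [measurable]: "g \<in> borel_measurable borel" and \<rho>: "\<And>x. norm x > \<rho> \<Longrightarrow> g x = 0" and \<rho>0: "\<rho> > 0"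
    using test_functionE[OF g] by metis
  let ?s = "sqrt \<bar>det A\<bar>"
  let ?g = "\<lambda>m \<xi>. complex_of_real (?s ^ m) * g (((*v) T ^^ m) \<xi>)"
  define V where "V m = (LINT \<eta>|lborel. complex_of_real ((cmod (g \<eta>))\<^sup>2) * \<Phi>.correlation 0 (((*v) B ^^ m) \<eta>))" for m
  have corr: "AE \<xi> in lborel. \<Phi>.correlation 0 \<xi> = complex_of_real (h \<xi>)"
    using pointwise_summable by eventually_elim (simp add: \<Phi>.correlation_def h_complex)
  have corr_m: "AE \<eta> in lborel. \<Phi>.correlation 0 (((*v) B ^^ m) \<eta>) = complex_of_real (h (((*v) B ^^ m) \<eta>))" for m
    by (rule AE_funpow_matrix[OF det_B corr])
  have [measurable]: "(\<lambda>\<eta>. \<Phi>.correlation 0 (((*v) B ^^ m) \<eta>)) \<in> borel_measurable borel" for m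
    by (rule measurable_compose[OF funpow_matrix_borel]) measurable
  have "V \<longlonglongrightarrow> (LINT \<eta>|lborel. complex_of_real ((cmod (g \<eta>))\<^sup>2))"
    unfolding V_def[abs_def]
  proof (rule integral_dominated_convergence)
    show "integrable lborel (\<lambda>\<eta>. (cmod (g \<eta>))\<^sup>2)"
      using test_function_integrable(2)[OF g] by (simp add: sq_integrable_def)
    have "AE \<eta> in lborel. \<forall>m. \<Phi>.correlation 0 (((*v) B ^^ m) \<eta>) = complex_of_real (h (((*v) B ^^ m) \<eta>))"
      unfolding AE_all_countable by (intro allI corr_m)
    then show "AE \<eta> in lborel. (\<lambda>m. complex_of_real ((cmod (g \<eta>))\<^sup>2) * \<Phi>.correlation 0 (((*v) B ^^ m) \<eta>)) \<longlonglongrightarrow> complex_of_real ((cmod (g \<eta>))\<^sup>2)"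
      using limit_zero
    proof eventually_elim
      case (elim \<eta>)
      have "(\<lambda>m. h (((*v) B ^^ m) \<eta>)) \<longlonglongrightarrow> 1" using elim(2) by (simp add: h_def)
      then have "(\<lambda>m. complex_of_real ((cmod (g \<eta>))\<^sup>2) * complex_of_real (h (((*v) B ^^ m) \<eta>))) \<longlonglongrightarrow> complex_of_real ((cmod (g \<eta>))\<^sup>2) * complex_of_real 1"
        by (intro tendsto_intros)
      then show ?case using elim(1) by simp
    qed
    show "AE \<eta> in lborel. norm (complex_of_real ((cmod (g \<eta>))\<^sup>2) * \<Phi>.correlation 0 (((*v) B ^^ m) \<eta>)) \<le> (cmod (g \<eta>))\<^sup>2" for m
      using corr_m[of m] AE_funpow_matrix[OF det_B h_le_1, of m]
    proof eventually_elim
      case (elim \<eta>)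
      have "(cmod (g \<eta>))\<^sup>2 * h (((*v) B ^^ m) \<eta>) \<le> (cmod (g \<eta>))\<^sup>2 * 1"
        using elim(2) by (intro mult_left_mono) auto
      then show ?case unfolding elim(1) norm_mult norm_of_real using h_nonneg by simp
    qed
  qed measurable
  then have lim: "(\<lambda>m. inverse ?N * Re (V m)) \<longlonglongrightarrow> inverse ?N * Re (LINT \<eta>|lborel. complex_of_real ((cmod (g \<eta>))\<^sup>2))"
    by (intro tendsto_intros)
  have val: "inverse ?N * Re (LINT \<eta>|lborel. complex_of_real ((cmod (g \<eta>))\<^sup>2)) = nrm2 lborel (ift g)"
    unfolding integral_complex_of_real ift_nrm2[OF g] nrm2_def[of lborel g] by simp
  have ev: "\<forall>\<^sub>F m in sequentially. inverse ?N * Re (V m) = \<Phi>.energy ((dilation (matrix_inv A) ^^ m) (ift g))"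
  proof -
    have "(\<lambda>m. contraction m * \<rho>) \<longlonglongrightarrow> 0 * \<rho>" by (intro tendsto_intros contraction_tendsto)
    then have "\<forall>\<^sub>F m in sequentially. contraction m * \<rho> < 1" by (rule order_tendstoD) simp
    then show ?thesis
    proof eventually_elim
      case (elim m)
      \<comment> \<open>If the shift by \<open>T\<^sup>m r\<close> did not separate the support of \<open>g\<close> from itself, then \<open>norm (T\<^sup>m r) \<le> \<rho>\<close>, and
        applying \<open>B\<^sup>m\<close> would give \<open>norm r < 1\<close>.\<close>
      have R0: "?g m \<xi> * cnj (?g m (\<xi> + (2 * pi) *\<^sub>R r)) = 0" if r: "r \<in> int_lattice - {0}" for r \<xi>
      proof (rule ccontr)
        assume "?g m \<xi> * cnj (?g m (\<xi> + (2 * pi) *\<^sub>R r)) \<noteq> 0"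
        then have "g (((*v) T ^^ m) \<xi>) \<noteq> 0" "g (((*v) T ^^ m) (\<xi> + (2 * pi) *\<^sub>R r)) \<noteq> 0" by auto
        then have n: "norm (((*v) T ^^ m) \<xi>) \<le> \<rho>" "norm (((*v) T ^^ m) (\<xi> + (2 * pi) *\<^sub>R r)) \<le> \<rho>"
          using \<rho> by (force simp: not_less[symmetric])+
        have lin: "linear ((*v) T ^^ m)" by (rule linear_funpow) (rule matrix_vector_mul_linear)
        have "((*v) T ^^ m) (\<xi> + (2 * pi) *\<^sub>R r) - ((*v) T ^^ m) \<xi> = (2 * pi) *\<^sub>R (((*v) T ^^ m) r)"
          by (simp only: linear_add[OF lin] linear_cmul[OF lin] add_diff_cancel_left')
        then have "norm ((2 * pi) *\<^sub>R (((*v) T ^^ m) r)) \<le> 2 * \<rho>"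
          using n norm_triangle_ineq4[of "((*v) T ^^ m) (\<xi> + (2 * pi) *\<^sub>R r)" "((*v) T ^^ m) \<xi>"] by simp
        moreover have "2 * norm (((*v) T ^^ m) r) \<le> norm ((2 * pi) *\<^sub>R (((*v) T ^^ m) r))"
          using pi_gt3 by (simp add: mult_le_cancel_right1)
        ultimately have T_r: "norm (((*v) T ^^ m) r) \<le> \<rho>" by linarith
        have "1 \<le> norm r" using r by (intro norm_int_lattice_ge_1) auto
        also have "norm r = norm (((*v) B ^^ m) (((*v) T ^^ m) r))" using funpow_inverse_cancel[OF det_T] by simp
        also have "\<dots> \<le> contraction m * norm (((*v) T ^^ m) r)" by (rule inv_transpose_funpow_le)
        also have "\<dots> \<le> contraction m * \<rho>"
          by (rule mult_left_mono[OF T_r]) (simp add: contraction_def sum_nonneg)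
        finally show False using elim by simp
      qed
      let ?f = "\<lambda>\<eta>. complex_of_real ((cmod (g \<eta>))\<^sup>2) * \<Phi>.correlation 0 (((*v) B ^^ m) \<eta>)"
      have fm: "?f \<in> borel_measurable borel" by measurable
      have ss: "(?s ^ m)\<^sup>2 = \<bar>det T\<bar> ^ m"
        by (simp add: det_transpose power_mult[symmetric] mult.commute[of m]) (simp add: power_mult)
      have "\<Phi>.energy ((dilation (matrix_inv A) ^^ m) (ift g)) =
          inverse ?N * Re (LINT \<xi>|lborel. cnj (?g m \<xi>) * ?g m (\<xi> + (2 * pi) *\<^sub>R 0) * \<Phi>.correlation 0 \<xi>)"
        unfolding funpow_dilation_ift(2)[OF g]
        using \<Phi>.energy_ift(2)[OF funpow_dilation_ift(1)[OF g], of "{0}" m] R0 int_lattice_closed(1) by simp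
      also have "(LINT \<xi>|lborel. cnj (?g m \<xi>) * ?g m (\<xi> + (2 * pi) *\<^sub>R 0) * \<Phi>.correlation 0 \<xi>) =
          (LINT \<xi>|lborel. complex_of_real (\<bar>det T\<bar> ^ m) * ?f (((*v) T ^^ m) \<xi>))"
      proof (rule Bochner_Integration.integral_cong)
        fix \<xi>
        have "cnj (complex_of_real a * z) * (complex_of_real a * z) = complex_of_real (a\<^sup>2) * complex_of_real ((cmod z)\<^sup>2)" for a z
          unfolding complex_norm_square
          by (simp only: complex_cnj_mult complex_cnj_complex_of_real power2_eq_square of_real_mult ac_simps)
        then have "cnj (?g m \<xi>) * ?g m \<xi> = complex_of_real ((?s ^ m)\<^sup>2) * complex_of_real ((cmod (g (((*v) T ^^ m) \<xi>)))\<^sup>2)" .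
        then show "cnj (?g m \<xi>) * ?g m (\<xi> + (2 * pi) *\<^sub>R 0) * \<Phi>.correlation 0 \<xi> = complex_of_real (\<bar>det T\<bar> ^ m) * ?f (((*v) T ^^ m) \<xi>)"
          unfolding scaleR_zero_right add_0_right funpow_inverse_cancel[OF det_T] ss by (simp only: mult.assoc)
      qed simp
      also have "\<dots> = \<bar>det T\<bar> ^ m *\<^sub>R (LINT \<xi>|lborel. ?f (((*v) T ^^ m) \<xi>))"
        unfolding integral_mult_right_zero scaleR_conv_of_real ..
      also have "\<dots> = V m" unfolding V_def by (rule integral_funpow_matrix[OF det_T fm, symmetric])
      finally show ?case by simp
    qed
  qed
  show ?thesis using Lim_transform_eventually[OF lim ev] unfolding val .
qed

lemma energy_nonneg: "0 \<le> \<Psi>.energy u" "0 \<le> \<Phi>.energy u"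
  unfolding \<Psi>.energy_def \<Phi>.energy_def by (rule infsum_nonneg, auto)+

text \<open>The energies of the inverse dilates increase to the squared norm.\<close>

lemma energy_ift_le:
  assumes g: "test_function g"
  shows "\<Phi>.energy (ift g) \<le> nrm2 lborel (ift g)"
proof -
  have "\<Phi>.energy ((dilation (matrix_inv A) ^^ 0) (ift g)) \<le> nrm2 lborel (ift g)"
  proof (rule incseq_le[OF incseq_SucI energy_limit[OF g]])
    fix m
    show "\<Phi>.energy ((dilation (matrix_inv A) ^^ m) (ift g)) \<le> \<Phi>.energy ((dilation (matrix_inv A) ^^ Suc m) (ift g))"
      using energy_refinement[OF funpow_dilation_ift(1)[OF g, of m]] energy_nonneg(1)
      unfolding funpow_dilation_ift(2)[OF g, of m, symmetric] by simp
  qed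
  then show ?thesis by simp
qed

lemma Bessel_translates:
  assumes f: "sq_integrable lborel f" and K: "finite K" "K \<subseteq> I \<times> int_lattice"
  shows "(\<Sum>(i, k)\<in>K. (cmod (ip lborel f (translation k (\<phi> i))))\<^sup>2) \<le> nrm2 lborel f"
proof -
  have "(\<Sum>p\<in>K. (cmod (ip lborel f ((\<lambda>(i, k). translation k (\<phi> i)) p)))\<^sup>2) \<le> nrm2 lborel f"
  proof (rule Bessel_extension[where U="ift ` Collect test_function"])
    show "\<exists>u\<in>ift ` Collect test_function. nrm2 lborel (\<lambda>x. f x - u x) < e" if "e > 0" for e
      using ift_dense[OF f that] by blast
    fix u assume "u \<in> ift ` Collect (test_function :: (real^'n \<Rightarrow> complex) \<Rightarrow> bool)"
    then obtain g where g: "test_function g" "u = ift g" by auto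
    obtain R where R: "finite R" "R \<subseteq> int_lattice"
      "\<And>r \<xi>. r \<in> int_lattice - R \<Longrightarrow> g \<xi> * cnj (g (\<xi> + (2 * pi) *\<^sub>R r)) = 0" using finitely_many_overlaps[OF g(1)] by metis
    have "(\<Sum>(i, k)\<in>K. (cmod (ip lborel u (translation k (\<phi> i))))\<^sup>2) \<le> \<Phi>.energy u"
      unfolding g(2) by (rule finite_sum_le_has_sum[OF \<Phi>.energy_ift(1)[OF g(1) R]]) (use K in auto)
    also have "\<dots> \<le> nrm2 lborel u" unfolding g(2) by (rule energy_ift_le[OF g(1)])
    finally show "(\<Sum>p\<in>K. (cmod (ip lborel u ((\<lambda>(i, k). translation k (\<phi> i)) p)))\<^sup>2) \<le> nrm2 lborel u"
      by (simp add: case_prod_unfold)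
    show "sq_integrable lborel u" unfolding g(2) by (rule ift_sq_integrable[OF g(1)])
  next
    fix p assume "p \<in> K"
    then show "sq_integrable lborel ((\<lambda>(i, k). translation k (\<phi> i)) p)"
      using K \<Phi>.\<theta>_sq by (auto intro!: translation_sq_integrable)
  qed (rule f)
  then show ?thesis by (simp add: case_prod_unfold)
qed

text \<open>The mass of the translates of \<open>\<phi> i\<close> on the unit cube adds up to its mass on the whole space.\<close>

lemma translates_mass:
  "(\<integral>\<^sup>+x. indicator (cube 1) x * (\<integral>\<^sup>+p. ennreal ((cmod (translation (snd p) (\<phi> (fst p)) x))\<^sup>2) \<partial>count_space (I \<times> int_lattice)) \<partial>lborel) < \<infinity>"
proof -
  have c: "countable (I \<times> (int_lattice :: (real^'n) set))" using I countable_int_lattice by (rule countable_SIGMA)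
  have m: "\<phi> i \<in> borel_measurable borel" if "i \<in> I" for i using \<Phi>.\<theta>_sq[OF that] by (simp add: sq_integrable_def)
  interpret L: sigma_finite_measure "count_space int_lattice :: (real^'n) measure"
    by (rule sigma_finite_measure_count_space_countable[OF countable_int_lattice])
  let ?t = "\<lambda>p x. indicator (cube 1) x * ennreal ((cmod (translation (snd p) (\<phi> (fst p)) x))\<^sup>2)"
  have "(\<integral>\<^sup>+x. indicator (cube 1) x * (\<integral>\<^sup>+p. ennreal ((cmod (translation (snd p) (\<phi> (fst p)) x))\<^sup>2) \<partial>count_space (I \<times> int_lattice)) \<partial>lborel)
      = (\<integral>\<^sup>+x. \<integral>\<^sup>+p. ?t p x \<partial>count_space (I \<times> int_lattice) \<partial>lborel)"
    by (simp add: nn_integral_cmult)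
  also have "\<dots> = (\<integral>\<^sup>+p. \<integral>\<^sup>+x. ?t p x \<partial>lborel \<partial>count_space (I \<times> int_lattice))"
  proof (rule nn_integral_count_space_nn_integral[OF c])
    fix p assume "p \<in> I \<times> (int_lattice :: (real^'n) set)"
    then have [measurable]: "\<phi> (fst p) \<in> borel_measurable borel" using m by auto
    show "?t p \<in> borel_measurable lborel" unfolding translation_def by measurable
  qed
  also have "\<dots> = (\<integral>\<^sup>+i. \<integral>\<^sup>+k. \<integral>\<^sup>+x. ?t (i, k) x \<partial>lborel \<partial>count_space int_lattice \<partial>count_space I)"
    unfolding pair_measure_countable[OF I countable_int_lattice, symmetric]
    by (rule L.nn_integral_fst[symmetric]) (simp add: pair_measure_countable[OF I countable_int_lattice])
  also have "\<dots> = (\<integral>\<^sup>+i. ennreal (nrm2 lborel (\<phi> i)) \<partial>count_space I)"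
  proof (rule nn_integral_cong)
    fix i assume "i \<in> space (count_space I)"
    then have i: "i \<in> I" by simp
    note m[OF i, measurable]
    have bij: "bij_betw uminus int_lattice (int_lattice :: (real^'n) set)"
      by (rule bij_betwI[of _ _ _ uminus]) (auto intro: int_lattice_closed)
    have "(\<integral>\<^sup>+k. \<integral>\<^sup>+x. ?t (i, k) x \<partial>lborel \<partial>count_space int_lattice) =
        (\<integral>\<^sup>+k. (\<integral>\<^sup>+x. ?t (i, - k) x \<partial>lborel) \<partial>count_space int_lattice)"
      by (rule nn_integral_bij_count_space[OF bij, symmetric])
    also have "\<dots> = (\<integral>\<^sup>+x. ennreal ((cmod (\<phi> i x))\<^sup>2) \<partial>lborel)"
      by (subst nn_integral_cells[of 1]) (auto simp: translation_def)
    also have "\<dots> = ennreal (nrm2 lborel (\<phi> i))" by (rule nn_integral_nrm2[OF \<Phi>.\<theta>_sq[OF i]])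
    finally show "(\<integral>\<^sup>+k. \<integral>\<^sup>+x. ?t (i, k) x \<partial>lborel \<partial>count_space int_lattice) = ennreal (nrm2 lborel (\<phi> i))" .
  qed
  also have "\<dots> < \<infinity>"
  proof -
    have "nrm2 lborel (\<phi> i) = inverse ((2 * pi) ^ CARD('n)) * nrm2 lborel (P i)" if "i \<in> I" for i
    proof -
      have solve: "x = inverse N * y" if "y = N * x" "N \<noteq> 0" for x y N :: real using that by simp
      show ?thesis by (rule solve) (use is_ft_nrm2[OF ft_\<phi>[OF that]] in simp_all)
    qed
    then have "(\<lambda>i. nrm2 lborel (\<phi> i)) summable_on I"
      using summable_on_cmult_right[OF P_summable] by (subst summable_on_cong) auto
    then show ?thesis by (subst (asm) summable_on_iff_nn_integral_count_space) auto
  qed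
  finally show ?thesis .
qed

text \<open>For \<open>m \<rightarrow> \<infinity>\<close> the dilated truncation of \<open>f\<close> lives on a small ball around the origin, and the translates of
  the \<open>\<phi> i\<close> have little mass there; the rest of \<open>f\<close> is controlled by Bessel's inequality.\<close>

lemma energy_vanishes:
  assumes f: "sq_integrable lborel f"
  shows "(\<lambda>m. \<Phi>.energy ((dilation A ^^ m) f)) \<longlonglongrightarrow> 0"
proof (rule tendstoI)
  fix \<epsilon> :: real assume \<epsilon>: "\<epsilon> > 0"
  let ?X = "I \<times> (int_lattice :: (real^'n) set)"
  let ?e = "\<lambda>p. translation (snd p) (\<phi> (fst p))"
  have e_sq: "sq_integrable lborel (?e p)" if "p \<in> ?X" for p
    using that \<Phi>.\<theta>_sq by (auto intro!: translation_sq_integrable)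
  have c: "countable ?X" using I countable_int_lattice by (rule countable_SIGMA)
  define Q where "Q x = (\<integral>\<^sup>+p. ennreal ((cmod (?e p x))\<^sup>2) \<partial>count_space ?X)" for x
  interpret X: sigma_finite_measure "count_space ?X" by (rule sigma_finite_measure_count_space_countable[OF c])
  have Qm [measurable]: "Q \<in> borel_measurable borel"
    unfolding Q_def[abs_def]
  proof (rule X.borel_measurable_nn_integral)
    have "(\<lambda>(p, x). ennreal ((cmod (?e p x))\<^sup>2)) \<in> borel_measurable (count_space ?X \<Otimes>\<^sub>M borel)"
    proof (rule measurable_pair_measure_countable1[OF c])
      fix p assume "p \<in> ?X"
      then have [measurable]: "?e p \<in> borel_measurable borel" using e_sq[of p] by (simp add: sq_integrable_def)
      show "(\<lambda>x. case (p, x) of (p, x) \<Rightarrow> ennreal ((cmod (?e p x))\<^sup>2)) \<in> borel_measurable borel" by simp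
    qed
    then show "(\<lambda>(x, p). ennreal ((cmod (?e p x))\<^sup>2)) \<in> borel_measurable (borel \<Otimes>\<^sub>M count_space ?X)"
      by (subst measurable_pair_swap_iff) (simp add: case_prod_unfold)
  qed
  have mass: "(\<integral>\<^sup>+x. indicator (cube 1) x * Q x \<partial>lborel) < \<infinity>"
    unfolding Q_def by (rule translates_mass)
  have Qfin: "AE x in lborel. indicator (cube 1) x * Q x \<noteq> \<infinity>"
    by (rule nn_integral_PInf_AE[OF _ less_imp_neq[OF mass]]) measurable
  have "\<forall>\<^sub>F R in at_top. nrm2 lborel (\<lambda>x. f x - truncation R f x) < \<epsilon> / 8"
    by (rule order_tendstoD(2)[OF truncation_tendsto[OF f]]) (use \<epsilon> in simp)
  then have "\<forall>\<^sub>F R in at_top. nrm2 lborel (\<lambda>x. f x - truncation R f x) < \<epsilon> / 8 \<and> R > (0 :: real)"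
    by (intro eventually_conj eventually_gt_at_top)
  then obtain \<rho> where \<rho>: "nrm2 lborel (\<lambda>x. f x - truncation \<rho> f x) < \<epsilon> / 8" "\<rho> > 0"
    using eventually_happens by (metis (no_types, lifting) trivial_limit_at_top_linorder)
  \<comment> \<open>For large \<open>m\<close> the \<open>m\<close>-th dilate of \<open>v\<close> has its support in \<open>b m\<close>; that of \<open>f - v\<close> is small in norm.\<close>
  define v where "v = truncation \<rho> f"
  have v: "sq_integrable lborel v" unfolding v_def by (rule truncation_props[OF f])
  define \<delta> where "\<delta> m = contraction m * \<rho>" for m
  have \<delta>: "\<delta> \<longlonglongrightarrow> 0" unfolding \<delta>_def[abs_def] using tendsto_mult_right[OF contraction_tendsto, of \<rho>] by simp
  \<comment> \<open>The ball is kept inside the unit cube, where the total mass is finite.\<close>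
  define b :: "nat \<Rightarrow> (real^'n) set" where "b m = cball 0 (min (\<delta> m) (1 / 4))" for m
  have b_sub: "b m \<subseteq> cube 1" for m
  proof
    fix x assume x: "x \<in> b m"
    show "x \<in> cube 1"
      unfolding cube_def
    proof (rule CollectI, rule allI)
      fix i have "\<bar>x $ i\<bar> \<le> 1 / 4" using x component_le_norm_cart[of x i] by (auto simp: b_def)
      then show "- 1 / 2 \<le> x $ i \<and> x $ i < 1 / 2" by arith
    qed
  qed
  have [measurable]: "b m \<in> sets borel" for m by (simp add: b_def)
  define t where "t m = (\<integral>\<^sup>+x. indicator (b m) x * Q x \<partial>lborel)" for m
  have "t \<longlonglongrightarrow> (\<integral>\<^sup>+x. (0 :: ennreal) \<partial>(lborel :: (real^'n) measure))"
    unfolding t_def[abs_def]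
  proof (rule nn_integral_dominated_convergence[OF _ _ _ _ mass])
    show "AE x in lborel. indicator (b m) x * Q x \<le> indicator (cube 1) x * Q x" for m
      using b_sub[of m] by (intro AE_I2 mult_right_mono) (auto simp: indicator_def)
    show "AE x in lborel. (\<lambda>m. indicator (b m) x * Q x) \<longlonglongrightarrow> 0"
      using AE_lborel_singleton[of "0 :: real^'n"]
    proof eventually_elim
      case (elim x)
      have "\<forall>\<^sub>F m in sequentially. \<delta> m < norm x" by (rule order_tendstoD(2)[OF \<delta>]) (use elim in simp)
      then have "\<forall>\<^sub>F m in sequentially. indicator (b m) x * Q x = 0"
        by eventually_elim (auto simp: b_def)
      then show ?case by (rule tendsto_eventually)
    qed
  qed measurable
  then have t0: "t \<longlonglongrightarrow> ennreal 0" by simp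
  have t_fin: "t m < \<infinity>" for m
  proof -
    have "t m \<le> (\<integral>\<^sup>+x. indicator (cube 1) x * Q x \<partial>lborel)"
      unfolding t_def using b_sub[of m] by (intro nn_integral_mono mult_right_mono) (auto simp: indicator_def)
    also note mass
    finally show ?thesis .
  qed
  define t' where "t' m = enn2real (t m)" for m
  have tt: "t m = ennreal (t' m)" for m unfolding t'_def using t_fin[of m] by simp
  have "t' \<longlonglongrightarrow> 0" unfolding t'_def[abs_def] by (rule tendsto_enn2real[OF t0]) simp
  then have "(\<lambda>m. nrm2 lborel v * t' m) \<longlonglongrightarrow> nrm2 lborel v * 0" by (intro tendsto_intros)
  then have ev1: "\<forall>\<^sub>F m in sequentially. nrm2 lborel v * t' m < \<epsilon> / 8"
    by (rule order_tendstoD(2)) (use \<epsilon> in simp)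
  have ev2: "\<forall>\<^sub>F m in sequentially. \<delta> m < 1 / 4" by (rule order_tendstoD(2)[OF \<delta>]) simp
  show "\<forall>\<^sub>F m in sequentially. dist (\<Phi>.energy ((dilation A ^^ m) f)) 0 < \<epsilon>"
    using ev1 ev2
  proof eventually_elim
    case (elim m)
    let ?D = "dilation A ^^ m"
    note sqD = funpow_dilation_sq[OF det_nz]
    have supp: "?D v x = 0" if "x \<notin> b m" for x
    proof (rule ccontr)
      assume "?D v x \<noteq> 0"
      then have "truncation \<rho> f (((*v) A ^^ m) x) \<noteq> 0" by (simp add: funpow_dilation_apply v_def)
      then have "norm (((*v) A ^^ m) x) < \<rho>" by (auto simp: truncation_def indicator_def split: if_splits)
      have "norm x = norm (((*v) (matrix_inv A) ^^ m) (((*v) A ^^ m) x))"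
        using funpow_inverse_cancel[OF det_nz] by simp
      also have "\<dots> \<le> contraction m * norm (((*v) A ^^ m) x)" by (rule inv_funpow_le)
      also have "\<dots> \<le> \<delta> m" unfolding \<delta>_def
        using \<open>norm (((*v) A ^^ m) x) < \<rho>\<close> by (intro mult_left_mono) (auto simp: contraction_def sum_nonneg)
      finally show False using that elim(2) by (simp add: b_def)
    qed
    have local: "(\<Sum>p\<in>K. (cmod (ip lborel (?D v) (?e p)))\<^sup>2) \<le> nrm2 lborel v * t' m"
      if K: "finite K" "K \<subseteq> ?X" for K
    proof -
      let ?be = "\<lambda>p x. indicator (b m) x * ?e p x"
      have be: "sq_integrable lborel (?be p)" if "p \<in> ?X" for p
        by (rule sq_integrable_indicator[OF e_sq[OF that]]) simp
      have one: "(cmod (ip lborel (?D v) (?e p)))\<^sup>2 \<le> nrm2 lborel v * nrm2 lborel (?be p)" if "p \<in> ?X" for p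
      proof -
        have "ip lborel (?D v) (?e p) = ip lborel (?D v) (?be p)"
          unfolding ip_def by (intro Bochner_Integration.integral_cong) (use supp in \<open>auto simp: indicator_def\<close>)
        then show ?thesis
          using Cauchy_Schwarz_ip[OF sqD[OF v, of m] be[OF that]] funpow_dilation_nrm2[OF det_nz v, of m] by simp
      qed
      have "ennreal (\<Sum>p\<in>K. nrm2 lborel (?be p)) = (\<Sum>p\<in>K. ennreal (nrm2 lborel (?be p)))"
        by (rule sum_ennreal[symmetric]) simp
      also have "\<dots> = (\<Sum>p\<in>K. \<integral>\<^sup>+x. ennreal ((cmod (?be p x))\<^sup>2) \<partial>lborel)"
        by (rule sum.cong) (use K be in \<open>auto simp: nn_integral_nrm2 subset_iff\<close>)
      also have "\<dots> = (\<integral>\<^sup>+x. (\<Sum>p\<in>K. ennreal ((cmod (?be p x))\<^sup>2)) \<partial>lborel)"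
      proof (rule nn_integral_sum[symmetric])
        fix p assume "p \<in> K"
        then have "?be p \<in> borel_measurable lborel" using be[of p] K by (auto simp: sq_integrable_def)
        then show "(\<lambda>x. ennreal ((cmod (?be p x))\<^sup>2)) \<in> borel_measurable lborel" by measurable
      qed
      also have "\<dots> \<le> t m"
        unfolding t_def
      proof (rule nn_integral_mono)
        fix x
        have "(\<Sum>p\<in>K. ennreal ((cmod (?be p x))\<^sup>2)) = indicator (b m) x * (\<Sum>p\<in>K. ennreal ((cmod (?e p x))\<^sup>2))"
          by (simp add: indicator_def)
        also have "\<dots> \<le> indicator (b m) x * Q x"
          unfolding Q_def by (intro mult_left_mono sum_le_nn_integral_count_space K) simp
        finally show "(\<Sum>p\<in>K. ennreal ((cmod (?be p x))\<^sup>2)) \<le> indicator (b m) x * Q x" .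
      qed
      finally have "ennreal (\<Sum>p\<in>K. nrm2 lborel (?be p)) \<le> ennreal (t' m)" unfolding tt .
      moreover have "0 \<le> t' m" by (simp add: t'_def)
      ultimately have s: "(\<Sum>p\<in>K. nrm2 lborel (?be p)) \<le> t' m" by simp
      have "(\<Sum>p\<in>K. (cmod (ip lborel (?D v) (?e p)))\<^sup>2) \<le> (\<Sum>p\<in>K. nrm2 lborel v * nrm2 lborel (?be p))"
        by (rule sum_mono) (use one K in auto)
      also have "\<dots> \<le> nrm2 lborel v * t' m"
        unfolding sum_distrib_left[symmetric] by (rule mult_left_mono[OF s]) simp
      finally show ?thesis .
    qed
    let ?w = "\<lambda>x. f x - v x"
    have w: "sq_integrable lborel ?w" by (rule sq_integrable_diff[OF f v])
    have rest: "(\<Sum>p\<in>K. (cmod (ip lborel (?D ?w) (?e p)))\<^sup>2) \<le> \<epsilon> / 8" if K: "finite K" "K \<subseteq> ?X" for K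
    proof -
      have "(\<Sum>(i, k)\<in>K. (cmod (ip lborel (?D ?w) (translation k (\<phi> i))))\<^sup>2) \<le> nrm2 lborel (?D ?w)"
        by (rule Bessel_translates[OF sqD[OF w] K])
      also have "\<dots> = nrm2 lborel ?w" by (rule funpow_dilation_nrm2[OF det_nz w])
      also have "\<dots> \<le> \<epsilon> / 8" using \<rho>(1) by (simp add: v_def)
      finally show ?thesis by (simp add: case_prod_unfold)
    qed
    have "(\<Sum>p\<in>K. (cmod (ip lborel (?D f) (?e p)))\<^sup>2) \<le> \<epsilon> / 2" if K: "finite K" "K \<subseteq> ?X" for K
    proof -
      have "(cmod (ip lborel (?D f) (?e p)))\<^sup>2 \<le> 2 * (cmod (ip lborel (?D v) (?e p)))\<^sup>2 + 2 * (cmod (ip lborel (?D ?w) (?e p)))\<^sup>2"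
        if "p \<in> K" for p
      proof -
        have ep: "sq_integrable lborel (?e p)" using e_sq that K by auto
        have "ip lborel (?D ?w) (?e p) = ip lborel (?D f) (?e p) - ip lborel (?D v) (?e p)"
          unfolding funpow_dilation_diff by (rule ip_diff_left[OF sqD[OF f] sqD[OF v] ep])
        then have eq: "ip lborel (?D f) (?e p) = ip lborel (?D v) (?e p) + ip lborel (?D ?w) (?e p)" by simp
        have sq: "(cmod (z + y))\<^sup>2 \<le> 2 * (cmod z)\<^sup>2 + 2 * (cmod y)\<^sup>2" for z y
        proof -
          have "(cmod (z + y))\<^sup>2 \<le> (cmod z + cmod y)\<^sup>2" by (intro power_mono norm_triangle_ineq) auto
          also have "\<dots> \<le> 2 * (cmod z)\<^sup>2 + 2 * (cmod y)\<^sup>2"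
            using sum_squares_bound[of "cmod z" "cmod y"] by (simp add: power2_sum)
          finally show ?thesis .
        qed
        show ?thesis unfolding eq by (rule sq)
      qed
      then have "(\<Sum>p\<in>K. (cmod (ip lborel (?D f) (?e p)))\<^sup>2) \<le>
          (\<Sum>p\<in>K. 2 * (cmod (ip lborel (?D v) (?e p)))\<^sup>2 + 2 * (cmod (ip lborel (?D ?w) (?e p)))\<^sup>2)"
        by (rule sum_mono)
      also have "\<dots> = 2 * (\<Sum>p\<in>K. (cmod (ip lborel (?D v) (?e p)))\<^sup>2) + 2 * (\<Sum>p\<in>K. (cmod (ip lborel (?D ?w) (?e p)))\<^sup>2)"
        by (simp add: sum.distrib sum_distrib_left)
      also have "\<dots> \<le> 2 * (\<epsilon> / 8) + 2 * (\<epsilon> / 8)"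
        using local[OF K] rest[OF K] elim(1) by (intro add_mono mult_left_mono) auto
      finally show ?thesis by simp
    qed
    then have "infsum (\<lambda>p. (cmod (ip lborel (?D f) (?e p)))\<^sup>2) ?X \<le> \<epsilon> / 2"
      by (intro summable_on_bounded_sums(2)) auto
    then have "\<Phi>.energy (?D f) \<le> \<epsilon> / 2" unfolding \<Phi>.energy_def by (simp add: case_prod_unfold)
    then show ?case using energy_nonneg(2)[of "?D f"] \<epsilon> by simp
  qed
qed

text \<open>For \<open>u\<close> in the dense set the inner products at scale \<open>j\<close> are those of \<open>w j = D\<^sup>-\<^sup>j u\<close> with the translates. Their
  squares sum to the energy of \<open>w j\<close> with respect to \<open>\<psi>\<close>, the \<open>j\<close>-th term of a telescoping series.\<close>

lemma tight_frame:
  assumes f: "sq_integrable lborel f"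
  shows "((\<lambda>(j, k, i). (cmod (ip lborel f (zpow (dilation A) j (translation k (\<psi> i)))))\<^sup>2) has_sum nrm2 lborel f)
    (UNIV \<times> int_lattice \<times> J)"
proof -
  let ?e = "\<lambda>(j, k, i). zpow (dilation A) j (translation k (\<psi> i))"
  let ?U = "ift ` Collect (test_function :: (real^'n \<Rightarrow> complex) \<Rightarrow> bool)"
  have \<psi>_sq: "sq_integrable lborel (translation k (\<psi> i))" if "i \<in> J" for k i
    using \<Psi>.\<theta>_sq[OF that] by (rule translation_sq_integrable)
  have "((\<lambda>p. (cmod (ip lborel f (?e p)))\<^sup>2) has_sum nrm2 lborel f) (UNIV \<times> int_lattice \<times> J)"
  proof (rule tight_frame_extension[OF _ f, where U="?U"])
    show "\<exists>u\<in>?U. nrm2 lborel (\<lambda>x. f x - u x) < e" if "sq_integrable lborel f" "e > 0" for f e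
      using ift_dense[OF that] by blast
    show "sq_integrable lborel u" if "u \<in> ?U" for u using that ift_sq_integrable by auto
    show "sq_integrable lborel (?e p)" if "p \<in> UNIV \<times> int_lattice \<times> J" for p
      using that \<psi>_sq by (auto intro!: zpow_dilation_sq[OF det_nz])
    fix u assume "u \<in> ?U"
    then obtain g where g: "test_function g" and u: "u = ift g" by auto
    have u_sq: "sq_integrable lborel u" unfolding u by (rule ift_sq_integrable[OF g])
    define w where "w j = zpow (dilation A) (- j) u" for j
    have w_test: "\<exists>g'. test_function g' \<and> w j = ift g'" for j
      unfolding w_def u by (rule zpow_dilation_ift[OF g])
    have sum: "((\<lambda>j. \<Psi>.energy (w j)) has_sum nrm2 lborel u) UNIV"
    proof (rule has_sum_telescoping_int[where a="\<lambda>j. \<Phi>.energy (w j)"])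
      fix j
      obtain g' where g': "test_function g'" "w j = ift g'" using w_test by blast
      have "w (j + 1) = dilation (matrix_inv A) (w j)"
        unfolding w_def by (rule zpow_dilation_step[OF det_nz])
      then show "\<Phi>.energy (w (j + 1)) = \<Phi>.energy (w j) + \<Psi>.energy (w j)"
        using energy_refinement[OF g'(1)] by (simp add: g'(2))
      show "0 \<le> \<Psi>.energy (w j)" by (rule energy_nonneg)
    next
      have "w (int m) = (dilation (matrix_inv A) ^^ m) (ift g)" for m
        unfolding w_def u by (cases "m = 0") (auto simp: zpow_dilation[OF det_nz])
      then show "(\<lambda>m. \<Phi>.energy (w (int m))) \<longlonglongrightarrow> nrm2 lborel u"
        using energy_limit[OF g] by (simp add: u)
      have "w (- int m) = (dilation A ^^ m) u" for m
        unfolding w_def by (simp add: zpow_dilation[OF det_nz])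
      then show "(\<lambda>m. \<Phi>.energy (w (- int m))) \<longlonglongrightarrow> 0" using energy_vanishes[OF u_sq] by simp
    qed
    have per: "((\<lambda>p. (cmod (ip lborel u (?e (j, p))))\<^sup>2) has_sum \<Psi>.energy (w j)) (int_lattice \<times> J)" for j
    proof -
      obtain g' where g': "test_function g'" "w j = ift g'" using w_test by blast
      obtain R where R: "finite R" "R \<subseteq> int_lattice"
        "\<And>r \<xi>. r \<in> int_lattice - R \<Longrightarrow> g' \<xi> * cnj (g' (\<xi> + (2 * pi) *\<^sub>R r)) = 0" using finitely_many_overlaps[OF g'(1)] by metis
      have "((\<lambda>(i, k). (cmod (ip lborel (w j) (translation k (\<psi> i))))\<^sup>2) has_sum \<Psi>.energy (w j)) (J \<times> int_lattice)"
        unfolding g'(2) by (rule \<Psi>.energy_ift(1)[OF g'(1) R])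
      then have "((\<lambda>(k, i). (cmod (ip lborel (w j) (translation k (\<psi> i))))\<^sup>2) has_sum \<Psi>.energy (w j)) (int_lattice \<times> J)"
        by (subst has_sum_swap) simp
      then show ?thesis
      proof (rule has_sum_cong[THEN iffD1, rotated])
        fix p assume "p \<in> (int_lattice :: (real^'n) set) \<times> J"
        then obtain k i where p: "p = (k, i)" "i \<in> J" by auto
        have "ip lborel u (zpow (dilation A) j (translation k (\<psi> i))) = ip lborel (w j) (translation k (\<psi> i))"
          unfolding w_def by (rule zpow_dilation_adjoint[OF det_nz u_sq \<psi>_sq[OF p(2)]])
        then show "(case p of (k, i) \<Rightarrow> (cmod (ip lborel (w j) (translation k (\<psi> i))))\<^sup>2) = (cmod (ip lborel u (?e (j, p))))\<^sup>2"
          by (simp add: p)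
      qed
    qed
    have sm: "(\<lambda>p. (cmod (ip lborel u (?e p)))\<^sup>2) summable_on (UNIV \<times> int_lattice \<times> J)"
      by (rule summable_on_SigmaI[OF per]) (use sum in \<open>auto simp: summable_on_def\<close>)
    show "((\<lambda>p. (cmod (ip lborel u (?e p)))\<^sup>2) has_sum nrm2 lborel u) (UNIV \<times> int_lattice \<times> J)"
      by (rule has_sum_SigmaI[OF per sum sm])
  qed
  then show ?thesis by (simp add: case_prod_unfold)
qed

end

section \<open>Borel representatives\<close>

text \<open>The preceding results concern Borel functions. Every Lebesgue measurable function agrees almost everywhere with
  one, and \<open>L2\<close>, \<open>l2_norm\<close>, \<open>l2_inner\<close> and the condition defining \<open>fourier\<close> do not distinguish the two.\<close>

lemma lebesgue_borel_representative:
  fixes f :: "'a::euclidean_space \<Rightarrow> complex"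
  assumes f: "f \<in> borel_measurable lebesgue"
  obtains f' where "f' \<in> borel_measurable borel" "AE x in lborel. f x = f' x"
proof -
  have m: "(\<lambda>x. Re (f x)) \<in> borel_measurable lebesgue" "(\<lambda>x. Im (f x)) \<in> borel_measurable lebesgue"
    using f by measurable
  obtain a where a: "a \<in> borel_measurable lborel" "AE x in lborel. Re (f x) = a x"
    using completion_ex_borel_measurable_real[OF m(1)] by blast
  obtain b where b: "b \<in> borel_measurable lborel" "AE x in lborel. Im (f x) = b x"
    using completion_ex_borel_measurable_real[OF m(2)] by blast
  show ?thesis
  proof (rule that[of "\<lambda>x. Complex (a x) (b x)"])
    have "(\<lambda>x. complex_of_real (a x) + \<i> * complex_of_real (b x)) \<in> borel_measurable borel"
      using a(1) b(1) by simp
    then show "(\<lambda>x. Complex (a x) (b x)) \<in> borel_measurable borel" by (simp only: Complex_eq)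
    show "AE x in lborel. f x = Complex (a x) (b x)"
      using a(2) b(2) by eventually_elim (simp add: complex_eq_iff)
  qed
qed

lemma lebesgue_measurable_if_AE_borel:
  fixes f :: "'a::euclidean_space \<Rightarrow> complex"
  assumes "f' \<in> borel_measurable borel" "AE x in lborel. f x = f' x"
  shows "f \<in> borel_measurable lebesgue"
proof (rule borel_measurable_AE)
  show "f' \<in> borel_measurable lebesgue" using assms(1) by (simp add: measurable_completion)
  show "AE x in lebesgue. f' x = f x"
    unfolding AE_completion_iff using assms(2) by eventually_elim simp
qed

lemma lebesgue_integral_eq_lborel:
  fixes f :: "'a::euclidean_space \<Rightarrow> 'b::{banach, second_countable_topology}"
  assumes "f \<in> borel_measurable lebesgue" "f' \<in> borel_measurable borel" "AE x in lborel. f x = f' x"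
  shows "integral\<^sup>L lebesgue f = integral\<^sup>L lborel f'"
    and "integrable lebesgue f \<longleftrightarrow> integrable lborel f'"
proof -
  have f': "f' \<in> borel_measurable lebesgue" "f' \<in> borel_measurable lborel"
    using assms(2) by (simp_all add: measurable_completion)
  have ae: "AE x in lebesgue. f x = f' x" using assms(3) unfolding AE_completion_iff .
  show "integral\<^sup>L lebesgue f = integral\<^sup>L lborel f'"
    using integral_cong_AE[OF assms(1) f'(1) ae] integral_completion[OF f'(2)] by simp
  show "integrable lebesgue f \<longleftrightarrow> integrable lborel f'"
    using integrable_cong_AE[OF assms(1) f'(1) ae] integrable_completion[OF f'(2)] by simp
qed

lemma L2_iff_sq_integrable:
  assumes f': "f' \<in> borel_measurable borel" and ae: "AE x in lborel. f x = f' x"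
  shows "f \<in> L2 \<longleftrightarrow> sq_integrable lborel f'" and "(l2_norm f)\<^sup>2 = nrm2 lborel f'"
proof -
  have f: "f \<in> borel_measurable lebesgue" by (rule lebesgue_measurable_if_AE_borel[OF assms])
  have m: "(\<lambda>x. (cmod (f x))\<^sup>2) \<in> borel_measurable lebesgue" "(\<lambda>x. (cmod (f' x))\<^sup>2) \<in> borel_measurable borel"
    using f f' by measurable
  have ae2: "AE x in lborel. (cmod (f x))\<^sup>2 = (cmod (f' x))\<^sup>2" using ae by eventually_elim simp
  note eq = lebesgue_integral_eq_lborel[OF m ae2]
  show "f \<in> L2 \<longleftrightarrow> sq_integrable lborel f'" using f f' eq(2) by (simp add: L2_def sq_integrable_def)
  show "(l2_norm f)\<^sup>2 = nrm2 lborel f'" unfolding l2_norm_def nrm2_def by (simp add: eq(1))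
qed

lemma L2_representative:
  assumes "f \<in> L2"
  obtains f' where "sq_integrable lborel f'" "AE x in lborel. f x = f' x"
proof -
  have "f \<in> borel_measurable lebesgue" using assms by (simp add: L2_def)
  then obtain f' where f': "f' \<in> borel_measurable borel" "AE x in lborel. f x = f' x"
    by (rule lebesgue_borel_representative)
  have "sq_integrable lborel f'" using L2_iff_sq_integrable(1)[OF f'] assms by simp
  from that[OF this f'(2)] show ?thesis .
qed

lemma l2_inner_eq_ip:
  assumes f': "sq_integrable lborel f'" "AE x in lborel. f x = f' x"
    and g': "sq_integrable lborel g'" "AE x in lborel. g x = g' x"
  shows "l2_inner f g = ip lborel f' g'"
  unfolding l2_inner_def ip_def
proof (rule lebesgue_integral_eq_lborel(1))
  have b: "f' \<in> borel_measurable borel" "g' \<in> borel_measurable borel"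
    using f' g' by (auto simp: sq_integrable_def)
  have "f \<in> borel_measurable lebesgue" "g \<in> borel_measurable lebesgue"
    using lebesgue_measurable_if_AE_borel[OF b(1) f'(2)] lebesgue_measurable_if_AE_borel[OF b(2) g'(2)] .
  then show "(\<lambda>x. f x * cnj (g x)) \<in> borel_measurable lebesgue" by measurable
  show "(\<lambda>x. f' x * cnj (g' x)) \<in> borel_measurable borel" using b by measurable
  show "AE x in lborel. f x * cnj (g x) = f' x * cnj (g' x)" using f'(2) g'(2) by eventually_elim simp
qed

text \<open>The condition that defines \<open>fourier f\<close> only involves integrals, so it can be stated for Borel representatives,
  where it becomes \<open>is_ft\<close>. It is satisfiable by \<open>is_ft_exists\<close>, so the chosen function satisfies it.\<close>

lemma fourier_representative:
  assumes f': "sq_integrable lborel f'" "AE x in lborel. f x = f' x"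
  obtains G where "is_ft f' G" "AE \<xi> in lborel. fourier f \<xi> = G \<xi>"
proof -
  have [measurable]: "f' \<in> borel_measurable borel" using f' by (simp add: sq_integrable_def)
  have f: "f \<in> borel_measurable lebesgue" by (rule lebesgue_measurable_if_AE_borel[OF _ f'(2)]) measurable
  have trunc: "fourier_L1 (\<lambda>x. indicator (ball 0 R) x * f x) \<xi> = ft (truncation R f') \<xi>" for R \<xi>
    unfolding fourier_L1_def ft_def
  proof (rule lebesgue_integral_eq_lborel(1))
    have [measurable]: "(\<lambda>x. indicator (ball 0 R) x :: complex) \<in> borel_measurable lebesgue"
      by (rule measurable_completion, rule borel_measurable_indicator) simp
    have [measurable]: "(\<lambda>x. exp (- (\<i> * complex_of_real (x \<bullet> \<xi>)))) \<in> borel_measurable lebesgue"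
      by (rule measurable_completion, unfold measurable_lborel2) (intro borel_measurable_continuous_onI continuous_intros)
    show "(\<lambda>x. indicator (ball 0 R) x * f x * exp (- (\<i> * complex_of_real (x \<bullet> \<xi>)))) \<in> borel_measurable lebesgue"
      using f by measurable
    have [measurable]: "truncation R f' \<in> borel_measurable borel" by (rule truncation_props(3)[OF f'(1)])
    show "(\<lambda>x. truncation R f' x * cis (- (x \<bullet> \<xi>))) \<in> borel_measurable borel"
      by measurable
    show "AE x in lborel. indicator (ball 0 R) x * f x * exp (- (\<i> * complex_of_real (x \<bullet> \<xi>))) = truncation R f' x * cis (- (x \<bullet> \<xi>))"
      using f'(2) by eventually_elim (simp add: truncation_def cis_conv_exp)
  qed
  let ?spec = "\<lambda>g. g \<in> L2 \<and> ((\<lambda>R::real. \<integral>\<^sup>+ \<xi>. ennreal ((cmod (fourier_L1 (\<lambda>x. indicator (ball 0 R) x * f x) \<xi> - g \<xi>))\<^sup>2)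
        \<partial>lebesgue) \<longlongrightarrow> 0) at_top"
  have nn: "(\<integral>\<^sup>+ \<xi>. ennreal ((cmod (fourier_L1 (\<lambda>x. indicator (ball 0 R) x * f x) \<xi> - g \<xi>))\<^sup>2) \<partial>lebesgue) =
      ennreal (nrm2 lborel (\<lambda>\<xi>. ft (truncation R f') \<xi> - G \<xi>))"
    if G: "sq_integrable lborel G" and ae: "AE \<xi> in lborel. g \<xi> = G \<xi>" for R g G
  proof -
    have "(\<integral>\<^sup>+ \<xi>. ennreal ((cmod (fourier_L1 (\<lambda>x. indicator (ball 0 R) x * f x) \<xi> - g \<xi>))\<^sup>2) \<partial>lebesgue) =
        (\<integral>\<^sup>+ \<xi>. ennreal ((cmod (ft (truncation R f') \<xi> - G \<xi>))\<^sup>2) \<partial>lborel)"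
      unfolding nn_integral_completion trunc
      by (rule nn_integral_cong_AE) (use ae in \<open>auto elim: eventually_mono\<close>)
    also have "\<dots> = ennreal (nrm2 lborel (\<lambda>\<xi>. ft (truncation R f') \<xi> - G \<xi>))"
      by (intro nn_integral_nrm2 sq_integrable_diff plancherel_truncation_diff(1) f' G)
    finally show ?thesis .
  qed
  obtain G0 where G0: "is_ft f' G0" using is_ft_exists[OF f'(1)] by blast
  have G0_sq: "sq_integrable lborel G0" using G0 by (simp add: is_ft_def)
  have "?spec G0"
  proof
    show "G0 \<in> L2"
      using L2_iff_sq_integrable(1)[of G0 G0] G0_sq by (simp add: sq_integrable_def)
    have "((\<lambda>R. ennreal (nrm2 lborel (\<lambda>\<xi>. ft (truncation R f') \<xi> - G0 \<xi>))) \<longlongrightarrow> ennreal 0) at_top"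
      using G0 by (intro tendsto_ennrealI) (simp add: is_ft_def)
    then show "((\<lambda>R::real. \<integral>\<^sup>+ \<xi>. ennreal ((cmod (fourier_L1 (\<lambda>x. indicator (ball 0 R) x * f x) \<xi> - G0 \<xi>))\<^sup>2)
        \<partial>lebesgue) \<longlongrightarrow> 0) at_top"
      by (subst nn[OF G0_sq]) auto
  qed
  then have spec: "?spec (fourier f)" unfolding fourier_def by (rule someI[where P="?spec"])
  obtain G where G: "sq_integrable lborel G" "AE \<xi> in lborel. fourier f \<xi> = G \<xi>"
    using L2_representative[OF spec[THEN conjunct1]] .
  have "((\<lambda>R. ennreal (nrm2 lborel (\<lambda>\<xi>. ft (truncation R f') \<xi> - G \<xi>))) \<longlongrightarrow> ennreal 0) at_top"
    using spec unfolding nn[OF G] by simp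
  then have "((\<lambda>R. nrm2 lborel (\<lambda>\<xi>. ft (truncation R f') \<xi> - G \<xi>)) \<longlongrightarrow> 0) at_top"
    by (subst (asm) tendsto_ennreal_iff) auto
  then show ?thesis using that[OF _ G(2)] f' G(1) by (auto simp: is_ft_def)
qed

lemma AE_funpow_dilation:
  fixes B :: "real^'n^'n"
  assumes B: "det B \<noteq> 0" and ae: "AE x in lborel. f x = g x"
  shows "AE x in lborel. (dilation B ^^ m) f x = (dilation B ^^ m) g x"
  using AE_funpow_matrix[OF B ae, of m] unfolding funpow_dilation_apply by eventually_elim simp

lemma AE_zpow_dilation_translation:
  fixes B :: "real^'n^'n"
  assumes B: "det B \<noteq> 0" and ae: "AE x in lborel. f x = g x"
  shows "AE x in lborel. zpow (dilation B) j (translation k f) x = zpow (dilation B) j (translation k g) x"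
proof -
  have "AE x in lborel. translation k f x = translation k g x"
    using AE_lborel_translate[OF ae, of "- k"] by (simp add: translation_def)
  from AE_funpow_dilation[OF B this] AE_funpow_dilation[OF _ this, of "matrix_inv B"] B
  show ?thesis by (simp add: zpow_dilation[OF B] det_matrix_inv)
qed

theorem theorem3p5:
  fixes A :: "real^'n^'n"
    and \<Phi> \<Psi> :: "(real^'n \<Rightarrow> complex) set"
  assumes expansive: "\<And>\<mu>. \<mu> \<in> eigenvalues A \<Longrightarrow> cmod \<mu> > 1"
    and integral: "(*v) A ` int_lattice \<subseteq> int_lattice"
    and Phi: "\<Phi> \<subseteq> L2" "countable \<Phi>"
    and Psi: "\<Psi> \<subseteq> L2" "finite \<Psi>"
    and summable: "AE \<xi> in lebesgue. (\<lambda>\<phi>. (cmod (fourier \<phi> \<xi>))\<^sup>2) summable_on \<Phi>"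
    and off_lattice: "AE \<xi> in lebesgue. \<forall>s \<in> int_lattice - (*v) (transpose A) ` int_lattice.
        - (\<Sum>\<^sub>\<infinity>\<phi>\<in>\<Phi>. fourier \<phi> \<xi> * cnj (fourier \<phi> (\<xi> + (2 * pi) *\<^sub>R s)))
        = (\<Sum>\<psi>\<in>\<Psi>. fourier \<psi> \<xi> * cnj (fourier \<psi> (\<xi> + (2 * pi) *\<^sub>R s)))"
    and on_lattice: "AE \<xi> in lebesgue. \<forall>s \<in> (*v) (transpose A) ` int_lattice.
        (\<Sum>\<^sub>\<infinity>\<phi>\<in>\<Phi>. fourier \<phi> (matrix_inv (transpose A) *v \<xi>)
                * cnj (fourier \<phi> (matrix_inv (transpose A) *v (\<xi> + (2 * pi) *\<^sub>R s))))
        - (\<Sum>\<^sub>\<infinity>\<phi>\<in>\<Phi>. fourier \<phi> \<xi> * cnj (fourier \<phi> (\<xi> + (2 * pi) *\<^sub>R s)))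
        = (\<Sum>\<psi>\<in>\<Psi>. fourier \<psi> \<xi> * cnj (fourier \<psi> (\<xi> + (2 * pi) *\<^sub>R s)))"
    and limit_infinity: "AE \<xi> in lebesgue.
        (\<lambda>J. \<Sum>\<^sub>\<infinity>\<phi>\<in>\<Phi>. (cmod (fourier \<phi> (((*v) (transpose A) ^^ J) \<xi>)))\<^sup>2) \<longlonglongrightarrow> 0"
    and limit_zero: "AE \<xi> in lebesgue.
        (\<lambda>J. \<Sum>\<^sub>\<infinity>\<phi>\<in>\<Phi>. (cmod (fourier \<phi> (((*v) (matrix_inv (transpose A)) ^^ J) \<xi>)))\<^sup>2) \<longlonglongrightarrow> 1"
  shows "normalized_tight_frame (UNIV \<times> int_lattice \<times> \<Psi>)
           (\<lambda>(j, k, \<psi>). zpow (dilation A) j (translation k \<psi>))"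
proof -
  interpret E: expansive_matrix A by unfold_locales (rule expansive)
  let ?T = "transpose A" and ?B = "matrix_inv (transpose A)"
  have det_T: "det ?T \<noteq> 0" and det_B: "det ?B \<noteq> 0"
    using E.det_nz by (simp_all add: det_transpose det_matrix_inv)
  have "\<exists>f' G. sq_integrable lborel f' \<and> (AE x in lborel. f x = f' x) \<and> is_ft f' G \<and> (AE \<xi> in lborel. fourier f \<xi> = G \<xi>)"
    if "f \<in> \<Phi> \<union> \<Psi>" for f
  proof -
    have "f \<in> L2" using that Phi Psi by auto
    then obtain f' where f': "sq_integrable lborel f'" "AE x in lborel. f x = f' x" by (rule L2_representative)
    from fourier_representative[OF this] obtain G where "is_ft f' G" "AE \<xi> in lborel. fourier f \<xi> = G \<xi>" .
    with f' show ?thesis by blast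
  qed
  then have "\<forall>f\<in>\<Phi> \<union> \<Psi>. \<exists>f' G. sq_integrable lborel f' \<and> (AE x in lborel. f x = f' x) \<and> is_ft f' G \<and> (AE \<xi> in lborel. fourier f \<xi> = G \<xi>)"
    by blast
  from bchoice[OF this] obtain r where "\<forall>f\<in>\<Phi> \<union> \<Psi>. \<exists>G. sq_integrable lborel (r f) \<and> (AE x in lborel. f x = r f x) \<and> is_ft (r f) G \<and> (AE \<xi> in lborel. fourier f \<xi> = G \<xi>)"
    ..
  from bchoice[OF this] obtain G where "\<forall>f\<in>\<Phi> \<union> \<Psi>. sq_integrable lborel (r f) \<and> (AE x in lborel. f x = r f x) \<and> is_ft (r f) (G f) \<and> (AE \<xi> in lborel. fourier f \<xi> = G f \<xi>)"
    ..
  then have r: "\<And>f. f \<in> \<Phi> \<union> \<Psi> \<Longrightarrow> sq_integrable lborel (r f)"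
    "\<And>f. f \<in> \<Phi> \<union> \<Psi> \<Longrightarrow> AE x in lborel. f x = r f x"
    and G: "\<And>f. f \<in> \<Phi> \<union> \<Psi> \<Longrightarrow> is_ft (r f) (G f)"
    "\<And>f. f \<in> \<Phi> \<union> \<Psi> \<Longrightarrow> AE \<xi> in lborel. fourier f \<xi> = G f \<xi>"
    by blast+
  \<comment> \<open>The points at which all transforms agree with their representatives. Countability of \<open>\<Phi>\<close> makes their
    complement a null set, and so are its preimages under countably many shifts and matrices.\<close>
  define eq where "eq \<xi> \<longleftrightarrow> (\<forall>f\<in>\<Phi> \<union> \<Psi>. fourier f \<xi> = G f \<xi>)" for \<xi>
  have eq: "AE \<xi> in lborel. eq \<xi>"
    unfolding eq_def by (rule AE_ball_countable') (use G Phi Psi in \<open>auto simp: countable_finite\<close>)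
  have eq_B: "AE \<xi> in lborel. eq (?B *v \<xi>)" by (rule AE_lborel_matrix[OF det_B eq])
  have shifts: "AE \<xi> in lborel. \<forall>s\<in>int_lattice. Q (\<xi> + (2 * pi) *\<^sub>R s)" if "AE \<xi> in lborel. Q \<xi>" for Q :: "real^'n \<Rightarrow> bool"
    by (rule AE_ball_countable'[OF AE_lborel_translate[OF that] countable_int_lattice])
  have T_lattice: "(*v) ?T ` int_lattice \<subseteq> int_lattice"
    using transpose_int_lattice[OF integral] by (simp only: image_subset_iff) blast
  interpret M: refinable_pair A \<Phi> r G \<Psi> r G
  proof
    show "AE \<xi> in lborel. (\<lambda>\<phi>. (cmod (G \<phi> \<xi>))\<^sup>2) summable_on \<Phi>"
      using summable[unfolded AE_completion_iff] eq
    proof eventually_elim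
      case (elim \<xi>)
      then show ?case by (subst summable_on_cong[where g="\<lambda>\<phi>. (cmod (fourier \<phi> \<xi>))\<^sup>2"]) (auto simp: eq_def)
    qed
    show "AE \<xi> in lborel. \<forall>s \<in> int_lattice - (*v) ?T ` int_lattice.
        - (\<Sum>\<^sub>\<infinity>\<phi>\<in>\<Phi>. G \<phi> \<xi> * cnj (G \<phi> (\<xi> + (2 * pi) *\<^sub>R s))) = (\<Sum>\<psi>\<in>\<Psi>. G \<psi> \<xi> * cnj (G \<psi> (\<xi> + (2 * pi) *\<^sub>R s)))"
      using off_lattice[unfolded AE_completion_iff] eq shifts[OF eq]
    proof eventually_elim
      case (elim \<xi>)
      show ?case
      proof
        fix s assume s: "s \<in> int_lattice - (*v) ?T ` int_lattice"
        have 1: "(\<Sum>\<^sub>\<infinity>\<phi>\<in>\<Phi>. G \<phi> \<xi> * cnj (G \<phi> (\<xi> + (2 * pi) *\<^sub>R s))) = (\<Sum>\<^sub>\<infinity>\<phi>\<in>\<Phi>. fourier \<phi> \<xi> * cnj (fourier \<phi> (\<xi> + (2 * pi) *\<^sub>R s)))"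
          by (rule infsum_cong) (use s elim(2,3) in \<open>auto simp: eq_def\<close>)
        have 2: "(\<Sum>\<psi>\<in>\<Psi>. G \<psi> \<xi> * cnj (G \<psi> (\<xi> + (2 * pi) *\<^sub>R s))) = (\<Sum>\<psi>\<in>\<Psi>. fourier \<psi> \<xi> * cnj (fourier \<psi> (\<xi> + (2 * pi) *\<^sub>R s)))"
          by (rule sum.cong) (use s elim(2,3) in \<open>auto simp: eq_def\<close>)
        show "- (\<Sum>\<^sub>\<infinity>\<phi>\<in>\<Phi>. G \<phi> \<xi> * cnj (G \<phi> (\<xi> + (2 * pi) *\<^sub>R s))) = (\<Sum>\<psi>\<in>\<Psi>. G \<psi> \<xi> * cnj (G \<psi> (\<xi> + (2 * pi) *\<^sub>R s)))"
          unfolding 1 2 using elim(1) s by blast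
      qed
    qed
    show "AE \<xi> in lborel. \<forall>s \<in> (*v) ?T ` int_lattice.
        (\<Sum>\<^sub>\<infinity>\<phi>\<in>\<Phi>. G \<phi> (?B *v \<xi>) * cnj (G \<phi> (?B *v (\<xi> + (2 * pi) *\<^sub>R s))))
        - (\<Sum>\<^sub>\<infinity>\<phi>\<in>\<Phi>. G \<phi> \<xi> * cnj (G \<phi> (\<xi> + (2 * pi) *\<^sub>R s))) = (\<Sum>\<psi>\<in>\<Psi>. G \<psi> \<xi> * cnj (G \<psi> (\<xi> + (2 * pi) *\<^sub>R s)))"
      using on_lattice[unfolded AE_completion_iff] eq shifts[OF eq] eq_B shifts[OF eq_B]
    proof eventually_elim
      case (elim \<xi>)
      show ?case
      proof
        fix s assume s: "s \<in> (*v) ?T ` int_lattice"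
        then have sl: "s \<in> int_lattice" using T_lattice by blast
        have 1: "(\<Sum>\<^sub>\<infinity>\<phi>\<in>\<Phi>. G \<phi> \<xi> * cnj (G \<phi> (\<xi> + (2 * pi) *\<^sub>R s))) = (\<Sum>\<^sub>\<infinity>\<phi>\<in>\<Phi>. fourier \<phi> \<xi> * cnj (fourier \<phi> (\<xi> + (2 * pi) *\<^sub>R s)))"
          by (rule infsum_cong) (use sl elim(2,3) in \<open>auto simp: eq_def\<close>)
        have 2: "(\<Sum>\<psi>\<in>\<Psi>. G \<psi> \<xi> * cnj (G \<psi> (\<xi> + (2 * pi) *\<^sub>R s))) = (\<Sum>\<psi>\<in>\<Psi>. fourier \<psi> \<xi> * cnj (fourier \<psi> (\<xi> + (2 * pi) *\<^sub>R s)))"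
          by (rule sum.cong) (use sl elim(2,3) in \<open>auto simp: eq_def\<close>)
        have 3: "(\<Sum>\<^sub>\<infinity>\<phi>\<in>\<Phi>. G \<phi> (?B *v \<xi>) * cnj (G \<phi> (?B *v (\<xi> + (2 * pi) *\<^sub>R s)))) =
            (\<Sum>\<^sub>\<infinity>\<phi>\<in>\<Phi>. fourier \<phi> (?B *v \<xi>) * cnj (fourier \<phi> (?B *v (\<xi> + (2 * pi) *\<^sub>R s))))"
          by (rule infsum_cong) (use sl elim(4,5) in \<open>auto simp: eq_def\<close>)
        show "(\<Sum>\<^sub>\<infinity>\<phi>\<in>\<Phi>. G \<phi> (?B *v \<xi>) * cnj (G \<phi> (?B *v (\<xi> + (2 * pi) *\<^sub>R s))))
          - (\<Sum>\<^sub>\<infinity>\<phi>\<in>\<Phi>. G \<phi> \<xi> * cnj (G \<phi> (\<xi> + (2 * pi) *\<^sub>R s))) = (\<Sum>\<psi>\<in>\<Psi>. G \<psi> \<xi> * cnj (G \<psi> (\<xi> + (2 * pi) *\<^sub>R s)))"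
          unfolding 1 2 3 using elim(1) s by blast
      qed
    qed
    have sums: "(\<Sum>\<^sub>\<infinity>\<phi>\<in>\<Phi>. (cmod (G \<phi> \<xi>))\<^sup>2) = (\<Sum>\<^sub>\<infinity>\<phi>\<in>\<Phi>. (cmod (fourier \<phi> \<xi>))\<^sup>2)" if "eq \<xi>" for \<xi>
      by (rule infsum_cong) (use that in \<open>auto simp: eq_def\<close>)
    have "AE \<xi> in lborel. \<forall>m. eq (((*v) ?T ^^ m) \<xi>)"
      unfolding AE_all_countable by (intro allI AE_funpow_matrix[OF det_T eq])
    with limit_infinity[unfolded AE_completion_iff]
    show "AE \<xi> in lborel. (\<lambda>m. \<Sum>\<^sub>\<infinity>\<phi>\<in>\<Phi>. (cmod (G \<phi> (((*v) ?T ^^ m) \<xi>)))\<^sup>2) \<longlonglongrightarrow> 0"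
      by eventually_elim (simp only: sums)
    have "AE \<xi> in lborel. \<forall>m. eq (((*v) ?B ^^ m) \<xi>)"
      unfolding AE_all_countable by (intro allI AE_funpow_matrix[OF det_B eq])
    with limit_zero[unfolded AE_completion_iff]
    show "AE \<xi> in lborel. (\<lambda>m. \<Sum>\<^sub>\<infinity>\<phi>\<in>\<Phi>. (cmod (G \<phi> (((*v) ?B ^^ m) \<xi>)))\<^sup>2) \<longlonglongrightarrow> 1"
      by eventually_elim (simp only: sums)
  qed (rule integral Phi Psi G(1); simp)+
  let ?e = "\<lambda>(j, k, \<psi>). zpow (dilation A) j (translation k \<psi>)"
  let ?e' = "\<lambda>(j, k, \<psi>). zpow (dilation A) j (translation k (r \<psi>))"
  have e': "sq_integrable lborel (?e' p)" "AE x in lborel. ?e p x = ?e' p x" if p_in: "p \<in> (UNIV :: int set) \<times> (int_lattice :: (real^'n) set) \<times> \<Psi>" for p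
  proof -
    obtain j k \<psi> where p: "p = (j, k, \<psi>)" "\<psi> \<in> \<Psi>" using p_in by (cases p rule: prod_cases3) auto
    show "sq_integrable lborel (?e' p)"
      using r(1)[of \<psi>] p by (auto intro!: zpow_dilation_sq[OF E.det_nz] translation_sq_integrable)
    show "AE x in lborel. ?e p x = ?e' p x"
      using AE_zpow_dilation_translation[OF E.det_nz r(2)[of \<psi>], of j k] p by simp
  qed
  show ?thesis
    unfolding normalized_tight_frame_def
  proof (intro conjI ballI)
    fix p :: "int \<times> (real^'n) \<times> (real^'n \<Rightarrow> complex)" assume p: "p \<in> UNIV \<times> int_lattice \<times> \<Psi>"
    show "?e p \<in> L2"
      using L2_iff_sq_integrable(1)[OF _ e'(2)[OF p]] e'(1)[OF p] by (simp add: sq_integrable_def)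
  next
    fix f :: "real^'n \<Rightarrow> complex" assume "f \<in> L2"
    then obtain f' where f': "sq_integrable lborel f'" "AE x in lborel. f x = f' x" by (rule L2_representative)
    have n: "(l2_norm f)\<^sup>2 = nrm2 lborel f'"
      by (rule L2_iff_sq_integrable(2)[OF _ f'(2)]) (use f'(1) in \<open>simp add: sq_integrable_def\<close>)
    have "((\<lambda>p. (cmod (ip lborel f' (?e' p)))\<^sup>2) has_sum nrm2 lborel f') (UNIV \<times> int_lattice \<times> \<Psi>)"
      using M.tight_frame[OF f'(1)] by (simp add: case_prod_unfold)
    then show "((\<lambda>p. (cmod (l2_inner f (?e p)))\<^sup>2) has_sum (l2_norm f)\<^sup>2) (UNIV \<times> int_lattice \<times> \<Psi>)"
      unfolding n
    proof (rule has_sum_cong[THEN iffD1, rotated])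
      fix p :: "int \<times> (real^'n) \<times> (real^'n \<Rightarrow> complex)" assume p: "p \<in> UNIV \<times> int_lattice \<times> \<Psi>"
      show "(cmod (ip lborel f' (?e' p)))\<^sup>2 = (cmod (l2_inner f (?e p)))\<^sup>2"
        unfolding l2_inner_eq_ip[OF f' e'[OF p]] ..
    qed
  qed
qed

end
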